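(* Let $p$ be an odd prime and let $S\in\gimel_p$ be hyperelliptic. Then $S$ can be represented by the affine curve in $\mathbb{C}^2$ $$y^2=(x^p-a^p)\left(x^p+\frac{1}{a^p}\right)$$ for some nonzero $a\in\mathbb{C}$.
   Context: $\gimel_p$ is the set of compact Riemann surfaces $S$ having an automorphism $T_S$ of order $p$ with $S/\langle T_S\rangle\simeq\mathbb{P}^1$ and exactly four fixed points (so $S$ has genus $p-1$). "Represented by an affine curve" means that $S$ is isomorphic to the compact Riemann surface (smooth projective model) of that curve. *)

theory Defs
  imports "HOL-Complex_Analysis.Complex_Analysis" "HOL-Computational_Algebra.Primes"
begin

section \<open>Riemann surfaces\<close>

text \<open>
  A surface is given by a topology, whose \<^term>\<open>topspace\<close> is the set of points, and a set of
  complex charts \<open>(U, \<phi>)\<close>. The atlas need not be maximal; all notions below depend only on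
  the complex structure it generates. Charts are total functions that matter only on their domains.
\<close>

record 'a surface =
  surf_top :: "'a topology"
  atlas :: "('a set \<times> ('a \<Rightarrow> complex)) set"

abbreviation points :: "'a surface \<Rightarrow> 'a set" where
  "points X \<equiv> topspace (surf_top X)"

definition complex_chart :: "'a topology \<Rightarrow> 'a set \<Rightarrow> ('a \<Rightarrow> complex) \<Rightarrow> bool" where
  "complex_chart T U \<phi> \<longleftrightarrow> openin T U \<and> open (\<phi> ` U) \<and>
     homeomorphic_map (subtopology T U) (top_of_set (\<phi> ` U)) \<phi>"

text \<open>Second countability is not demanded: it is automatic for compact surfaces.\<close>

definition riemann_surface :: "'a surface \<Rightarrow> bool" where
  "riemann_surface X \<longleftrightarrow>
     points X \<noteq> {} \<and> connected_space (surf_top X) \<and> Hausdorff_space (surf_top X) \<and>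
     (\<forall>(U, \<phi>) \<in> atlas X. complex_chart (surf_top X) U \<phi>) \<and>
     (\<Union>(U, \<phi>) \<in> atlas X. U) = points X \<and>
     (\<forall>(U, \<phi>) \<in> atlas X. \<forall>(V, \<psi>) \<in> atlas X. (\<psi> \<circ> inv_into U \<phi>) holomorphic_on \<phi> ` (U \<inter> V))"

definition compact_riemann_surface :: "'a surface \<Rightarrow> bool" where
  "compact_riemann_surface X \<longleftrightarrow> riemann_surface X \<and> compact_space (surf_top X)"

definition holomorphic_map :: "'a surface \<Rightarrow> 'b surface \<Rightarrow> ('a \<Rightarrow> 'b) \<Rightarrow> bool" where
  "holomorphic_map X Y f \<longleftrightarrow>
     continuous_map (surf_top X) (surf_top Y) f \<and>
     (\<forall>(U, \<phi>) \<in> atlas X. \<forall>(V, \<psi>) \<in> atlas Y.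
        (\<psi> \<circ> f \<circ> inv_into U \<phi>) holomorphic_on \<phi> ` {x \<in> U. f x \<in> V})"

definition biholomorphic_maps :: "'a surface \<Rightarrow> 'b surface \<Rightarrow> ('a \<Rightarrow> 'b) \<Rightarrow> ('b \<Rightarrow> 'a) \<Rightarrow> bool" where
  "biholomorphic_maps X Y f g \<longleftrightarrow>
     holomorphic_map X Y f \<and> holomorphic_map Y X g \<and>
     (\<forall>x \<in> points X. g (f x) = x) \<and> (\<forall>y \<in> points Y. f (g y) = y)"

definition isomorphic_surfaces :: "'a surface \<Rightarrow> 'b surface \<Rightarrow> bool" where
  "isomorphic_surfaces X Y \<longleftrightarrow> (\<exists>f g. biholomorphic_maps X Y f g)"

definition automorphism :: "'a surface \<Rightarrow> ('a \<Rightarrow> 'a) \<Rightarrow> bool" where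
  "automorphism X T \<longleftrightarrow> (\<exists>g. biholomorphic_maps X X T g)"

text \<open>Equality of automorphisms means equality on the points of the surface.\<close>

definition automorphism_of_order :: "'a surface \<Rightarrow> ('a \<Rightarrow> 'a) \<Rightarrow> nat \<Rightarrow> bool" where
  "automorphism_of_order X T n \<longleftrightarrow>
     automorphism X T \<and> 0 < n \<and> (\<forall>x \<in> points X. (T ^^ n) x = x) \<and>
     (\<forall>k. 0 < k \<and> k < n \<longrightarrow> (\<exists>x \<in> points X. (T ^^ k) x \<noteq> x))"

definition restrict_surface :: "'a surface \<Rightarrow> 'a set \<Rightarrow> 'a surface" where
  "restrict_surface X V =
     \<lparr>surf_top = subtopology (surf_top X) V, atlas = (\<lambda>(U, \<phi>). (U \<inter> V, \<phi>)) ` atlas X\<rparr>"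


section \<open>The Riemann sphere\<close>

text \<open>The one-point compactification of the plane, with the coordinates \<open>z\<close> and \<open>1/z\<close>.\<close>

definition riemann_sphere :: "complex option surface" where
  "riemann_sphere =
     \<lparr>surf_top = Alexandroff_compactification euclidean,
      atlas = {(range Some, the),
               (UNIV - {Some 0}, \<lambda>q. case q of None \<Rightarrow> 0 | Some z \<Rightarrow> 1 / z)}\<rparr>"


section \<open>Quotients by cyclic groups of automorphisms\<close>

text \<open>For \<open>T\<close> of finite order this is the orbit under the whole group generated by \<open>T\<close>.\<close>

definition orbit_of :: "('a \<Rightarrow> 'a) \<Rightarrow> 'a \<Rightarrow> 'a set" where
  "orbit_of T x = range (\<lambda>k::nat. (T ^^ k) x)"

text \<open>
  The quotient \<open>X/\<langle>T\<rangle>\<close> is the orbit space with the quotient topology and the (unique) complex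
  structure for which the projection is holomorphic.
\<close>

definition quotient_surface :: "'a surface \<Rightarrow> ('a \<Rightarrow> 'a) \<Rightarrow> 'a set surface \<Rightarrow> bool" where
  "quotient_surface X T Q \<longleftrightarrow>
     riemann_surface Q \<and> points Q = orbit_of T ` points X \<and>
     quotient_map (surf_top X) (surf_top Q) (orbit_of T) \<and>
     holomorphic_map X Q (orbit_of T)"

definition gimel :: "nat \<Rightarrow> 'a surface set" where
  "gimel p = {S. compact_riemann_surface S \<and>
     (\<exists>T. automorphism_of_order S T p \<and>
          (\<exists>Q. quotient_surface S T Q \<and> isomorphic_surfaces Q riemann_sphere) \<and>
          card {x \<in> points S. T x = x} = 4)}"


section \<open>Hyperelliptic surfaces\<close>

text \<open>
  The degree is the number of preimages of all but finitely many points. A constant map into an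
  infinite surface does not have positive degree in this sense.
\<close>

definition has_degree :: "'a surface \<Rightarrow> 'b surface \<Rightarrow> ('a \<Rightarrow> 'b) \<Rightarrow> nat \<Rightarrow> bool" where
  "has_degree X Y f d \<longleftrightarrow> finite {y \<in> points Y. card {x \<in> points X. f x = y} \<noteq> d}"

text \<open>
  The customary restriction to genus at least 2 is not imposed; it holds automatically for the
  members of \<^term>\<open>gimel p\<close> with \<open>p\<close> an odd prime, whose genus is \<open>p - 1\<close>.
\<close>

definition hyperelliptic :: "'a surface \<Rightarrow> bool" where
  "hyperelliptic S \<longleftrightarrow> compact_riemann_surface S \<and>
     (\<exists>f. holomorphic_map S riemann_sphere f \<and> has_degree S riemann_sphere f 2)"


section \<open>The compact Riemann surface of an affine plane curve\<close>

text \<open>The points of the curve \<open>F(x,y) = 0\<close> at which the gradient of \<open>F\<close> does not vanish.\<close>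

definition regular_points :: "(complex \<Rightarrow> complex \<Rightarrow> complex) \<Rightarrow> (complex \<times> complex) set" where
  "regular_points F = {(x, y). F x y = 0 \<and>
     (deriv (\<lambda>u. F u y) x \<noteq> 0 \<or> deriv (\<lambda>v. F x v) y \<noteq> 0)}"

text \<open>
  The regular part of a curve is a complex submanifold of \<open>\<complex>\<^sup>2\<close>: by the implicit function theorem
  it is locally the graph of a holomorphic function of one of the two coordinates, which then
  serves as a local parameter.
\<close>

definition regular_curve :: "(complex \<Rightarrow> complex \<Rightarrow> complex) \<Rightarrow> (complex \<times> complex) surface" where
  "regular_curve F =
     \<lparr>surf_top = top_of_set (regular_points F),
      atlas =
        {(U, fst) | U. openin (top_of_set (regular_points F)) U \<and>
           (\<exists>D g. open D \<and> g holomorphic_on D \<and> U = (\<lambda>x. (x, g x)) ` D)} \<union>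
        {(U, snd) | U. openin (top_of_set (regular_points F)) U \<and>
           (\<exists>D g. open D \<and> g holomorphic_on D \<and> U = (\<lambda>y. (g y, y)) ` D)}\<rparr>"

text \<open>
  \<open>S\<close> is (isomorphic to) the smooth projective model of the irreducible curve \<open>F(x,y) = 0\<close>: the
  compact Riemann surface obtained from the regular part of the curve by adding finitely many
  points. As \<open>S\<close> minus finitely many points is connected, this cannot hold if the regular part of
  the curve is disconnected, as it is for a reducible curve without multiple components.
\<close>

definition represented_by_curve :: "'a surface \<Rightarrow> (complex \<Rightarrow> complex \<Rightarrow> complex) \<Rightarrow> bool" where
  "represented_by_curve S F \<longleftrightarrow> compact_riemann_surface S \<and>
     (\<exists>P. finite P \<and> P \<subseteq> points S \<and>
        isomorphic_surfaces (restrict_surface S (points S - P)) (regular_curve F))"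

end

(*
  The quotient by the automorphism T of order p gives a meromorphic function H of degree p with
  H o T = H, and hyperellipticity gives a function F of degree 2; generically normalised, F has two
  simple poles, and F, F o T, F o T^2 have disjoint pole divisors D0, D1, D2.

  First, T acts on F by a Moebius transformation.  Since F - F o T and F - F o T^2 have only four
  simple poles, the fixed points of T are all their zeros, and the zeros are simple.  Hence
  v = (F - F o T)/(F - F o T^2) has divisor D2 - D1.  A function with at most one simple pole
  b is constant (otherwise g - g o T has two poles and four zeros), so the functions with poles in
  D1 are spanned by 1 and F o T.  Applied to v and to v * (F o T^2) this makes F o T^2 a Moebius
  transform of F o T.

  A coordinate change makes this transformation G o T = w G with a primitive p-th root of unity w,
  and then div G = P1 + P2 - P3 - P4 for the fixed points Pi.  Normalising div H = p P3 - p P4, the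
  function G^p H / ((H - l1)(H - l2)) with li = H(Pi) has no zeros or poles, so that
  G^p = c (H + m/H - e) with m = l1 l2 and e = l1 + l2.  Therefore y = c (H - m/H) satisfies
  y^2 = (G^p + c e)^2 - 4 c^2 m, a product (G^p - A)(G^p - B), and after rescaling A B = -1.
  As G and H separate points, (G, y) maps S - {P3, P4} bijectively onto the affine curve.
*)
theory Submission
  imports Defs "HOL-Number_Theory.Cong"
begin

text \<open>The usual source of the Moebius action is the uniqueness of the hyperelliptic
  involution, which rests on the canonical map and on the genus. Neither appears here: the four
  fixed points do this work, because \<open>g - g \<circ> T\<close> vanishes at each of them and so
  has four poles or is zero. The only global input is that the orders of a meromorphic function sum
  to zero, and this comes from counting points in fibres on a compact surface.

  Oddness of p makes D0, D1 and D2 disjoint: p must divide neither 2 nor 4. The transformation has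
  two distinct fixed values because a parabolic one has infinite order. F takes each value twice,
  and all four fixed points of T lie over these two values, so they split into pairs; this gives the
  divisor of G.

  Functions are total and complex valued. A value at a pole is meaningless, so identities are first
  asserted outside a finite set; they hold at a point as soon as both sides are regular there. At
  the end G and H separate points because the fibres of H are orbits of T, along which G is
  multiplied by \<omega>.\<close>

section \<open>Orders of meromorphic germs at the origin\<close>

text \<open>Only the punctured germ counts, so a meaningless value at 0 is ignored. The zero germ
  satisfies \<open>ord_ge\<close> for every \<open>n\<close> and \<open>ord_eq\<close> for
  none.\<close>

definition ord_ge :: "(complex \<Rightarrow> complex) \<Rightarrow> int \<Rightarrow> bool" where
  "ord_ge \<phi> n \<longleftrightarrow> (\<exists>g. g analytic_on {0} \<and> (\<forall>\<^sub>F z in at 0. \<phi> z = g z * z powi n))"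

definition ord_eq :: "(complex \<Rightarrow> complex) \<Rightarrow> int \<Rightarrow> bool" where
  "ord_eq \<phi> n \<longleftrightarrow> (\<exists>g. g analytic_on {0} \<and> g 0 \<noteq> 0 \<and> (\<forall>\<^sub>F z in at 0. \<phi> z = g z * z powi n))"

lemma ev_nz: "\<forall>\<^sub>F z in at (0::complex). z \<noteq> 0"
  by (simp add: eventually_neq_at_within)

lemma ord_eq_imp_ge: "ord_eq \<phi> n \<Longrightarrow> ord_ge \<phi> n"
  by (auto simp: ord_eq_def ord_ge_def)

lemma ord_ge_cong:
  assumes "\<forall>\<^sub>F z in at 0. \<phi> z = \<psi> z" shows "ord_ge \<phi> n \<longleftrightarrow> ord_ge \<psi> n"
proof -
  have "(\<forall>\<^sub>F z in at 0. \<phi> z = g z * z powi n) \<longleftrightarrow> (\<forall>\<^sub>F z in at 0. \<psi> z = g z * z powi n)" for g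
    by (rule eventually_cong) (use assms in \<open>auto elim: eventually_mono\<close>)
  then show ?thesis by (simp add: ord_ge_def)
qed

lemma ord_eq_cong:
  assumes "\<forall>\<^sub>F z in at 0. \<phi> z = \<psi> z" shows "ord_eq \<phi> n \<longleftrightarrow> ord_eq \<psi> n"
proof -
  have "(\<forall>\<^sub>F z in at 0. \<phi> z = g z * z powi n) \<longleftrightarrow> (\<forall>\<^sub>F z in at 0. \<psi> z = g z * z powi n)" for g
    by (rule eventually_cong) (use assms in \<open>auto elim: eventually_mono\<close>)
  then show ?thesis by (simp add: ord_eq_def)
qed

lemma analytic_imp_ord_ge: "\<phi> analytic_on {0} \<Longrightarrow> ord_ge \<phi> 0"
  unfolding ord_ge_def by (intro exI[of _ \<phi>]) auto

lemma analytic_imp_ord_eq: "\<phi> analytic_on {0} \<Longrightarrow> \<phi> 0 \<noteq> 0 \<Longrightarrow> ord_eq \<phi> 0"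
  unfolding ord_eq_def by (intro exI[of _ \<phi>]) auto

lemma ord_ge_mono: assumes "ord_ge \<phi> n" "m \<le> n" shows "ord_ge \<phi> m"
proof -
  obtain g where g: "g analytic_on {0}" "\<forall>\<^sub>F z in at 0. \<phi> z = g z * z powi n"
    using assms by (auto simp: ord_ge_def)
  have "\<forall>\<^sub>F z in at 0. \<phi> z = (g z * z ^ nat (n - m)) * z powi m"
    using g(2) ev_nz
  proof eventually_elim
    case (elim z)
    have "z powi n = z ^ nat (n - m) * z powi m"
      using elim(2) \<open>m \<le> n\<close> by (simp add: power_int_of_nat[symmetric] power_int_add[symmetric] del: power_int_of_nat)
    then show ?case using elim by simp
  qed
  moreover have "(\<lambda>z. g z * z ^ nat (n - m)) analytic_on {0}" by (intro analytic_intros g)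
  ultimately show ?thesis unfolding ord_ge_def by blast
qed

lemma ord_ge_add: assumes "ord_ge \<phi> n" "ord_ge \<psi> n" shows "ord_ge (\<lambda>z. \<phi> z + \<psi> z) n"
proof -
  obtain g h where g: "g analytic_on {0}" "\<forall>\<^sub>F z in at 0. \<phi> z = g z * z powi n"
    and h: "h analytic_on {0}" "\<forall>\<^sub>F z in at 0. \<psi> z = h z * z powi n"
    using assms by (auto simp: ord_ge_def)
  have "\<forall>\<^sub>F z in at 0. \<phi> z + \<psi> z = (g z + h z) * z powi n"
    using g(2) h(2) by eventually_elim (simp add: algebra_simps)
  moreover have "(\<lambda>z. g z + h z) analytic_on {0}" by (intro analytic_intros g h)
  ultimately show ?thesis unfolding ord_ge_def by blast
qed

lemma ord_ge_mult: assumes "ord_ge \<phi> n" "ord_ge \<psi> m" shows "ord_ge (\<lambda>z. \<phi> z * \<psi> z) (n + m)"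
proof -
  obtain g h where g: "g analytic_on {0}" "\<forall>\<^sub>F z in at 0. \<phi> z = g z * z powi n"
    and h: "h analytic_on {0}" "\<forall>\<^sub>F z in at 0. \<psi> z = h z * z powi m"
    using assms by (auto simp: ord_ge_def)
  have "\<forall>\<^sub>F z in at 0. \<phi> z * \<psi> z = (g z * h z) * z powi (n + m)"
    using g(2) h(2) ev_nz by eventually_elim (simp add: power_int_add)
  moreover have "(\<lambda>z. g z * h z) analytic_on {0}" by (intro analytic_intros g h)
  ultimately show ?thesis unfolding ord_ge_def by blast
qed

lemma ord_eq_mult: assumes "ord_eq \<phi> n" "ord_eq \<psi> m" shows "ord_eq (\<lambda>z. \<phi> z * \<psi> z) (n + m)"
proof -
  obtain g h where g: "g analytic_on {0}" "g 0 \<noteq> 0" "\<forall>\<^sub>F z in at 0. \<phi> z = g z * z powi n"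
    and h: "h analytic_on {0}" "h 0 \<noteq> 0" "\<forall>\<^sub>F z in at 0. \<psi> z = h z * z powi m"
    using assms by (auto simp: ord_eq_def)
  have "\<forall>\<^sub>F z in at 0. \<phi> z * \<psi> z = (g z * h z) * z powi (n + m)"
    using g(3) h(3) ev_nz by eventually_elim (simp add: power_int_add)
  moreover have "(\<lambda>z. g z * h z) analytic_on {0}" by (intro analytic_intros g h)
  ultimately show ?thesis unfolding ord_eq_def using g(2) h(2) by fastforce
qed

lemma ord_eq_inverse: assumes "ord_eq \<phi> n" shows "ord_eq (\<lambda>z. inverse (\<phi> z)) (- n)"
proof -
  obtain g where g: "g analytic_on {0}" "g 0 \<noteq> 0" "\<forall>\<^sub>F z in at 0. \<phi> z = g z * z powi n"
    using assms by (auto simp: ord_eq_def)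
  have "\<forall>\<^sub>F z in at 0. inverse (\<phi> z) = inverse (g z) * z powi (- n)"
    using g(3) by eventually_elim (simp add: power_int_minus)
  moreover have "(\<lambda>z. inverse (g z)) analytic_on {0}" by (rule analytic_on_inverse) (use g in auto)
  ultimately show ?thesis unfolding ord_eq_def using g(2) by fastforce
qed

lemma ord_eq_divide:
  assumes "ord_eq \<phi> n" "ord_eq \<psi> m" shows "ord_eq (\<lambda>z. \<phi> z / \<psi> z) (n - m)"
  using ord_eq_mult[OF assms(1) ord_eq_inverse[OF assms(2)]] by (simp add: divide_inverse)

lemma ord_eq_const: "c \<noteq> 0 \<Longrightarrow> ord_eq (\<lambda>z. c) 0"
  by (rule analytic_imp_ord_eq) auto

lemma ord_ge_const: "ord_ge (\<lambda>z. c) 0"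
  by (rule analytic_imp_ord_ge) auto

lemma ord_ge_cmult: "ord_ge \<phi> n \<Longrightarrow> ord_ge (\<lambda>z. c * \<phi> z) n"
  using ord_ge_mult[OF ord_ge_const[of c]] by fastforce

lemma ord_ge_diff: "ord_ge \<phi> n \<Longrightarrow> ord_ge \<psi> n \<Longrightarrow> ord_ge (\<lambda>z. \<phi> z - \<psi> z) n"
  using ord_ge_add[of \<phi> n "\<lambda>z. (-1) * \<psi> z"] ord_ge_cmult[of \<psi> n "-1"] by simp

lemma ord_eq_power: "ord_eq \<phi> n \<Longrightarrow> ord_eq (\<lambda>z. \<phi> z ^ k) (int k * n)"
proof (induction k)
  case 0 show ?case using ord_eq_const[of 1] by simp
next
  case (Suc k)
  show ?case using ord_eq_mult[OF Suc.prems Suc.IH[OF Suc.prems]] by (simp add: algebra_simps)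
qed

lemma ord_eq_nz: assumes "ord_eq \<phi> n" shows "\<forall>\<^sub>F z in at 0. \<phi> z \<noteq> 0"
proof -
  obtain g where g: "g analytic_on {0}" "g 0 \<noteq> 0" "\<forall>\<^sub>F z in at 0. \<phi> z = g z * z powi n"
    using assms by (auto simp: ord_eq_def)
  have "isCont g 0" using g(1) analytic_at_imp_isCont by blast
  then have "(g \<longlongrightarrow> g 0) (at 0)" by (simp add: isCont_def)
  then have "\<forall>\<^sub>F z in at 0. g z \<noteq> 0" using g(2) by (rule tendsto_imp_eventually_ne)
  with g(3) ev_nz show ?thesis by eventually_elim simp
qed

lemma ord_ge_pos_tendsto: assumes "ord_ge \<phi> n" "n > 0" shows "(\<phi> \<longlongrightarrow> 0) (at 0)"
proof -
  obtain g where g: "g analytic_on {0}" "\<forall>\<^sub>F z in at 0. \<phi> z = g z * z powi 1"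
    using ord_ge_mono[OF assms(1), of 1] assms(2) by (auto simp: ord_ge_def)
  have "isCont g 0" using g(1) analytic_at_imp_isCont by blast
  then have "((\<lambda>z. g z * z) \<longlongrightarrow> g 0 * 0) (at 0)" by (intro tendsto_mult) (auto simp: isCont_def)
  then have "((\<lambda>z. g z * z) \<longlongrightarrow> 0) (at 0)" by simp
  then show ?thesis by (rule Lim_transform_eventually) (use g(2) in \<open>auto elim: eventually_mono\<close>)
qed

lemma ord_ge_tendsto: assumes "ord_ge \<phi> 0" obtains l where "(\<phi> \<longlongrightarrow> l) (at 0)"
proof -
  obtain g where g: "g analytic_on {0}" "\<forall>\<^sub>F z in at 0. \<phi> z = g z"
    using assms by (auto simp: ord_ge_def)
  have "isCont g 0" using g(1) analytic_at_imp_isCont by blast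
  then have "(g \<longlongrightarrow> g 0) (at 0)" by (simp add: isCont_def)
  then show ?thesis
    using that Lim_transform_eventually g(2) by (metis (mono_tags, lifting) eventually_mono)
qed

lemma ord_eq_zero_tendsto: assumes "ord_eq \<phi> 0" obtains l where "(\<phi> \<longlongrightarrow> l) (at 0)" "l \<noteq> 0"
proof -
  obtain g where g: "g analytic_on {0}" "g 0 \<noteq> 0" "\<forall>\<^sub>F z in at 0. \<phi> z = g z"
    using assms by (auto simp: ord_eq_def)
  have "isCont g 0" using g(1) analytic_at_imp_isCont by blast
  then have "(g \<longlongrightarrow> g 0) (at 0)" by (simp add: isCont_def)
  then show ?thesis
    using that g(2) Lim_transform_eventually g(3) by (metis (mono_tags, lifting) eventually_mono)
qed

text \<open>Otherwise \<open>\<phi> * inverse \<phi>\<close>, which is 1 near the origin, would have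
  positive order and tend to 0.\<close>

lemma ord_ge_eq_le: assumes "ord_eq \<phi> m" "ord_ge \<phi> n" shows "n \<le> m"
proof (rule ccontr)
  assume "\<not> n \<le> m"
  then have n: "n - m > 0" by simp
  have "ord_ge (\<lambda>z. \<phi> z * inverse (\<phi> z)) (n - m)"
    using ord_ge_mult[OF assms(2) ord_eq_imp_ge[OF ord_eq_inverse[OF assms(1)]]] by simp
  then have "((\<lambda>z. \<phi> z * inverse (\<phi> z)) \<longlongrightarrow> 0) (at 0)" using n by (rule ord_ge_pos_tendsto)
  then have "((\<lambda>z. 1::complex) \<longlongrightarrow> 0) (at (0::complex))"
    by (rule Lim_transform_eventually) (use ord_eq_nz[OF assms(1)] in \<open>auto elim: eventually_mono\<close>)
  then show False by (simp add: tendsto_const_iff)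
qed

lemma ord_eq_unique: "ord_eq \<phi> m \<Longrightarrow> ord_eq \<phi> n \<Longrightarrow> m = n"
  by (meson ord_ge_eq_le ord_eq_imp_ge order_antisym)

text \<open>The analytic factor either vanishes on a disc or has a zero of finite order, and this
  order is added to \<open>n\<close>.\<close>

lemma ord_ge_cases:
  assumes "ord_ge \<phi> n"
  shows "(\<forall>\<^sub>F z in at 0. \<phi> z = 0) \<or> (\<exists>m\<ge>n. ord_eq \<phi> m)"
proof -
  obtain g where g: "g analytic_on {0}" "\<forall>\<^sub>F z in at 0. \<phi> z = g z * z powi n"
    using assms by (auto simp: ord_ge_def)
  obtain r where r: "r > 0" "g holomorphic_on ball 0 r"
    using g(1) by (auto simp: analytic_on_def)
  show ?thesis
  proof (cases "\<exists>w\<in>ball 0 r. g w \<noteq> 0")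
    case False
    have "\<forall>\<^sub>F z in at 0. z \<in> ball (0::complex) r"
      using r(1) by (intro eventually_at_in_open') auto
    with g(2) have "\<forall>\<^sub>F z in at 0. \<phi> z = 0" by eventually_elim (use False in auto)
    then show ?thesis ..
  next
    case True
    obtain s where s: "s > 0" "zor_poly g 0 holomorphic_on cball 0 s"
      "\<forall>w\<in>cball 0 s. g w = zor_poly g 0 w * (w - 0) ^ nat (zorder g 0) \<and> zor_poly g 0 w \<noteq> 0"
      using conjunct2[OF zorder_exist_zero[OF r(2) open_ball connected_ball centre_in_ball[THEN iffD2, OF r(1)] True]]
      by blast
    have an: "zor_poly g 0 analytic_on {0}"
      using s(1) holomorphic_on_subset[OF s(2) ball_subset_cball] by (auto simp: analytic_on_def)
    have "\<forall>\<^sub>F z in at 0. z \<in> ball (0::complex) s"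
      using s(1) by (intro eventually_at_in_open') auto
    with g(2) ev_nz have "\<forall>\<^sub>F z in at 0. \<phi> z = zor_poly g 0 z * z powi (n + int (nat (zorder g 0)))"
    proof eventually_elim
      case (elim z)
      have "g z = zor_poly g 0 z * z ^ nat (zorder g 0)" using s(3) elim(3) by simp
      then show ?case using elim(1,2) by (simp add: power_int_add mult.commute del: int_nat_eq)
    qed
    then have "ord_eq \<phi> (n + int (nat (zorder g 0)))"
      unfolding ord_eq_def using an s(1,3) by (intro exI[of _ "zor_poly g 0"]) simp
    then show ?thesis by (intro disjI2 exI[of _ "n + int (nat (zorder g 0))"]) simp
  qed
qed

text \<open>Were the order of the sum larger, subtracting \<open>\<psi>\<close> would give
  \<open>\<phi>\<close> an order larger than \<open>n\<close>.\<close>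

lemma ord_eq_add:
  assumes "ord_eq \<phi> n" "ord_ge \<psi> m" "n < m" shows "ord_eq (\<lambda>z. \<phi> z + \<psi> z) n"
proof -
  have ge: "ord_ge (\<lambda>z. \<phi> z + \<psi> z) n"
    using assms by (intro ord_ge_add) (auto intro: ord_eq_imp_ge ord_ge_mono)
  have no: "\<not> ord_ge (\<lambda>z. \<phi> z + \<psi> z) (n + 1)"
  proof
    assume "ord_ge (\<lambda>z. \<phi> z + \<psi> z) (n + 1)"
    moreover have "ord_ge \<psi> (n + 1)" using assms by (auto intro: ord_ge_mono)
    ultimately have "ord_ge (\<lambda>z. \<phi> z + \<psi> z - \<psi> z) (n + 1)" by (rule ord_ge_diff)
    then show False using ord_ge_eq_le[OF assms(1)] by force
  qed
  from ord_ge_cases[OF ge] show ?thesis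
  proof
    assume "\<forall>\<^sub>F z in at 0. \<phi> z + \<psi> z = 0"
    then have "ord_ge (\<lambda>z. \<phi> z + \<psi> z) (n + 1) \<longleftrightarrow> ord_ge (\<lambda>z. 0) (n + 1)" by (rule ord_ge_cong)
    moreover have "ord_ge (\<lambda>z. 0) (n + 1)" unfolding ord_ge_def by (intro exI[of _ "\<lambda>z. 0"]) auto
    ultimately show ?thesis using no by blast
  next
    assume "\<exists>m\<ge>n. ord_eq (\<lambda>z. \<phi> z + \<psi> z) m"
    then obtain k where k: "k \<ge> n" "ord_eq (\<lambda>z. \<phi> z + \<psi> z) k" by blast
    have "\<not> n + 1 \<le> k" using no ord_ge_mono[OF ord_eq_imp_ge[OF k(2)]] by blast
    then have "k = n" using k(1) by simp
    then show ?thesis using k by simp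
  qed
qed

text \<open>The constant is the limit of \<open>\<phi> / \<psi>\<close>. Subtracting this multiple
  removes a leading term, in particular a simple pole.\<close>

lemma ord_ge_kill:
  assumes "ord_ge \<phi> n" "ord_eq \<psi> n" obtains c where "ord_ge (\<lambda>z. \<phi> z - c * \<psi> z) (n + 1)"
proof -
  have "ord_ge (\<lambda>z. \<phi> z * inverse (\<psi> z)) 0"
    using ord_ge_mult[OF assms(1) ord_eq_imp_ge[OF ord_eq_inverse[OF assms(2)]]] by simp
  then obtain g where g: "g analytic_on {0}" "\<forall>\<^sub>F z in at 0. \<phi> z * inverse (\<psi> z) = g z"
    by (auto simp: ord_ge_def)
  have "(\<lambda>z. g z - g 0) analytic_on {0}" by (intro analytic_intros g)
  then have "ord_ge (\<lambda>z. g z - g 0) 0" by (rule analytic_imp_ord_ge)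
  then have "ord_ge (\<lambda>z. g z - g 0) 1"
  proof (rule disjE[OF ord_ge_cases], goal_cases)
    case 1
    then have "ord_ge (\<lambda>z. g z - g 0) 1 \<longleftrightarrow> ord_ge (\<lambda>z. 0) 1" by (intro ord_ge_cong) simp
    moreover have "ord_ge (\<lambda>z. 0) 1" unfolding ord_ge_def by (intro exI[of _ "\<lambda>z. 0"]) auto
    ultimately show ?case by blast
  next
    case 2
    then obtain m where m: "m \<ge> 0" "ord_eq (\<lambda>z. g z - g 0) m" by blast
    have "m \<noteq> 0"
    proof
      assume "m = 0"
      then obtain l where "((\<lambda>z. g z - g 0) \<longlongrightarrow> l) (at 0)" "l \<noteq> 0" using m ord_eq_zero_tendsto by blast
      moreover have "((\<lambda>z. g z - g 0) \<longlongrightarrow> g 0 - g 0) (at 0)"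
        using analytic_at_imp_isCont[of g 0] g(1) by (intro tendsto_diff) (auto simp: isCont_def)
      ultimately show False using LIM_unique by fastforce
    qed
    then show ?case using m by (intro ord_ge_mono[OF ord_eq_imp_ge]) auto
  qed
  from ord_ge_mult[OF this ord_eq_imp_ge[OF assms(2)]]
  have *: "ord_ge (\<lambda>z. (g z - g 0) * \<psi> z) (n + 1)" by (simp add: add.commute)
  have e: "\<forall>\<^sub>F z in at 0. (g z - g 0) * \<psi> z = \<phi> z - g 0 * \<psi> z"
    using g(2) ord_eq_nz[OF assms(2)] by eventually_elim (auto simp: field_simps)
  have "ord_ge (\<lambda>z. \<phi> z - g 0 * \<psi> z) (n + 1)" using * ord_ge_cong[OF e] by blast
  then show ?thesis by (rule that)
qed

lemma ord_ge_diff_limit: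
  assumes "ord_ge \<phi> 0" "(\<phi> \<longlongrightarrow> l) (at 0)" shows "ord_ge (\<lambda>z. \<phi> z - l) 1"
proof -
  obtain c where c: "ord_ge (\<lambda>z. \<phi> z - c * 1) (0 + 1)"
    using ord_ge_kill[OF assms(1) ord_eq_const[of 1]] by auto
  then have "((\<lambda>z. \<phi> z - c * 1) \<longlongrightarrow> 0) (at 0)" by (rule ord_ge_pos_tendsto) auto
  then have "(\<phi> \<longlongrightarrow> c) (at 0)" by (simp add: LIM_zero_iff)
  with assms(2) have "c = l" using LIM_unique by blast
  with c show ?thesis by simp
qed

lemma ord_eq_neg_filterlim: assumes "ord_eq \<phi> n" "n < 0" shows "filterlim \<phi> at_infinity (at 0)"
proof -
  have "((\<lambda>z. inverse (\<phi> z)) \<longlongrightarrow> 0) (at 0)"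
    by (rule ord_ge_pos_tendsto[OF ord_eq_imp_ge[OF ord_eq_inverse[OF assms(1)]]]) (use assms in auto)
  moreover have "\<forall>\<^sub>F z in at 0. inverse (\<phi> z) \<noteq> 0" using ord_eq_nz[OF assms(1)] by simp
  ultimately have "filterlim (\<lambda>z. inverse (\<phi> z)) (at 0) (at 0)" by (simp add: filterlim_at)
  then have "filterlim (\<lambda>z. inverse (inverse (\<phi> z))) at_infinity (at 0)"
    by (rule filterlim_compose[OF filterlim_inverse_at_infinity])
  then show ?thesis by simp
qed

text \<open>Orders do not depend on the local parameter: near 0, \<open>\<tau> z = s z * z\<close>
  with \<open>s 0 = deriv \<tau> 0\<close>, so the n-th power of \<open>\<tau>\<close> is the n-th
  power of z times a unit.\<close>

lemma ord_ge_compose: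
  assumes "ord_ge \<phi> n" "\<tau> analytic_on {0}" "\<tau> 0 = 0" "deriv \<tau> 0 \<noteq> 0"
  shows "ord_ge (\<lambda>z. \<phi> (\<tau> z)) n"
proof -
  obtain g where g: "g analytic_on {0}" "\<forall>\<^sub>F z in at 0. \<phi> z = g z * z powi n"
    using assms by (auto simp: ord_ge_def)
  have o1: "ord_ge \<tau> 1" using ord_ge_diff_limit[OF analytic_imp_ord_ge[OF assms(2)], of 0]
      analytic_at_imp_isCont[OF assms(2)] assms(3) by (simp add: isCont_def)
  then obtain s where s: "s analytic_on {0}" "\<forall>\<^sub>F z in at 0. \<tau> z = s z * z" by (auto simp: ord_ge_def)
  have "(s \<longlongrightarrow> s 0) (at 0)" using analytic_at_imp_isCont[OF s(1)] by (simp add: isCont_def)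
  moreover have "(s \<longlongrightarrow> deriv \<tau> 0) (at 0)"
  proof -
    have "\<tau> field_differentiable at 0" using assms(2) by (simp add: analytic_on_imp_differentiable_at)
    then have "((\<lambda>z. (\<tau> z - \<tau> 0) / (z - 0)) \<longlongrightarrow> deriv \<tau> 0) (at 0)"
      by (metis DERIV_deriv_iff_field_differentiable has_field_derivative_iff)
    then show ?thesis
      by (rule Lim_transform_eventually)
        (use s(2) ev_nz in eventually_elim, auto simp: assms(3))
  qed
  ultimately have "s 0 = deriv \<tau> 0" by (rule LIM_unique)
  then have s0: "s 0 \<noteq> 0" using assms(4) by simp
  have "ord_eq \<tau> 1" unfolding ord_eq_def using s s0 by fastforce
  then have nz: "\<forall>\<^sub>F z in at 0. \<tau> z \<noteq> 0" by (rule ord_eq_nz)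
  have "(\<tau> \<longlongrightarrow> 0) (at 0)" using ord_ge_pos_tendsto[OF o1] by simp
  with nz have "filterlim \<tau> (at 0) (at 0)" by (simp add: filterlim_at)
  then have "\<forall>\<^sub>F z in at 0. \<phi> (\<tau> z) = g (\<tau> z) * \<tau> z powi n"
    by (rule eventually_compose_filterlim[OF g(2)])
  with s(2) have "\<forall>\<^sub>F z in at 0. \<phi> (\<tau> z) = (g (\<tau> z) * s z powi n) * z powi n"
    by eventually_elim (simp add: power_int_mult_distrib)
  moreover have "(\<lambda>z. g (\<tau> z) * s z powi n) analytic_on {0}"
  proof (intro analytic_on_mult analytic_on_power_int s)
    show "(\<lambda>z. g (\<tau> z)) analytic_on {0}"
      using analytic_on_compose[OF assms(2), of g] g(1) assms(3) by (simp add: o_def)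
    show "n \<ge> 0 \<or> (\<forall>x\<in>{0}. s x \<noteq> 0)" using s0 by simp
  qed
  ultimately show ?thesis unfolding ord_ge_def by blast
qed

lemma analytic_nth_root:
  assumes "g analytic_on {0}" "g 0 \<noteq> (0::complex)" "k > 0"
  obtains h where "h analytic_on {0}" "h 0 \<noteq> 0" "\<forall>\<^sub>F z in nhds 0. g z = h z ^ k"
proof -
  define c where "c = exp (Ln (g 0) / of_nat k)"
  have c: "c ^ k = g 0" using assms(2,3) by (simp add: c_def exp_of_nat_mult[symmetric])
  \<comment> \<open>Dividing by \<open>g 0\<close> moves the argument of \<open>Ln\<close> to 1 at
    the origin, away from the branch cut; \<open>c\<close> restores the constant factor.\<close>
  define h where "h = (\<lambda>z. c * exp (Ln (g z / g 0) / of_nat k))"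
  have "(\<lambda>z. Ln (g z / g 0)) analytic_on {0}"
    by (intro analytic_intros assms) (use assms in auto)
  then have "h analytic_on {0}" unfolding h_def by (intro analytic_intros) (use assms in auto)
  moreover have "h 0 \<noteq> 0" by (simp add: h_def c_def)
  moreover have "\<forall>\<^sub>F z in nhds 0. g z \<noteq> 0"
    using tendsto_imp_eventually_ne[OF analytic_at_imp_isCont[OF assms(1), unfolded isCont_def] assms(2)]
      assms(2) by (simp add: eventually_nhds_conv_at)
  then have "\<forall>\<^sub>F z in nhds 0. g z = h z ^ k"
  proof eventually_elim
    case (elim z)
    have "h z ^ k = c ^ k * exp (of_nat k * (Ln (g z / g 0) / of_nat k))"
      unfolding h_def power_mult_distrib by (subst exp_of_nat_mult) simp
    also have "of_nat k * (Ln (g z / g 0) / of_nat k) = Ln (g z / g 0)" using assms(3) by simp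
    also have "exp (Ln (g z / g 0)) = g z / g 0" using elim assms(2) by (intro exp_Ln) simp
    finally show ?case using assms(2) c by simp
  qed
  ultimately show ?thesis using that by blast
qed

section \<open>Number of solutions of an equation near a zero or a pole\<close>

abbreviation fibre :: "(complex \<Rightarrow> complex) \<Rightarrow> real \<Rightarrow> complex \<Rightarrow> complex set" where
  "fibre \<phi> r c \<equiv> {z \<in> ball 0 r - {0}. \<phi> z = c}"

text \<open>The bound on the radius comes before the value \<open>c\<close>, so that discs can later
  be shrunk to fit prescribed neighbourhoods. The centre is left out because its value may be
  meaningless. The filter will be \<open>at q\<close> near a finite value and
  \<open>at_infinity\<close> near a pole.\<close>

definition local_count :: "(complex \<Rightarrow> complex) \<Rightarrow> nat \<Rightarrow> complex filter \<Rightarrow> bool" where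
  "local_count \<phi> k F \<longleftrightarrow>
     (\<exists>r0>0. \<forall>r. 0 < r \<and> r \<le> r0 \<longrightarrow> (\<forall>\<^sub>F c in F. finite (fibre \<phi> r c) \<and> card (fibre \<phi> r c) = k))"

lemma local_count_0:
  assumes "r0 > 0" "\<forall>\<^sub>F c in F. \<forall>z. z \<noteq> 0 \<and> norm z < r0 \<longrightarrow> \<phi> z \<noteq> c"
  shows "local_count \<phi> 0 F"
  unfolding local_count_def
proof (intro exI[of _ r0] conjI allI impI assms(1))
  fix r assume "0 < r \<and> r \<le> r0"
  then have *: "fibre \<phi> r c = {}" if "\<forall>z. z \<noteq> 0 \<and> norm z < r0 \<longrightarrow> \<phi> z \<noteq> c" for c using that by auto
  show "\<forall>\<^sub>F c in F. finite (fibre \<phi> r c) \<and> card (fibre \<phi> r c) = 0"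
    using assms(2)
  proof eventually_elim
    case (elim c)
    show ?case unfolding *[OF elim] by simp
  qed
qed

text \<open>Transports a count along a change of the target coordinate, either a translation or an
  inversion.\<close>

lemma local_count_compose:
  assumes "local_count \<phi> k F" "filterlim h F F'" "\<And>z c. \<psi> z = c \<longleftrightarrow> \<phi> z = h c"
  shows "local_count \<psi> k F'"
proof -
  obtain r0 where r0: "r0 > 0" "\<forall>r. 0 < r \<and> r \<le> r0 \<longrightarrow>
      (\<forall>\<^sub>F c in F. finite (fibre \<phi> r c) \<and> card (fibre \<phi> r c) = k)"
    using assms(1) by (auto simp: local_count_def)
  have "\<forall>\<^sub>F c in F'. finite (fibre \<psi> r c) \<and> card (fibre \<psi> r c) = k" if "0 < r \<and> r \<le> r0" for r
    unfolding assms(3) by (rule eventually_compose_filterlim[OF r0(2)[rule_format, OF that] assms(2)])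
  then show ?thesis using r0(1) unfolding local_count_def by blast
qed

text \<open>An analytic k-th root of the unit factor makes \<open>\<phi>\<close> the k-th power of a
  local coordinate \<open>\<kappa>\<close>, so the nearby solutions correspond to the k distinct
  k-th roots of \<open>c\<close>.\<close>

lemma ord_eq_pos_count:
  assumes "ord_eq \<phi> (int k)" "k > 0" shows "local_count \<phi> k (at 0)"
proof -
  obtain g where g: "g analytic_on {0}" "g 0 \<noteq> 0" "\<forall>\<^sub>F z in at 0. \<phi> z = g z * z powi int k"
    using assms by (auto simp: ord_eq_def)
  obtain h where h: "h analytic_on {0}" "h 0 \<noteq> 0" "\<forall>\<^sub>F z in nhds 0. g z = h z ^ k"
    using analytic_nth_root[OF g(1,2) assms(2)] .
  define \<kappa> where "\<kappa> = (\<lambda>z. z * h z)"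
  have kan: "\<kappa> analytic_on {0}" unfolding \<kappa>_def by (intro analytic_intros h)
  then obtain r1 where r1: "r1 > 0" "\<kappa> holomorphic_on ball 0 r1" by (auto simp: analytic_on_def)
  have "(h has_field_derivative deriv h 0) (at 0)"
    using h(1) by (simp add: analytic_on_imp_differentiable_at DERIV_deriv_iff_field_differentiable)
  then have "(\<kappa> has_field_derivative (1 * h 0 + deriv h 0 * 0)) (at 0)"
    unfolding \<kappa>_def by (intro DERIV_mult) (auto intro!: derivative_eq_intros)
  then have dk: "deriv \<kappa> 0 \<noteq> 0" using h(2) by (simp add: DERIV_imp_deriv)
  obtain r2 where r2: "r2 > 0" "ball (0::complex) r2 \<subseteq> ball 0 r1" "inj_on \<kappa> (ball 0 r2)"
    by (rule has_complex_derivative_locally_injective[OF r1(2) centre_in_ball[THEN iffD2, OF r1(1)] open_ball dk])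
  have "\<forall>\<^sub>F z in at 0. \<phi> z = \<kappa> z ^ k"
    using g(3) h(3)[unfolded eventually_nhds_conv_at, THEN conjunct1]
    by eventually_elim (simp add: \<kappa>_def power_mult_distrib mult.commute)
  then obtain r3 where r3: "r3 > 0" "\<And>z. z \<noteq> 0 \<Longrightarrow> dist z 0 < r3 \<Longrightarrow> \<phi> z = \<kappa> z ^ k"
    unfolding eventually_at by auto
  define r0 where "r0 = min r2 r3"
  have "r0 > 0" using r2 r3 by (simp add: r0_def)
  moreover have "\<forall>\<^sub>F c in at 0. finite (fibre \<phi> r c) \<and> card (fibre \<phi> r c) = k"
    if r: "0 < r" "r \<le> r0" for r
  proof -
    have sub: "ball (0::complex) r \<subseteq> ball 0 r2" using r by (auto simp: r0_def)
    have inj: "inj_on \<kappa> (ball 0 r)" using r2(3) sub inj_on_subset by blast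
    have hol: "\<kappa> holomorphic_on ball 0 r" using r1(2) sub r2(2) by (meson holomorphic_on_subset)
    have "open (\<kappa> ` ball 0 r)" using open_mapping_thm3[OF hol _ inj] by simp
    moreover have k0: "\<kappa> 0 = 0" by (simp add: \<kappa>_def)
    then have "0 \<in> \<kappa> ` ball 0 r" using r(1) by (metis centre_in_ball image_eqI)
    ultimately obtain d where d: "d > 0" "ball 0 d \<subseteq> \<kappa> ` ball 0 r" by (meson openE)
    \<comment> \<open>A value of norm below \<open>d ^ k\<close> has all its k-th roots inside the
      image of the disc under \<open>\<kappa>\<close>.\<close>
    have "\<forall>\<^sub>F c in at 0. c \<in> ball 0 (d ^ k) - {0::complex}"
      using d(1) by (intro eventually_at_in_open) auto
    then show ?thesis
    proof eventually_elim
      case (elim c)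
      have eq: "\<kappa> ` (fibre \<phi> r c) = {w. w ^ k = c}"
      proof (intro equalityI subsetI)
        fix w assume "w \<in> \<kappa> ` (fibre \<phi> r c)"
        then show "w \<in> {w. w ^ k = c}" using r r3(2) by (auto simp: r0_def)
      next
        fix w assume "w \<in> {w. w ^ k = c}"
        then have w: "w ^ k = c" by simp
        then have "norm w ^ k < d ^ k" using elim by (auto simp: norm_power)
        then have "norm w < d" using d(1) by (meson less_imp_le power_less_imp_less_base)
        then obtain z where z: "z \<in> ball 0 r" "\<kappa> z = w" using d(2) by (force simp: image_iff)
        have "w \<noteq> 0" using w elim assms(2) by (auto simp: power_0_left)
        then have "z \<noteq> 0" using z k0 by auto
        then have "\<phi> z = c" using r3(2)[of z] z w r by (auto simp: r0_def)
        then show "w \<in> \<kappa> ` (fibre \<phi> r c)" using z \<open>z \<noteq> 0\<close> by auto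
      qed
      have inj': "inj_on \<kappa> (fibre \<phi> r c)" using inj by (rule inj_on_subset) auto
      have cc: "c \<noteq> 0" using elim by simp
      have "finite {w. w ^ k = c}" by (rule finite_nth_roots[OF assms(2)])
      then have "finite (\<kappa> ` (fibre \<phi> r c))" by (simp only: eq)
      then have "finite (fibre \<phi> r c)" by (rule finite_imageD[OF _ inj'])
      moreover have "card (fibre \<phi> r c) = k"
        using card_image[OF inj'] card_nth_roots[OF cc assms(2)] by (simp only: eq)
      ultimately show ?case ..
    qed
  qed
  ultimately show ?thesis unfolding local_count_def by blast
qed

lemma ord_eq_neg_count:
  assumes "ord_eq \<phi> (- int k)" "k > 0" shows "local_count \<phi> k at_infinity"
proof (rule local_count_compose)
  have "ord_eq (\<lambda>z. inverse (\<phi> z)) (int k)" using ord_eq_inverse[OF assms(1)] by simp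
  then show "local_count (\<lambda>z. inverse (\<phi> z)) k (at 0)" using assms(2) by (rule ord_eq_pos_count)
  show "filterlim inverse (at (0::complex)) at_infinity"
    by (rule filterlim_inverse_at_iff[THEN iffD2]) (simp add: filterlim_ident)
qed simp

section \<open>Local parameters on a compact Riemann surface\<close>

text \<open>The reciprocal has order at least 0 and is therefore bounded.\<close>

lemma ord_eq_nonpos_bound:
  assumes "ord_eq \<phi> n" "n \<le> 0" obtains d where "d > 0" "\<forall>\<^sub>F z in at 0. norm (\<phi> z) \<ge> d"
proof -
  have "ord_ge (\<lambda>z. inverse (\<phi> z)) 0"
    using ord_ge_mono[OF ord_eq_imp_ge[OF ord_eq_inverse[OF assms(1)]], of 0] assms(2) by simp
  then obtain l where "((\<lambda>z. inverse (\<phi> z)) \<longlongrightarrow> l) (at 0)" by (rule ord_ge_tendsto)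
  then have "((\<lambda>z. norm (inverse (\<phi> z))) \<longlongrightarrow> norm l) (at 0)" by (rule tendsto_norm)
  then have *: "\<forall>\<^sub>F z in at 0. norm (inverse (\<phi> z)) < norm l + 1" by (rule order_tendstoD) simp
  have l: "norm l + 1 > 0" by (rule add_nonneg_pos) auto
  have "\<forall>\<^sub>F z in at 0. norm (\<phi> z) \<ge> inverse (norm l + 1)"
    using * ord_eq_nz[OF assms(1)]
  proof eventually_elim
    case (elim z)
    then have "inverse (norm l + 1) \<le> inverse (inverse (norm (\<phi> z)))"
      by (intro le_imp_inverse_le) (auto simp: norm_inverse)
    then show ?case by simp
  qed
  then show ?thesis using that[of "inverse (norm l + 1)"] l by simp
qed

lemma ord_ge_bound:
  assumes "ord_ge \<phi> 0" obtains b where "\<forall>\<^sub>F z in at 0. norm (\<phi> z) < b"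
proof -
  obtain l where "(\<phi> \<longlongrightarrow> l) (at 0)" using assms by (rule ord_ge_tendsto)
  then have "((\<lambda>z. norm (\<phi> z)) \<longlongrightarrow> norm l) (at 0)" by (rule tendsto_norm)
  then have "\<forall>\<^sub>F z in at 0. norm (\<phi> z) < norm l + 1" by (rule order_tendstoD) simp
  then show ?thesis by (rule that)
qed

lemma eventually_at_0D:
  fixes P :: "complex \<Rightarrow> bool"
  assumes "\<forall>\<^sub>F z in at 0. P z" shows "\<exists>d>0. \<forall>z. z \<noteq> 0 \<and> norm z < d \<longrightarrow> P z"
  using assms by (auto simp: eventually_at dist_norm)

locale rsurface =
  fixes S :: "'a surface"
  assumes rs: "riemann_surface S"
begin

lemma hausdorff: "Hausdorff_space (surf_top S)" and connected: "connected_space (surf_top S)"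
  and nonempty: "points S \<noteq> {}"
  using rs by (auto simp: riemann_surface_def)

lemma chart_facts:
  assumes "(U, \<phi>) \<in> atlas S"
  shows "openin (surf_top S) U" "open (\<phi> ` U)" "inj_on \<phi> U" "U \<subseteq> points S"
    and "\<And>V. openin (surf_top S) V \<Longrightarrow> V \<subseteq> U \<Longrightarrow> open (\<phi> ` V)"
    and "\<And>D. open D \<Longrightarrow> openin (surf_top S) {x \<in> U. \<phi> x \<in> D}"
proof -
  have c: "complex_chart (surf_top S) U \<phi>" using rs assms by (auto simp: riemann_surface_def)
  then show U: "openin (surf_top S) U" and o: "open (\<phi> ` U)" by (auto simp: complex_chart_def)
  then show sub: "U \<subseteq> points S" by (simp add: openin_subset)
  have h: "homeomorphic_map (subtopology (surf_top S) U) (top_of_set (\<phi> ` U)) \<phi>"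
    using c by (auto simp: complex_chart_def)
  have ts: "topspace (subtopology (surf_top S) U) = U" using sub by (auto simp: topspace_subtopology)
  show "inj_on \<phi> U" using homeomorphic_imp_injective_map[OF h] ts by simp
  show "open (\<phi> ` V)" if "openin (surf_top S) V" "V \<subseteq> U" for V
  proof -
    have "openin (subtopology (surf_top S) U) V" using that by (auto simp: openin_subtopology)
    then have "openin (top_of_set (\<phi> ` U)) (\<phi> ` V)"
      using homeomorphic_imp_open_map[OF h] by (auto simp: open_map_def)
    then show ?thesis using o openin_open_trans by blast
  qed
  show "openin (surf_top S) {x \<in> U. \<phi> x \<in> D}" if "open D" for D
  proof -
    have "continuous_map (subtopology (surf_top S) U) (top_of_set (\<phi> ` U)) \<phi>"
      using h by (rule homeomorphic_imp_continuous_map)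
    then have "continuous_map (subtopology (surf_top S) U) euclidean \<phi>"
      by (simp add: continuous_map_in_subtopology)
    then have "openin (subtopology (surf_top S) U) {x \<in> U. \<phi> x \<in> D}"
      using that ts openin_continuous_map_preimage[of _ euclidean \<phi> D] by fastforce
    then show ?thesis using U openin_trans_full by blast
  qed
qed

lemma chart_exists: assumes "x \<in> points S" obtains U \<phi> where "(U, \<phi>) \<in> atlas S" "x \<in> U"
proof -
  have "(\<Union>(U, \<phi>) \<in> atlas S. U) = points S" using rs by (simp add: riemann_surface_def)
  then have "x \<in> (\<Union>(U, \<phi>) \<in> atlas S. U)" using assms by simp
  then show ?thesis using that by auto
qed

end

locale compact_surface = rsurface +
  assumes cpt: "compact_space (surf_top S)"
begin

definition chart_at :: "'a \<Rightarrow> 'a set \<times> ('a \<Rightarrow> complex)" where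
  "chart_at x = (SOME c. c \<in> atlas S \<and> x \<in> fst c)"

definition dom :: "'a \<Rightarrow> 'a set" where "dom x = fst (chart_at x)"
definition crd :: "'a \<Rightarrow> 'a \<Rightarrow> complex" where "crd x = snd (chart_at x)"

text \<open>A local parameter centred at \<open>x\<close>: the inverse of the chosen chart, shifted
  so that 0 goes to \<open>x\<close>. It is total but meaningful only near 0, and statements about
  it are germ statements.\<close>

definition par :: "'a \<Rightarrow> complex \<Rightarrow> 'a" where
  "par x z = inv_into (dom x) (crd x) (crd x x + z)"

lemma chart_at: assumes "x \<in> points S" shows "(dom x, crd x) \<in> atlas S" "x \<in> dom x"
proof -
  obtain U \<phi> where "(U, \<phi>) \<in> atlas S" "x \<in> U" using chart_exists[OF assms] .
  then have "\<exists>c. c \<in> atlas S \<and> x \<in> fst c" by (intro exI[of _ "(U, \<phi>)"]) simp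
  then have "chart_at x \<in> atlas S \<and> x \<in> fst (chart_at x)" unfolding chart_at_def by (rule someI_ex)
  then show "(dom x, crd x) \<in> atlas S" "x \<in> dom x" by (auto simp: dom_def crd_def)
qed

lemma chart_ball:
  assumes "(U, \<phi>) \<in> atlas S" "x \<in> U" "openin (surf_top S) W" "x \<in> W"
  obtains r where "r > 0" "ball (\<phi> x) r \<subseteq> \<phi> ` (U \<inter> W)"
proof -
  have "open (\<phi> ` (U \<inter> W))" using assms chart_facts by (intro chart_facts(5)[OF assms(1)]) auto
  moreover have "\<phi> x \<in> \<phi> ` (U \<inter> W)" using assms by auto
  ultimately show ?thesis using that openE by blast
qed

lemma par_0: "x \<in> points S \<Longrightarrow> par x 0 = x"
  using chart_at[of x] chart_facts(3)[of "dom x" "crd x"] by (simp add: par_def)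

lemma par_ball:
  assumes "x \<in> points S" "openin (surf_top S) W" "x \<in> W"
  shows "\<exists>r0>0. \<forall>r. 0 < r \<and> r \<le> r0 \<longrightarrow> inj_on (par x) (ball 0 r) \<and>
     par x ` ball 0 r \<subseteq> W \<and> openin (surf_top S) (par x ` ball 0 r)"
proof -
  note c = chart_at[OF assms(1)]
  note cf = chart_facts[OF c(1)]
  obtain r0 where r0: "r0 > 0" "ball (crd x x) r0 \<subseteq> crd x ` (dom x \<inter> W)"
    using chart_ball[OF c assms(2,3)] .
  have "inj_on (par x) (ball 0 r) \<and> par x ` ball 0 r \<subseteq> W \<and> openin (surf_top S) (par x ` ball 0 r)"
    if r: "0 < r" "r \<le> r0" for r
  proof -
    have im: "\<exists>y\<in>dom x \<inter> W. crd x y = crd x x + z \<and> par x z = y" if "z \<in> ball 0 r" for z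
    proof -
      have "crd x x + z \<in> ball (crd x x) r0" using that r by (auto simp: dist_norm)
      then obtain y where "y \<in> dom x \<inter> W" "crd x y = crd x x + z" using r0(2) by (metis imageE subsetD)
      moreover from this have "par x z = y" unfolding par_def using inv_into_f_f[OF cf(3), of y] by auto
      ultimately show ?thesis by blast
    qed
    have "inj_on (par x) (ball 0 r)"
      by (rule inj_onI) (metis im add_left_cancel)
    moreover have "par x ` ball 0 r \<subseteq> W" using im by blast
    moreover have "par x ` ball 0 r = {y \<in> dom x. crd x y \<in> ball (crd x x) r}"
    proof (intro equalityI subsetI)
      fix y assume "y \<in> par x ` ball 0 r"
      then show "y \<in> {y \<in> dom x. crd x y \<in> ball (crd x x) r}" using im by (fastforce simp: dist_norm)
    next
      fix y assume y: "y \<in> {y \<in> dom x. crd x y \<in> ball (crd x x) r}"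
      then have "par x (crd x y - crd x x) = y" unfolding par_def using cf(3) by simp
      moreover have "crd x y - crd x x \<in> ball 0 r" using y by (auto simp: dist_norm norm_minus_commute)
      ultimately show "y \<in> par x ` ball 0 r" by (metis image_eqI)
    qed
    then have "openin (surf_top S) (par x ` ball 0 r)" using cf(6)[of "ball (crd x x) r"] by simp
    ultimately show ?thesis by blast
  qed
  with r0(1) show ?thesis by blast
qed

text \<open>Translates between punctured germs in the parameter and punctured neighbourhoods on the
  surface, where topological arguments such as compactness and connectedness apply.\<close>

lemma ev_par_iff:
  assumes "x \<in> points S"
  shows "(\<forall>\<^sub>F z in at 0. P (par x z)) \<longleftrightarrow> (\<exists>W. openin (surf_top S) W \<and> x \<in> W \<and> (\<forall>y\<in>W - {x}. P y))"
proof
  assume "\<forall>\<^sub>F z in at 0. P (par x z)"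
  then obtain d where d: "d > 0" "\<And>z. z \<noteq> 0 \<Longrightarrow> norm z < d \<Longrightarrow> P (par x z)"
    using eventually_at_0D by blast
  obtain r0 where r0: "r0 > 0" "\<And>r. 0 < r \<Longrightarrow> r \<le> r0 \<Longrightarrow> inj_on (par x) (ball 0 r) \<and>
     par x ` ball 0 r \<subseteq> points S \<and> openin (surf_top S) (par x ` ball 0 r)"
    using par_ball[OF assms openin_topspace assms] by blast
  define r where "r = min d r0"
  have r: "0 < r" "r \<le> r0" using d r0 by (auto simp: r_def)
  have "openin (surf_top S) (par x ` ball 0 r)" using r0(2)[OF r] by blast
  moreover have "x \<in> par x ` ball 0 r" using r par_0[OF assms] by (metis centre_in_ball image_eqI)
  moreover have "P y" if y: "y \<in> par x ` ball 0 r - {x}" for y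
  proof -
    obtain z where z: "z \<in> ball 0 r" "y = par x z" using y by blast
    then have "z \<noteq> 0" using y par_0[OF assms] by auto
    then show ?thesis using d(2)[of z] z by (simp add: r_def)
  qed
  ultimately show "\<exists>W. openin (surf_top S) W \<and> x \<in> W \<and> (\<forall>y\<in>W - {x}. P y)" by blast
next
  assume "\<exists>W. openin (surf_top S) W \<and> x \<in> W \<and> (\<forall>y\<in>W - {x}. P y)"
  then obtain W where W: "openin (surf_top S) W" "x \<in> W" "\<forall>y\<in>W - {x}. P y" by blast
  obtain r0 where r0: "r0 > 0" "\<And>r. 0 < r \<Longrightarrow> r \<le> r0 \<Longrightarrow> inj_on (par x) (ball 0 r) \<and>
     par x ` ball 0 r \<subseteq> W \<and> openin (surf_top S) (par x ` ball 0 r)"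
    using par_ball[OF assms W(1,2)] by blast
  have *: "inj_on (par x) (ball 0 r0)" "par x ` ball 0 r0 \<subseteq> W" using r0(2)[OF r0(1)] by auto
  have "\<forall>\<^sub>F z in at 0. z \<in> ball 0 r0 - {0::complex}"
    using r0(1) by (intro eventually_at_in_open) auto
  then show "\<forall>\<^sub>F z in at 0. P (par x z)"
  proof eventually_elim
    case (elim z)
    then have "par x z \<noteq> par x 0" using inj_onD[OF *(1), of z 0] r0(1) by auto
    moreover have "par x z \<in> W" using *(2) elim by blast
    ultimately show ?case using W(3) par_0[OF assms] by auto
  qed
qed

lemma ev_par_in: "x \<in> points S \<Longrightarrow> openin (surf_top S) W \<Longrightarrow> x \<in> W \<Longrightarrow> \<forall>\<^sub>F z in at 0. par x z \<in> W"
  using ev_par_iff[of x "\<lambda>y. y \<in> W"] by blast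

lemma ev_par_points: "x \<in> points S \<Longrightarrow> \<forall>\<^sub>F z in at 0. par x z \<in> points S"
  using ev_par_in[of x "points S"] by auto

lemma closed_finite: "finite A \<Longrightarrow> openin (surf_top S) (points S - A)"
  using closedin_Hausdorff_finite[OF hausdorff, of "A \<inter> points S"]
  by (simp add: closedin_def Diff_Int)

lemma ev_par_notin:
  assumes "x \<in> points S" "finite A" shows "\<forall>\<^sub>F z in at 0. par x z \<notin> A"
proof -
  have "openin (surf_top S) (points S - (A - {x}))" using assms by (intro closed_finite) auto
  then show ?thesis using ev_par_iff[OF assms(1), of "\<lambda>y. y \<notin> A"] assms(1) by blast
qed

lemma ev_par_outside:
  assumes "x \<in> points S" "finite {y \<in> points S. \<not> P y}" shows "\<forall>\<^sub>F z in at 0. P (par x z)"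
  using ev_par_notin[OF assms] ev_par_points[OF assms(1)] by eventually_elim auto

lemma infinite_points: "infinite (points S)"
proof
  assume fin: "finite (points S)"
  obtain x where x: "x \<in> points S" using nonempty by blast
  have "\<forall>\<^sub>F z in at (0::complex). False"
    using ev_par_points[OF x] ev_par_notin[OF x fin] by eventually_elim auto
  then show False by simp
qed

lemma finite_cover:
  assumes "\<And>x. x \<in> points S \<Longrightarrow> openin (surf_top S) (W x) \<and> x \<in> W x"
  obtains F where "F \<subseteq> points S" "finite F" "points S \<subseteq> (\<Union>x\<in>F. W x)"
proof -
  have op: "\<forall>V\<in>W ` points S. openin (surf_top S) V" using assms by auto
  have cov: "points S \<subseteq> \<Union>(W ` points S)" using assms by auto
  have "\<exists>\<F>. finite \<F> \<and> \<F> \<subseteq> W ` points S \<and> points S \<subseteq> \<Union>\<F>"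
    by (rule cpt[unfolded compact_space_alt, THEN spec, THEN mp, OF conjI[OF op cov]])
  then obtain \<F> where F: "finite \<F>" "\<F> \<subseteq> W ` points S" "points S \<subseteq> \<Union>\<F>" by blast
  obtain F' where F': "F' \<subseteq> points S" "finite F'" "\<F> = W ` F'" using finite_subset_image[OF F(1,2)] by blast
  show ?thesis using that[OF F'(1,2)] F(3) F'(3) by simp
qed

text \<open>By compactness finitely many of the neighbourhoods cover the surface, and only their
  centres can be exceptions. The finiteness of zeros and poles comes from here.\<close>

lemma finite_exceptions:
  assumes "\<And>x. x \<in> points S \<Longrightarrow> \<forall>\<^sub>F z in at 0. P (par x z)"
  shows "finite {x \<in> points S. \<not> P x}"
proof -
  have "\<forall>x\<in>points S. \<exists>W. openin (surf_top S) W \<and> x \<in> W \<and> (\<forall>y\<in>W - {x}. P y)"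
    using assms ev_par_iff[where P = P] by simp
  from bchoice[OF this] obtain W
    where W: "\<forall>x\<in>points S. openin (surf_top S) (W x) \<and> x \<in> W x \<and> (\<forall>y\<in>W x - {x}. P y)" ..
  obtain F where F: "F \<subseteq> points S" "finite F" "points S \<subseteq> (\<Union>x\<in>F. W x)"
    by (rule finite_cover[of W]) (use W in auto)
  have "{x \<in> points S. \<not> P x} \<subseteq> F" using F W by blast
  then show ?thesis using F(2) finite_subset by blast
qed

section \<open>Meromorphic functions and their orders\<close>

abbreviation og :: "('a \<Rightarrow> complex) \<Rightarrow> 'a \<Rightarrow> int \<Rightarrow> bool" where
  "og u x n \<equiv> ord_ge (\<lambda>z. u (par x z)) n"

abbreviation oe :: "('a \<Rightarrow> complex) \<Rightarrow> 'a \<Rightarrow> int \<Rightarrow> bool" where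
  "oe u x n \<equiv> ord_eq (\<lambda>z. u (par x z)) n"

text \<open>Values at finitely many points may be arbitrary; equality of meromorphic functions is
  therefore expressed as \<open>finite {x \<in> points S. u x \<noteq> v x}\<close>.\<close>

definition mero :: "('a \<Rightarrow> complex) \<Rightarrow> bool" where
  "mero u \<longleftrightarrow> (\<forall>x\<in>points S. \<exists>n. og u x n)"

text \<open>For a meromorphic function this means that it is not the zero function, by
  \<open>mero_zero_or_nz\<close>; the local form is what divisions need.\<close>

definition nz :: "('a \<Rightarrow> complex) \<Rightarrow> bool" where
  "nz u \<longleftrightarrow> (\<forall>x\<in>points S. \<forall>\<^sub>F z in at 0. u (par x z) \<noteq> 0)"

text \<open>Unlike \<open>og u x 0\<close> this also demands that the value at \<open>x\<close> be
  the limit.\<close>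

definition reg :: "('a \<Rightarrow> complex) \<Rightarrow> 'a \<Rightarrow> bool" where
  "reg u x \<longleftrightarrow> (\<lambda>z. u (par x z)) analytic_on {0}"

text \<open>The identity theorem: the points around which \<open>u\<close> vanishes and those around
  which it has no other zero form two disjoint open sets that cover the connected surface.\<close>

lemma mero_zero_or_nz:
  assumes "mero u" shows "nz u \<or> finite {x \<in> points S. u x \<noteq> 0}"
proof -
  define A where "A = {x \<in> points S. \<forall>\<^sub>F z in at 0. u (par x z) = 0}"
  define B where "B = {x \<in> points S. \<forall>\<^sub>F z in at 0. u (par x z) \<noteq> 0}"
  have op: "openin (surf_top S) {x \<in> points S. \<forall>\<^sub>F z in at 0. P (par x z)}" for P
  proof (subst openin_subopen, intro ballI)
    fix x assume "x \<in> {x \<in> points S. \<forall>\<^sub>F z in at 0. P (par x z)}"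
    then have x: "x \<in> points S" "\<forall>\<^sub>F z in at 0. P (par x z)" by auto
    then obtain W where W: "openin (surf_top S) W" "x \<in> W" "\<forall>y\<in>W - {x}. P y"
      using ev_par_iff by blast
    have "\<forall>\<^sub>F z in at 0. P (par y z)" if y: "y \<in> W" "y \<noteq> x" for y
    proof -
      have yS: "y \<in> points S" using y W(1) openin_subset by blast
      have "openin (surf_top S) (W \<inter> (points S - {x}))" using W(1) closed_finite[of "{x}"] by auto
      then show ?thesis using ev_par_iff[OF yS, of P] y yS W(3) by blast
    qed
    then have "W \<subseteq> {x \<in> points S. \<forall>\<^sub>F z in at 0. P (par x z)}"
      using x openin_subset[OF W(1)] by auto
    then show "\<exists>W. openin (surf_top S) W \<and> x \<in> W \<and> W \<subseteq> {x \<in> points S. \<forall>\<^sub>F z in at 0. P (par x z)}"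
      using W by blast
  qed
  have AB: "points S \<subseteq> A \<union> B"
  proof
    fix x assume x: "x \<in> points S"
    then obtain n where "og u x n" using assms by (auto simp: mero_def)
    then show "x \<in> A \<union> B" using ord_ge_cases[of "\<lambda>z. u (par x z)" n] ord_eq_nz[of "\<lambda>z. u (par x z)"] x
      by (auto simp: A_def B_def)
  qed
  have "A \<inter> B = {}"
  proof -
    have False if x: "x \<in> A" "x \<in> B" for x
    proof -
      have "\<forall>\<^sub>F z in at 0. u (par x z) = 0" "\<forall>\<^sub>F z in at 0. u (par x z) \<noteq> 0"
        using x by (auto simp: A_def B_def)
      then have "\<forall>\<^sub>F z in at (0::complex). False" by eventually_elim auto
      then show False by simp
    qed
    then show ?thesis by blast
  qed
  moreover have "openin (surf_top S) A" "openin (surf_top S) B"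
    unfolding A_def B_def by (rule op)+
  ultimately have "A = {} \<or> B = {}"
    using connected AB unfolding connected_space_def by metis
  then show ?thesis
  proof
    assume "A = {}"
    then show ?thesis using AB by (auto simp: nz_def B_def)
  next
    assume "B = {}"
    then show ?thesis using AB finite_exceptions[of "\<lambda>y. u y = 0"] by (auto simp: A_def)
  qed
qed

lemma nz_oe: assumes "mero u" "nz u" "x \<in> points S" obtains n where "oe u x n"
proof -
  obtain n where n: "og u x n" using assms by (auto simp: mero_def)
  have no: "\<not> (\<forall>\<^sub>F z in at 0. u (par x z) = 0)"
  proof
    assume "\<forall>\<^sub>F z in at 0. u (par x z) = 0"
    moreover have "\<forall>\<^sub>F z in at 0. u (par x z) \<noteq> 0" using assms by (auto simp: nz_def)
    ultimately have "\<forall>\<^sub>F z in at (0::complex). False" by eventually_elim auto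
    then show False by simp
  qed
  then show ?thesis using ord_ge_cases[OF n] that by auto
qed

lemma nz_finite_zeros: "nz u \<Longrightarrow> finite {x \<in> points S. u x = 0}"
  using finite_exceptions[of "\<lambda>x. u x \<noteq> 0"] by (simp add: nz_def)

lemma oe_imp_nz: assumes "mero u" "x \<in> points S" "oe u x n" shows "nz u"
proof (rule ccontr)
  assume "\<not> nz u"
  then have "finite {x \<in> points S. \<not> u x = 0}" using mero_zero_or_nz[OF assms(1)] by blast
  then have "\<forall>\<^sub>F z in at 0. u (par x z) = 0" by (rule ev_par_outside[OF assms(2)])
  with ord_eq_nz[OF assms(3)] have "\<forall>\<^sub>F z in at (0::complex). False" by eventually_elim auto
  then show False by simp
qed

section \<open>Changes of chart and independence of the chosen parameter\<close>

lemma id_holomorphic: "holomorphic_map S S (\<lambda>x. x)"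
proof -
  have "{x \<in> U. x \<in> V} = U \<inter> V" for U V :: "'a set" by auto
  then show ?thesis using rs by (auto simp: holomorphic_map_def riemann_surface_def o_def)
qed

text \<open>The map \<open>T\<close> read in charts. Being injective and holomorphic it has nonzero
  derivative, so it preserves orders. With \<open>T\<close> the identity this is a change of
  chart.\<close>

lemma chart_transition:
  assumes "(U, \<phi>) \<in> atlas S" "(V, \<psi>) \<in> atlas S" "x \<in> U" "T x \<in> V"
    and T: "holomorphic_map S S T" "inj_on T (points S)"
  defines "\<tau> \<equiv> \<lambda>z. \<psi> (T (inv_into U \<phi> (\<phi> x + z))) - \<psi> (T x)"
  shows "\<tau> analytic_on {0}" "\<tau> 0 = 0" "deriv \<tau> 0 \<noteq> 0"
    "\<forall>\<^sub>F z in nhds 0. T (inv_into U \<phi> (\<phi> x + z)) = inv_into V \<psi> (\<psi> (T x) + \<tau> z)"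
proof -
  note cU = chart_facts[OF assms(1)] and cV = chart_facts[OF assms(2)]
  define W where "W = {y \<in> points S. T y \<in> V}"
  have W: "openin (surf_top S) W" unfolding W_def
    using T(1) cV(1) by (auto simp: holomorphic_map_def intro: openin_continuous_map_preimage)
  have xW: "x \<in> W" using assms cU(4) by (auto simp: W_def)
  obtain r where r: "r > 0" "ball (\<phi> x) r \<subseteq> \<phi> ` (U \<inter> W)"
    using chart_ball[OF assms(1,3) W xW] .
  have in1: "inv_into U \<phi> (\<phi> x + z) \<in> U" "T (inv_into U \<phi> (\<phi> x + z)) \<in> V"
    "inv_into U \<phi> (\<phi> x + z) \<in> points S" "\<phi> (inv_into U \<phi> (\<phi> x + z)) = \<phi> x + z"
    if "z \<in> ball 0 r" for z
  proof -
    have "\<phi> x + z \<in> ball (\<phi> x) r" using that by (auto simp: dist_norm)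
    then obtain y where y: "y \<in> U \<inter> W" "\<phi> x + z = \<phi> y" using r(2) by blast
    then have "inv_into U \<phi> (\<phi> x + z) = y" using inv_into_f_f[OF cU(3)] by simp
    then show "inv_into U \<phi> (\<phi> x + z) \<in> U" "T (inv_into U \<phi> (\<phi> x + z)) \<in> V"
    "inv_into U \<phi> (\<phi> x + z) \<in> points S" "\<phi> (inv_into U \<phi> (\<phi> x + z)) = \<phi> x + z"
      using y by (auto simp: W_def)
  qed
  have "(\<psi> \<circ> T \<circ> inv_into U \<phi>) holomorphic_on \<phi> ` {x \<in> U. T x \<in> V}"
    using T(1) assms(1,2) by (auto simp: holomorphic_map_def)
  moreover have "ball (\<phi> x) r \<subseteq> \<phi> ` {x \<in> U. T x \<in> V}" using r(2) by (auto simp: W_def)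
  ultimately have hol: "(\<psi> \<circ> T \<circ> inv_into U \<phi>) holomorphic_on ball (\<phi> x) r"
    by (rule holomorphic_on_subset)
  have "((\<psi> \<circ> T \<circ> inv_into U \<phi>) \<circ> (\<lambda>z. \<phi> x + z)) holomorphic_on ball 0 r"
    by (rule holomorphic_on_compose_gen[OF _ hol]) (auto intro!: holomorphic_intros simp: dist_norm)
  then have "(\<lambda>z. \<psi> (T (inv_into U \<phi> (\<phi> x + z)))) holomorphic_on ball 0 r" by (simp add: o_def)
  then have hol\<tau>: "\<tau> holomorphic_on ball 0 r" unfolding \<tau>_def by (intro holomorphic_intros)
  then show "\<tau> analytic_on {0}" using r(1) by (auto simp: analytic_on_def)
  show t0: "\<tau> 0 = 0" unfolding \<tau>_def using inv_into_f_f[OF cU(3) assms(3)] by simp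
  have inj: "inj_on \<tau> (ball 0 r)"
  proof (rule inj_onI)
    fix z w assume z: "z \<in> ball 0 r" and w: "w \<in> ball 0 r" and "\<tau> z = \<tau> w"
    then have "\<psi> (T (inv_into U \<phi> (\<phi> x + z))) = \<psi> (T (inv_into U \<phi> (\<phi> x + w)))" by (simp add: \<tau>_def)
    then have "T (inv_into U \<phi> (\<phi> x + z)) = T (inv_into U \<phi> (\<phi> x + w))"
      using inj_onD[OF cV(3)] in1(2)[OF z] in1(2)[OF w] by blast
    then have "inv_into U \<phi> (\<phi> x + z) = inv_into U \<phi> (\<phi> x + w)"
      using inj_onD[OF T(2)] in1(3)[OF z] in1(3)[OF w] by blast
    then have "\<phi> (inv_into U \<phi> (\<phi> x + z)) = \<phi> (inv_into U \<phi> (\<phi> x + w))" by (rule arg_cong)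
    then have "\<phi> x + z = \<phi> x + w" by (simp only: in1(4)[OF z] in1(4)[OF w])
    then show "z = w" by simp
  qed
  show "deriv \<tau> 0 \<noteq> 0"
    using holomorphic_injective_imp_regular[OF hol\<tau> open_ball inj] r(1) by simp
  have "\<forall>\<^sub>F z in nhds 0. z \<in> ball (0::complex) r" using r(1) by (intro eventually_nhds_in_open) auto
  then show "\<forall>\<^sub>F z in nhds 0. T (inv_into U \<phi> (\<phi> x + z)) = inv_into V \<psi> (\<psi> (T x) + \<tau> z)"
    by eventually_elim (simp add: \<tau>_def inv_into_f_f[OF cV(3) in1(2)])
qed

lemma analytic_transition:
  assumes "(U, \<phi>) \<in> atlas S" "(V, \<psi>) \<in> atlas S" "x \<in> U" "x \<in> V"
    and "(\<lambda>z. u (inv_into V \<psi> (\<psi> x + z))) analytic_on {0}"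
  shows "(\<lambda>z. u (inv_into U \<phi> (\<phi> x + z))) analytic_on {0}"
proof -
  define \<tau> where "\<tau> = (\<lambda>z. \<psi> (inv_into U \<phi> (\<phi> x + z)) - \<psi> x)"
  note t = chart_transition[OF assms(1-4) id_holomorphic inj_on_id2, folded \<tau>_def]
  have t0: "\<tau> 0 = 0" using t(2) by (simp add: \<tau>_def)
  have "(\<lambda>z. u (inv_into V \<psi> (\<psi> x + \<tau> z))) analytic_on {0}"
    using analytic_on_compose[OF t(1), of "\<lambda>z. u (inv_into V \<psi> (\<psi> x + z))"] assms(5) t0
    by (simp add: o_def)
  moreover have "\<forall>\<^sub>F z in nhds 0. u (inv_into U \<phi> (\<phi> x + z)) = u (inv_into V \<psi> (\<psi> x + \<tau> z))"
    using t(4) by eventually_elim (simp add: \<tau>_def)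
  ultimately show ?thesis by (subst analytic_at_cong) auto
qed

text \<open>Makes regularity independent of the chart picked by \<open>chart_at\<close>.\<close>

lemma reg_chart:
  assumes "(U, \<phi>) \<in> atlas S" "x \<in> U"
  shows "reg u x \<longleftrightarrow> (\<lambda>z. u (inv_into U \<phi> (\<phi> x + z))) analytic_on {0}"
  using analytic_transition[of U \<phi> "dom x" "crd x" x u] analytic_transition[of "dom x" "crd x" U \<phi> x u]
    chart_at[of x] chart_facts(4)[OF assms(1)] assms by (auto simp: reg_def par_def)

text \<open>Off the centre the product \<open>g z * z powi n\<close> is holomorphic; recentring the
  chart at \<open>par x z\<close> turns this into regularity there.\<close>

lemma reg_near:
  assumes "x \<in> points S" "og u x n" shows "\<forall>\<^sub>F z in at 0. reg u (par x z)"
proof -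
  note c = chart_at[OF assms(1)]
  note cf = chart_facts[OF c(1)]
  obtain g where g: "g analytic_on {0}" "\<forall>\<^sub>F z in at 0. u (par x z) = g z * z powi n"
    using assms by (auto simp: ord_ge_def)
  obtain r where r: "r > 0" "g holomorphic_on ball 0 r" using g(1) by (auto simp: analytic_on_def)
  obtain d where d: "d > 0" "\<And>z. z \<noteq> 0 \<Longrightarrow> norm z < d \<Longrightarrow> u (par x z) = g z * z powi n"
    using eventually_at_0D[OF g(2)] by blast
  obtain r0 where r0: "r0 > 0" "ball (crd x x) r0 \<subseteq> crd x ` (dom x \<inter> points S)"
    using chart_ball[OF c openin_topspace assms(1)] .
  define s where "s = min (min r d) r0"
  have s: "s > 0" "s \<le> r" "s \<le> d" "s \<le> r0" using r d r0 by (auto simp: s_def)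
  have "(\<lambda>z. g z * z powi n) holomorphic_on (ball 0 s - {0})"
    using s(2) by (intro holomorphic_intros holomorphic_on_subset[OF r(2)]) auto
  moreover have "(\<lambda>z. g z * z powi n) holomorphic_on (ball 0 s - {0}) \<longleftrightarrow>
      (\<lambda>z. u (par x z)) holomorphic_on (ball 0 s - {0})"
    by (rule holomorphic_cong) (use d(2) s(3) in auto)
  ultimately have hol: "(\<lambda>z. u (par x z)) holomorphic_on (ball 0 s - {0})" by simp
  have op: "open (ball 0 s - {0::complex})" by (intro open_Diff) auto
  have "\<forall>\<^sub>F z in at 0. z \<in> ball 0 s - {0::complex}"
    using s(1) by (intro eventually_at_in_open) auto
  then show ?thesis
  proof eventually_elim
    case (elim z)
    have "crd x x + z \<in> ball (crd x x) r0" using elim s(4) by (auto simp: dist_norm)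
    then obtain y where y: "y \<in> dom x" "crd x x + z = crd x y" using r0(2) by blast
    then have py: "par x z = y" using inv_into_f_f[OF cf(3)] by (simp add: par_def)
    have "(\<lambda>w. u (par x w)) analytic_on {z}" using hol op elim analytic_at by blast
    then have "((\<lambda>w. u (par x w)) \<circ> (\<lambda>w. z + w)) analytic_on {0}"
      by (intro analytic_on_compose) (auto intro!: analytic_intros)
    then have "(\<lambda>w. u (inv_into (dom x) (crd x) (crd x y + w))) analytic_on {0}"
      by (simp add: o_def par_def y(2)[symmetric] add.assoc)
    then show ?case using reg_chart[OF c(1) y(1)] py by blast
  qed
qed

lemma mero_reg_finite: "mero u \<Longrightarrow> finite {x \<in> points S. \<not> reg u x}"
  by (rule finite_exceptions) (auto simp: mero_def intro: reg_near)

lemma reg_og: "reg u x \<Longrightarrow> og u x 0"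
  unfolding reg_def by (rule analytic_imp_ord_ge)

lemma reg_oe: "x \<in> points S \<Longrightarrow> reg u x \<Longrightarrow> u x \<noteq> 0 \<Longrightarrow> oe u x 0"
  unfolding reg_def by (rule analytic_imp_ord_eq) (auto simp: par_0)

end

section \<open>The degree theorem\<close>

lemma eventually_at_openD:
  assumes "eventually P (at (q::complex))" shows "\<exists>U. open U \<and> q \<in> U \<and> (\<forall>c\<in>U. c \<noteq> q \<longrightarrow> P c)"
  using assms by (auto simp: eventually_at_topological)

context compact_surface
begin

section \<open>Algebra of meromorphic functions\<close>

lemma og_cong:
  assumes "finite {x \<in> points S. u x \<noteq> v x}" "x \<in> points S" shows "og u x n \<longleftrightarrow> og v x n"
  by (rule ord_ge_cong, rule ev_par_outside[OF assms(2)]) (use assms(1) in auto)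

lemma oe_cong:
  assumes "finite {x \<in> points S. u x \<noteq> v x}" "x \<in> points S" shows "oe u x n \<longleftrightarrow> oe v x n"
  by (rule ord_eq_cong, rule ev_par_outside[OF assms(2)]) (use assms(1) in auto)

lemma meroI: "(\<And>x. x \<in> points S \<Longrightarrow> og u x n) \<Longrightarrow> mero u"
  by (auto simp: mero_def)

lemma mero_const: "mero (\<lambda>x. c)"
  by (rule meroI) (rule ord_ge_const)

lemma mero_add: assumes "mero u" "mero v" shows "mero (\<lambda>x. u x + v x)"
  unfolding mero_def
proof
  fix x assume x: "x \<in> points S"
  obtain n m where "og u x n" "og v x m" using assms x unfolding mero_def by blast
  then have "og u x (min n m)" "og v x (min n m)" by (auto intro: ord_ge_mono)
  then have "og (\<lambda>x. u x + v x) x (min n m)" by (rule ord_ge_add)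
  then show "\<exists>n. og (\<lambda>x. u x + v x) x n" ..
qed

lemma mero_mult: assumes "mero u" "mero v" shows "mero (\<lambda>x. u x * v x)"
  unfolding mero_def
proof
  fix x assume x: "x \<in> points S"
  obtain n m where "og u x n" "og v x m" using assms x unfolding mero_def by blast
  then have "og (\<lambda>x. u x * v x) x (n + m)" by (rule ord_ge_mult)
  then show "\<exists>n. og (\<lambda>x. u x * v x) x n" ..
qed

lemma mero_diff: "mero u \<Longrightarrow> mero v \<Longrightarrow> mero (\<lambda>x. u x - v x)"
  using mero_add[of u "\<lambda>x. (-1) * v x"] mero_mult[OF mero_const[of "-1"], of v] by simp

lemma mero_inverse: assumes "mero u" "nz u" shows "mero (\<lambda>x. inverse (u x))"
  unfolding mero_def
proof
  fix x assume x: "x \<in> points S"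
  obtain n where "oe u x n" using assms x by (rule nz_oe)
  then have "og (\<lambda>x. inverse (u x)) x (- n)" by (intro ord_eq_imp_ge ord_eq_inverse)
  then show "\<exists>n. og (\<lambda>x. inverse (u x)) x n" ..
qed

lemma mero_divide: "mero u \<Longrightarrow> mero v \<Longrightarrow> nz v \<Longrightarrow> mero (\<lambda>x. u x / v x)"
  using mero_mult[OF _ mero_inverse] by (simp add: divide_inverse)

lemma reg_limit: "x \<in> points S \<Longrightarrow> reg u x \<Longrightarrow> ((\<lambda>z. u (par x z)) \<longlongrightarrow> u x) (at 0)"
  using analytic_at_imp_isCont[of "\<lambda>z. u (par x z)" 0] by (simp add: reg_def isCont_def par_0)

lemma reg_og_pos: "x \<in> points S \<Longrightarrow> reg u x \<Longrightarrow> og (\<lambda>y. u y - u x) x 1"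
  by (rule ord_ge_diff_limit[OF reg_og reg_limit])

definition ord :: "('a \<Rightarrow> complex) \<Rightarrow> 'a \<Rightarrow> int" where
  "ord u x = (THE n. oe u x n)"

lemma ord_eqI: "oe u x n \<Longrightarrow> ord u x = n"
  unfolding ord_def using ord_eq_unique by blast

lemma oe_ord: assumes "mero u" "nz u" "x \<in> points S" shows "oe u x (ord u x)"
proof -
  obtain n where "oe u x n" using nz_oe[OF assms] .
  then show ?thesis using ord_eqI by simp
qed

lemma og_le_ord: "mero u \<Longrightarrow> nz u \<Longrightarrow> x \<in> points S \<Longrightarrow> og u x n \<Longrightarrow> n \<le> ord u x"
  using ord_ge_eq_le oe_ord by blast

lemma finite_ord: assumes "mero u" "nz u" shows "finite {x \<in> points S. ord u x \<noteq> 0}"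
proof (rule finite_subset)
  show "{x \<in> points S. ord u x \<noteq> 0} \<subseteq> {x \<in> points S. \<not> reg u x} \<union> {x \<in> points S. u x = 0}"
    using reg_oe ord_eqI by blast
  show "finite ({x \<in> points S. \<not> reg u x} \<union> {x \<in> points S. u x = 0})"
    using mero_reg_finite nz_finite_zeros assms by blast
qed

section \<open>Counting the points of a fibre\<close>

lemma finite_separation:
  assumes "finite X" "X \<subseteq> points S"
  shows "\<exists>V. (\<forall>x\<in>X. openin (surf_top S) (V x) \<and> x \<in> V x) \<and> (\<forall>x\<in>X. \<forall>y\<in>X. x \<noteq> y \<longrightarrow> V x \<inter> V y = {})"
proof -
  have "\<forall>p\<in>{(x, y). x \<in> X \<and> y \<in> X \<and> x \<noteq> y}. \<exists>AB. openin (surf_top S) (fst AB) \<and> openin (surf_top S) (snd AB)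
      \<and> fst p \<in> fst AB \<and> snd p \<in> snd AB \<and> fst AB \<inter> snd AB = {}"
  proof
    fix p assume "p \<in> {(x, y). x \<in> X \<and> y \<in> X \<and> x \<noteq> y}"
    then have "fst p \<in> points S" "snd p \<in> points S" "fst p \<noteq> snd p" using assms(2) by auto
    then have "\<exists>A B. openin (surf_top S) A \<and> openin (surf_top S) B \<and> fst p \<in> A \<and> snd p \<in> B \<and> disjnt A B"
      using hausdorff[unfolded Hausdorff_space_def, rule_format, of "fst p" "snd p"] by blast
    then obtain A B where "openin (surf_top S) A" "openin (surf_top S) B" "fst p \<in> A" "snd p \<in> B" "A \<inter> B = {}"
      by (auto simp: disjnt_def)
    then show "\<exists>AB. openin (surf_top S) (fst AB) \<and> openin (surf_top S) (snd AB)
      \<and> fst p \<in> fst AB \<and> snd p \<in> snd AB \<and> fst AB \<inter> snd AB = {}"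
      by (intro exI[of _ "(A, B)"]) simp
  qed
  from bchoice[OF this] obtain AB where "\<forall>p\<in>{(x, y). x \<in> X \<and> y \<in> X \<and> x \<noteq> y}.
      openin (surf_top S) (fst (AB p)) \<and> openin (surf_top S) (snd (AB p))
      \<and> fst p \<in> fst (AB p) \<and> snd p \<in> snd (AB p) \<and> fst (AB p) \<inter> snd (AB p) = {}" ..
  then have AB: "\<And>x y. x \<in> X \<Longrightarrow> y \<in> X \<Longrightarrow> x \<noteq> y \<Longrightarrow>
      openin (surf_top S) (fst (AB (x, y))) \<and> openin (surf_top S) (snd (AB (x, y)))
      \<and> x \<in> fst (AB (x, y)) \<and> y \<in> snd (AB (x, y)) \<and> fst (AB (x, y)) \<inter> snd (AB (x, y)) = {}"
    by auto
  \<comment> \<open>The final intersection with \<open>points S\<close> matters when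
    \<open>X\<close> has a single point and the indexed intersection runs over the empty
    set.\<close>
  define V where "V = (\<lambda>x. (\<Inter>y\<in>X - {x}. fst (AB (x, y)) \<inter> snd (AB (y, x))) \<inter> points S)"
  have 1: "openin (surf_top S) (V x) \<and> x \<in> V x" if x: "x \<in> X" for x
  proof
    show "openin (surf_top S) (V x)" unfolding V_def
      by (rule openin_INT) (use assms AB x in auto)
    show "x \<in> V x" unfolding V_def using assms(2) AB x by auto
  qed
  have 2: "V x \<inter> V y = {}" if "x \<in> X" "y \<in> X" "x \<noteq> y" for x y
  proof -
    have "V x \<subseteq> fst (AB (x, y))" "V y \<subseteq> snd (AB (x, y))" unfolding V_def using that by auto
    then show ?thesis using AB[OF that] by blast
  qed
  show ?thesis by (intro exI[of _ V] conjI ballI impI 1[THEN conjunct1] 1[THEN conjunct2] 2)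
qed

text \<open>Discs around finitely many points cover the surface. For \<open>c\<close> far enough
  along the filter, only the discs at points with \<open>m x \<noteq> 0\<close> contain solutions,
  and these discs are disjoint, so the local counts add up.\<close>

lemma count_fibres:
  fixes m :: "'a \<Rightarrow> nat"
  assumes fin: "finite {x \<in> points S. m x \<noteq> 0}"
    and loc: "\<And>x. x \<in> points S \<Longrightarrow> local_count (\<lambda>z. u (par x z)) (m x) F"
    and avoid: "\<And>a. \<forall>\<^sub>F c in F. c \<noteq> a"
  shows "\<forall>\<^sub>F c in F. card {x \<in> points S. u x = c} = (\<Sum>x\<in>{x \<in> points S. m x \<noteq> 0}. m x)"
proof -
  define X where "X = {x \<in> points S. m x \<noteq> 0}"
  have XS: "X \<subseteq> points S" by (auto simp: X_def)
  obtain V where "(\<forall>x\<in>X. openin (surf_top S) (V x) \<and> x \<in> V x) \<and> (\<forall>x\<in>X. \<forall>y\<in>X. x \<noteq> y \<longrightarrow> V x \<inter> V y = {})"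
    using finite_separation[OF fin[folded X_def] XS] ..
  then have V: "\<And>x. x \<in> X \<Longrightarrow> openin (surf_top S) (V x) \<and> x \<in> V x"
    "\<And>x y. x \<in> X \<Longrightarrow> y \<in> X \<Longrightarrow> x \<noteq> y \<Longrightarrow> V x \<inter> V y = {}" by auto
  define V' where "V' = (\<lambda>x. if x \<in> X then V x else points S)"
  have V': "openin (surf_top S) (V' x) \<and> x \<in> V' x" if "x \<in> points S" for x
    using that V by (auto simp: V'_def)
  have "\<exists>r>0. inj_on (par x) (ball 0 r) \<and> par x ` ball 0 r \<subseteq> V' x \<and> openin (surf_top S) (par x ` ball 0 r) \<and>
     (\<forall>\<^sub>F c in F. finite (fibre (\<lambda>z. u (par x z)) r c) \<and> card (fibre (\<lambda>z. u (par x z)) r c) = m x)"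
    if x: "x \<in> points S" for x
  proof -
    obtain r1 where r1: "r1 > 0" "\<forall>r. 0 < r \<and> r \<le> r1 \<longrightarrow> inj_on (par x) (ball 0 r) \<and>
       par x ` ball 0 r \<subseteq> V' x \<and> openin (surf_top S) (par x ` ball 0 r)"
      using par_ball[of x "V' x"] V'[OF x] x by auto
    obtain r2 where r2: "r2 > 0" "\<forall>r. 0 < r \<and> r \<le> r2 \<longrightarrow> (\<forall>\<^sub>F c in F.
       finite (fibre (\<lambda>z. u (par x z)) r c) \<and> card (fibre (\<lambda>z. u (par x z)) r c) = m x)"
      using loc[OF x] unfolding local_count_def by auto
    show ?thesis using r1(1) r2(1) r1(2)[rule_format, of "min r1 r2"] r2(2)[rule_format, of "min r1 r2"]
      by (intro exI[of _ "min r1 r2"]) auto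
  qed
  then have "\<forall>x\<in>points S. \<exists>r>0. inj_on (par x) (ball 0 r) \<and> par x ` ball 0 r \<subseteq> V' x \<and> openin (surf_top S) (par x ` ball 0 r) \<and>
     (\<forall>\<^sub>F c in F. finite (fibre (\<lambda>z. u (par x z)) r c) \<and> card (fibre (\<lambda>z. u (par x z)) r c) = m x)"
    by blast
  from bchoice[OF this] obtain r where r: "\<forall>x\<in>points S. r x > 0 \<and> inj_on (par x) (ball 0 (r x)) \<and>
     par x ` ball 0 (r x) \<subseteq> V' x \<and> openin (surf_top S) (par x ` ball 0 (r x)) \<and>
     (\<forall>\<^sub>F c in F. finite (fibre (\<lambda>z. u (par x z)) (r x) c) \<and> card (fibre (\<lambda>z. u (par x z)) (r x) c) = m x)"
    by auto
  define W where "W = (\<lambda>x. par x ` ball 0 (r x))"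
  have W: "openin (surf_top S) (W x) \<and> x \<in> W x" if x: "x \<in> points S" for x
    using r x par_0[OF x] unfolding W_def by (metis centre_in_ball image_eqI)
  obtain Y where Y: "Y \<subseteq> points S" "finite Y" "points S \<subseteq> (\<Union>x\<in>Y. W x)"
    by (rule finite_cover[of W]) (use W in auto)
  \<comment> \<open>\<open>X\<close> carries the count while \<open>Y\<close> makes the discs cover
    the surface; the local counts are needed at all these points simultaneously.\<close>
  define Z where "Z = X \<union> Y"
  have Z: "finite Z" "Z \<subseteq> points S" using fin Y XS by (auto simp: Z_def X_def)
  have ev1: "\<forall>\<^sub>F c in F. \<forall>x\<in>Z. finite (fibre (\<lambda>z. u (par x z)) (r x) c) \<and>
      card (fibre (\<lambda>z. u (par x z)) (r x) c) = m x"
    by (rule eventually_ball_finite[OF Z(1)]) (use r Z(2) in blast)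
  \<comment> \<open>The local counts leave out the centres, so \<open>c\<close> must avoid the
    values there.\<close>
  have ev2: "\<forall>\<^sub>F c in F. \<forall>x\<in>Z. c \<noteq> u x"
    by (rule eventually_ball_finite[OF Z(1)]) (use avoid in blast)
  show ?thesis using ev1 ev2
  proof eventually_elim
    case (elim c)
    define A where "A = (\<lambda>x. {z \<in> ball 0 (r x) - {0}. u (par x z) = c})"
    have A: "finite (A x)" "card (A x) = m x" if "x \<in> Z" for x using elim(1) that by (auto simp: A_def)
    have inW: "y \<in> par x ` A x" if "y \<in> W x" "u y = c" "x \<in> Z" for x y
    proof -
      obtain z where z: "z \<in> ball 0 (r x)" "y = par x z" using \<open>y \<in> W x\<close> by (auto simp: W_def)
      have "x \<in> points S" using that Z by blast
      then have "z \<noteq> 0" using elim(2) that z par_0 by auto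
      then show ?thesis using z that by (auto simp: A_def)
    qed
    have parS: "par x ` A x \<subseteq> V' x \<and> par x ` A x \<subseteq> points S" if "x \<in> points S" for x
      using r that V'[OF that] openin_subset[of "surf_top S" "V' x"] by (fastforce simp: A_def)
    have eq: "{y \<in> points S. u y = c} = (\<Union>x\<in>X. par x ` A x)"
    proof (intro equalityI subsetI)
      fix y assume y: "y \<in> {y \<in> points S. u y = c}"
      then obtain x where x: "x \<in> Y" "y \<in> W x" using Y(3) by blast
      then have yA: "y \<in> par x ` A x" using inW[of y x] y by (auto simp: Z_def)
      then have "A x \<noteq> {}" by blast
      then have "m x \<noteq> 0" using A[of x] x by (auto simp: Z_def)
      then have "x \<in> X" using x Y by (auto simp: X_def)
      then show "y \<in> (\<Union>x\<in>X. par x ` A x)" using yA by blast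
    next
      fix y assume "y \<in> (\<Union>x\<in>X. par x ` A x)"
      then show "y \<in> {y \<in> points S. u y = c}" using parS XS by (fastforce simp: A_def)
    qed
    have "card (\<Union>x\<in>X. par x ` A x) = (\<Sum>x\<in>X. card (par x ` A x))"
    proof (rule card_UN_disjoint)
      show "finite X" using fin by (simp add: X_def)
      show "\<forall>x\<in>X. finite (par x ` A x)" using A(1) by (auto simp: Z_def)
      show "\<forall>x\<in>X. \<forall>y\<in>X. x \<noteq> y \<longrightarrow> par x ` A x \<inter> par y ` A y = {}"
      proof (intro ballI impI)
        fix x y assume xy: "x \<in> X" "y \<in> X" "x \<noteq> y"
        have "par x ` A x \<subseteq> V' x" "par y ` A y \<subseteq> V' y" using parS XS xy by blast+
        then have "par x ` A x \<subseteq> V x" "par y ` A y \<subseteq> V y" using xy by (simp_all add: V'_def)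
        then show "par x ` A x \<inter> par y ` A y = {}" using V(2)[OF xy] by blast
      qed
    qed
    also have "\<dots> = (\<Sum>x\<in>X. m x)"
    proof (rule sum.cong[OF refl])
      fix x assume x: "x \<in> X"
      have "inj_on (par x) (ball 0 (r x))" using r x XS by auto
      then have "inj_on (par x) (A x)" by (rule inj_on_subset) (auto simp: A_def)
      then show "card (par x ` A x) = m x" using A(2)[of x] x by (simp add: card_image Z_def)
    qed
    finally show ?case by (simp add: eq X_def)
  qed
qed

text \<open>At a pole of \<open>u\<close>, or where the value is not \<open>q\<close>, the function
  stays away from \<open>q\<close> on a punctured disc; the order is then at most 0 and
  \<open>nat\<close> gives the count 0.\<close>

lemma local_count_at:
  assumes "mero u" "nz (\<lambda>x. u x - q)" "x \<in> points S"
  shows "local_count (\<lambda>z. u (par x z)) (nat (ord (\<lambda>x. u x - q) x)) (at q)"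
proof -
  define n where "n = ord (\<lambda>x. u x - q) x"
  have oe: "oe (\<lambda>x. u x - q) x n"
    unfolding n_def by (rule oe_ord[OF mero_diff[OF assms(1) mero_const] assms(2,3)])
  show ?thesis unfolding n_def[symmetric]
  proof (cases "n > 0")
    case True
    then have "local_count (\<lambda>z. u (par x z) - q) (nat n) (at 0)" using oe by (intro ord_eq_pos_count) auto
    moreover have "filterlim (\<lambda>c. c - q) (at 0) (at q)"
      by (auto simp: filterlim_at eventually_neq_at_within intro!: tendsto_eq_intros)
    ultimately show "local_count (\<lambda>z. u (par x z)) (nat n) (at q)"
      by (rule local_count_compose) auto
  next
    case False
    then obtain d where d: "d > 0" "\<forall>\<^sub>F z in at 0. norm (u (par x z) - q) \<ge> d"
      using ord_eq_nonpos_bound[OF oe] by auto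
    obtain r0 where r0: "r0 > 0" "\<forall>z. z \<noteq> 0 \<and> norm z < r0 \<longrightarrow> norm (u (par x z) - q) \<ge> d"
      using eventually_at_0D[OF d(2)] by blast
    have "\<forall>\<^sub>F c in at q. c \<in> ball q d" using d(1) by (intro eventually_at_in_open') auto
    then have "\<forall>\<^sub>F c in at q. \<forall>z. z \<noteq> 0 \<and> norm z < r0 \<longrightarrow> u (par x z) \<noteq> c"
      by eventually_elim (use r0(2) in \<open>fastforce simp: dist_norm norm_minus_commute\<close>)
    from local_count_0[OF r0(1) this] show "local_count (\<lambda>z. u (par x z)) (nat n) (at q)"
      using False by simp
  qed
qed

lemma local_count_infinity:
  assumes "mero u" "nz u" "x \<in> points S"
  shows "local_count (\<lambda>z. u (par x z)) (nat (- ord u x)) at_infinity"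
proof -
  define n where "n = ord u x"
  have oe: "oe u x n" unfolding n_def by (rule oe_ord[OF assms])
  show ?thesis unfolding n_def[symmetric]
  proof (cases "n < 0")
    case True
    then show "local_count (\<lambda>z. u (par x z)) (nat (- n)) at_infinity" using oe by (intro ord_eq_neg_count) auto
  next
    case False
    then have "og u x 0" by (intro ord_ge_mono[OF ord_eq_imp_ge[OF oe]]) auto
    then obtain b where b: "\<forall>\<^sub>F z in at 0. norm (u (par x z)) < b" by (rule ord_ge_bound)
    obtain r0 where r0: "r0 > 0" "\<forall>z. z \<noteq> 0 \<and> norm z < r0 \<longrightarrow> norm (u (par x z)) < b"
      using eventually_at_0D[OF b] by blast
    have "\<forall>\<^sub>F c in at_infinity. norm (c::complex) \<ge> b" unfolding eventually_at_infinity by blast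
    then have "\<forall>\<^sub>F c in at_infinity. \<forall>z. z \<noteq> 0 \<and> norm z < r0 \<longrightarrow> u (par x z) \<noteq> c"
      by eventually_elim (use r0(2) in fastforce)
    from local_count_0[OF r0(1) this] show "local_count (\<lambda>z. u (par x z)) (nat (- n)) at_infinity"
      using False by simp
  qed
qed

lemma eventually_at_infinity_neq: "\<forall>\<^sub>F c in at_infinity. c \<noteq> (a::complex)"
proof -
  have "norm c \<ge> norm a + 1 \<Longrightarrow> c \<noteq> a" for c by auto
  then show ?thesis unfolding eventually_at_infinity by blast
qed

text \<open>\<open>nat\<close> discards the poles, so this is the degree of the zero divisor of
  \<open>u - q\<close>.\<close>

definition zeros_at :: "('a \<Rightarrow> complex) \<Rightarrow> complex \<Rightarrow> nat" where
  "zeros_at u q = (\<Sum>x\<in>{x \<in> points S. nat (ord (\<lambda>x. u x - q) x) \<noteq> 0}. nat (ord (\<lambda>x. u x - q) x))"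

definition num_poles :: "('a \<Rightarrow> complex) \<Rightarrow> nat" where
  "num_poles u = (\<Sum>x\<in>{x \<in> points S. nat (- ord u x) \<noteq> 0}. nat (- ord u x))"

lemma count_at:
  assumes "mero u" "nz (\<lambda>x. u x - q)"
  shows "\<forall>\<^sub>F c in at q. card {x \<in> points S. u x = c} = zeros_at u q"
  unfolding zeros_at_def
proof (rule count_fibres)
  show "finite {x \<in> points S. nat (ord (\<lambda>x. u x - q) x) \<noteq> 0}"
    by (rule finite_subset[OF _ finite_ord[OF mero_diff[OF assms(1) mero_const] assms(2)]]) auto
  show "\<And>a::complex. \<forall>\<^sub>F c in at q. c \<noteq> a" by (rule eventually_neq_at_within)
qed (rule local_count_at[OF assms])

lemma count_infinity:
  assumes "mero u" "nz u"
  shows "\<forall>\<^sub>F c in at_infinity. card {x \<in> points S. u x = c} = num_poles u"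
  unfolding num_poles_def
proof (rule count_fibres)
  show "finite {x \<in> points S. nat (- ord u x) \<noteq> 0}"
    by (rule finite_subset[OF _ finite_ord[OF assms]]) auto
  show "\<And>a::complex. \<forall>\<^sub>F c in at_infinity. c \<noteq> a" by (rule eventually_at_infinity_neq)
qed (rule local_count_infinity[OF assms])

text \<open>The number of points in a fibre is constant near each value, the value itself excepted, so
  the weighted count is locally constant on the plane, and large values give the poles.\<close>

theorem zeros_eq_poles:
  assumes "mero u" "\<And>q. nz (\<lambda>x. u x - q)"
  shows "zeros_at u q = num_poles u"
proof -
  define N where "N = (\<lambda>c. card {x \<in> points S. u x = c})"
  have step: "\<forall>\<^sub>F c in at q. zeros_at u c = zeros_at u q" for q
  proof -
    have "\<forall>\<^sub>F c in at q. N c = zeros_at u q" using count_at[OF assms, of q] unfolding N_def .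
    from eventually_at_openD[OF this]
    obtain U where U: "open U" "q \<in> U" "\<forall>c\<in>U. c \<noteq> q \<longrightarrow> N c = zeros_at u q" by blast
    have "\<forall>\<^sub>F c in at q. c \<in> U - {q}" using U by (intro eventually_at_in_open) auto
    then show ?thesis
    proof eventually_elim
      case (elim c)
      have "open (U - {q})" using U(1) by (intro open_Diff) auto
      then have "\<forall>\<^sub>F c' in at c. c' \<in> U - {q}" using elim by (rule eventually_at_in_open')
      then have elim: "\<forall>\<^sub>F c' in at c. N c' = zeros_at u q" by eventually_elim (use U(3) in auto)
      have "\<forall>\<^sub>F c' in at c. N c' = zeros_at u c" using count_at[OF assms, of c] unfolding N_def .
      with elim have "\<forall>\<^sub>F c' in at c. zeros_at u c = zeros_at u q" by eventually_elim simp
      then show ?case by simp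
    qed
  qed
  have const: "zeros_at u c = zeros_at u q" for c
  proof -
    have "\<forall>\<^sub>F c in nhds q. zeros_at u c = zeros_at u q" for q
      using step[of q] by (simp add: eventually_nhds_conv_at)
    then have "open {c. zeros_at u c = k}" for k
      by (auto simp: open_dist eventually_nhds_metric)
    \<comment> \<open>The plane is connected, and the complement of a level set is a union of open
      level sets.\<close>
    moreover have "{c. zeros_at u c \<noteq> zeros_at u q} = (\<Union>k\<in>-{zeros_at u q}. {c. zeros_at u c = k})" by auto
    ultimately have "open {c. zeros_at u c \<noteq> zeros_at u q}" "open {c. zeros_at u c = zeros_at u q}"
      by auto
    then have "{c. zeros_at u c \<noteq> zeros_at u q} = {} \<or> {c. zeros_at u c = zeros_at u q} = {}"
      using connected_UNIV[where 'a = complex] unfolding connected_def by blast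
    then show ?thesis by blast
  qed
  obtain b where b: "\<And>c. norm c \<ge> b \<Longrightarrow> N c = num_poles u"
    using count_infinity[OF assms(1)] assms(2)[of 0] unfolding N_def eventually_at_infinity by auto
  \<comment> \<open>Near a value of norm above \<open>b\<close> the fibre count equals both
    \<open>num_poles u\<close> and \<open>zeros_at u c\<close>.\<close>
  define c :: complex where "c = of_real (\<bar>b\<bar> + 1)"
  have "c \<in> {c. norm c > b}" by (auto simp: c_def)
  moreover have "open {c::complex. norm c > b}" by (intro open_Collect_less continuous_intros)
  ultimately have "\<forall>\<^sub>F c' in at c. c' \<in> {c. norm c > b}" by (intro eventually_at_in_open') auto
  then have "\<forall>\<^sub>F c' in at c. N c' = num_poles u" by eventually_elim (use b in auto)
  moreover have "\<forall>\<^sub>F c' in at c. N c' = zeros_at u c" using count_at[OF assms, of c] unfolding N_def .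
  ultimately have "\<forall>\<^sub>F c' in at c. zeros_at u c = num_poles u" by eventually_elim simp
  then show ?thesis using const[of c] by simp
qed

text \<open>An order is its positive minus its negative part, so the sum compares
  \<open>zeros_at u 0\<close> with \<open>num_poles u\<close>. Constants are treated apart because
  their \<open>u - q\<close> vanishes for one \<open>q\<close>.\<close>

lemma sum_ord_zero:
  assumes "mero u" "nz u" "finite A" "A \<subseteq> points S" "\<And>x. x \<in> points S \<Longrightarrow> ord u x \<noteq> 0 \<Longrightarrow> x \<in> A"
  shows "(\<Sum>x\<in>A. ord u x) = 0"
proof (cases "\<forall>q. nz (\<lambda>x. u x - q)")
  case False
  then obtain q where q: "finite {x \<in> points S. u x \<noteq> q}"
    using mero_zero_or_nz[OF mero_diff[OF assms(1) mero_const]] by force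
  have "q \<noteq> 0"
  proof
    assume "q = 0"
    then have "points S \<subseteq> {x \<in> points S. u x \<noteq> q} \<union> {x \<in> points S. u x = 0}" by auto
    then show False using q nz_finite_zeros[OF assms(2)] infinite_points finite_subset by blast
  qed
  then have "oe u x 0" if "x \<in> points S" for x using oe_cong[OF q that] ord_eq_const by blast
  then have "ord u x = 0" if "x \<in> A" for x using assms(4) that by (blast intro: ord_eqI)
  then show ?thesis by simp
next
  case True
  have eq: "zeros_at u 0 = num_poles u" by (rule zeros_eq_poles) (use assms True in auto)
  have "zeros_at u 0 = (\<Sum>x\<in>A. nat (ord u x))" unfolding zeros_at_def
    by (simp, rule sum.mono_neutral_left) (use assms in auto)
  moreover have "num_poles u = (\<Sum>x\<in>A. nat (- ord u x))" unfolding num_poles_def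
    by (rule sum.mono_neutral_left) (use assms in auto)
  ultimately have "(\<Sum>x\<in>A. nat (ord u x)) = (\<Sum>x\<in>A. nat (- ord u x))" using eq by simp
  then have "(\<Sum>x\<in>A. int (nat (ord u x))) = (\<Sum>x\<in>A. int (nat (- ord u x)))"
    by (metis of_nat_sum)
  moreover have "ord u x = int (nat (ord u x)) - int (nat (- ord u x))" for x by simp
  ultimately show ?thesis by (metis (no_types, lifting) sum.cong sum_subtractf diff_self)
qed

text \<open>Subtracting the limit at one point creates a zero there and no pole anywhere, which
  contradicts \<open>sum_ord_zero\<close> unless the difference is the zero function.\<close>

lemma no_poles_const:
  assumes "mero u" "\<And>x. x \<in> points S \<Longrightarrow> og u x 0"
  obtains c where "finite {x \<in> points S. u x \<noteq> c}"
proof -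
  obtain x0 where x0: "x0 \<in> points S" using nonempty by blast
  obtain c where "((\<lambda>z. u (par x0 z)) \<longlongrightarrow> c) (at 0)" using ord_ge_tendsto[OF assms(2)[OF x0]] .
  then have og1: "og (\<lambda>x. u x - c) x0 1" by (rule ord_ge_diff_limit[OF assms(2)[OF x0]])
  have m: "mero (\<lambda>x. u x - c)" by (intro mero_diff assms mero_const)
  have "\<not> nz (\<lambda>x. u x - c)"
  proof
    assume nz: "nz (\<lambda>x. u x - c)"
    define A where "A = insert x0 {x \<in> points S. ord (\<lambda>x. u x - c) x \<noteq> 0}"
    have "finite A" using finite_ord[OF m nz] by (simp add: A_def)
    then have "(\<Sum>x\<in>A. ord (\<lambda>x. u x - c) x) = 0"
      using x0 by (intro sum_ord_zero m nz) (auto simp: A_def)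
    moreover have "(\<Sum>x\<in>A. ord (\<lambda>x. u x - c) x) > 0"
    proof (rule sum_pos2[of A x0])
      show "0 < ord (\<lambda>x. u x - c) x0" using og_le_ord[OF m nz x0 og1] by simp
      show "0 \<le> ord (\<lambda>x. u x - c) x" if "x \<in> A" for x
      proof -
        have xS: "x \<in> points S" using that x0 by (auto simp: A_def)
        show ?thesis
          using og_le_ord[OF m nz xS] ord_ge_diff[OF assms(2)[OF xS] ord_ge_const[of c]] by blast
      qed
    qed (use \<open>finite A\<close> in \<open>auto simp: A_def\<close>)
    ultimately show False by simp
  qed
  then show ?thesis using mero_zero_or_nz[OF m] that by auto
qed

text \<open>Fills in removable singularities, so that identities known outside a finite set can be
  evaluated at every point that is not a pole.\<close>

definition nrm :: "('a \<Rightarrow> complex) \<Rightarrow> 'a \<Rightarrow> complex" where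
  "nrm u x = (if og u x 0 then Lim (at 0) (\<lambda>z. u (par x z)) else u x)"

lemma nrm_eq: assumes "x \<in> points S" "reg u x" shows "nrm u x = u x"
  using reg_og[OF assms(2)] tendsto_Lim[OF _ reg_limit[OF assms]] by (simp add: nrm_def)

lemma nrm_finite: "mero u \<Longrightarrow> finite {x \<in> points S. nrm u x \<noteq> u x}"
  by (rule finite_subset[OF _ mero_reg_finite]) (auto simp: nrm_eq)

lemma reg_nrm: assumes "mero u" "x \<in> points S" "og u x 0" shows "reg (nrm u) x"
proof -
  obtain g where g: "g analytic_on {0}" "\<forall>\<^sub>F z in at 0. u (par x z) = g z"
    using assms(3) by (auto simp: ord_ge_def)
  have "(g \<longlongrightarrow> g 0) (at 0)" using analytic_at_imp_isCont[OF g(1)] by (simp add: isCont_def)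
  then have lim: "((\<lambda>z. u (par x z)) \<longlongrightarrow> g 0) (at 0)"
    by (rule Lim_transform_eventually) (use g(2) in \<open>auto elim: eventually_mono\<close>)
  have n0: "nrm u x = g 0" using assms(3) tendsto_Lim[OF at_neq_bot lim] by (simp add: nrm_def)
  have "\<forall>\<^sub>F z in at 0. nrm u (par x z) = u (par x z)"
    by (rule ev_par_outside[OF assms(2), where P = "\<lambda>y. nrm u y = u y"]) (rule nrm_finite[OF assms(1)])
  with g(2) have "\<forall>\<^sub>F z in at 0. nrm u (par x z) = g z"
    by eventually_elim simp
  then have "\<forall>\<^sub>F z in nhds 0. nrm u (par x z) = g z"
    using n0 by (simp add: eventually_nhds_conv_at par_0[OF assms(2)])
  then show ?thesis unfolding reg_def using g(1) by (subst analytic_at_cong) auto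
qed

text \<open>Both values are limits, so an identity on a punctured neighbourhood extends to the
  centre.\<close>

lemma reg_cong_value:
  assumes "x \<in> points S" "reg u x" "reg v x" "\<forall>\<^sub>F z in at 0. u (par x z) = v (par x z)"
  shows "u x = v x"
proof -
  have "((\<lambda>z. v (par x z)) \<longlongrightarrow> u x) (at 0)"
    by (rule Lim_transform_eventually[OF reg_limit[OF assms(1,2)] assms(4)])
  then show ?thesis using reg_limit[OF assms(1,3)] LIM_unique by blast
qed

end

section \<open>Maps to the sphere as meromorphic functions\<close>

lemma holomorphic_map_in: "holomorphic_map X Y f \<Longrightarrow> x \<in> points X \<Longrightarrow> f x \<in> points Y"
  by (auto simp: holomorphic_map_def continuous_map_def)

text \<open>The image of a chart of \<open>X\<close> need not lie in one chart of \<open>Y\<close>,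
  so differentiability is checked point by point through a chart of \<open>Y\<close> around
  \<open>f x\<close>.\<close>

lemma holomorphic_map_compose:
  assumes X: "riemann_surface X" and Y: "riemann_surface Y"
    and f: "holomorphic_map X Y f" and g: "holomorphic_map Y Z g"
  shows "holomorphic_map X Z (g \<circ> f)"
proof -
  interpret X: rsurface X by unfold_locales (rule X)
  interpret Y: rsurface Y by unfold_locales (rule Y)
  have cf: "continuous_map (surf_top X) (surf_top Y) f" and cg: "continuous_map (surf_top Y) (surf_top Z) g"
    using f g by (auto simp: holomorphic_map_def)
  have "(\<eta> \<circ> (g \<circ> f) \<circ> inv_into U \<phi>) holomorphic_on \<phi> ` {x \<in> U. (g \<circ> f) x \<in> W}"
    if U: "(U, \<phi>) \<in> atlas X" and W: "(W, \<eta>) \<in> atlas Z" for U \<phi> W \<eta>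
    unfolding holomorphic_on_def
  proof
    note cU = X.chart_facts[OF U]
    fix w assume "w \<in> \<phi> ` {x \<in> U. (g \<circ> f) x \<in> W}"
    then obtain x where x: "x \<in> U" "g (f x) \<in> W" "w = \<phi> x" by auto
    have fx: "f x \<in> points Y" using holomorphic_map_in[OF f] x cU(4) by blast
    obtain V \<psi> where V: "(V, \<psi>) \<in> atlas Y" "f x \<in> V" using Y.chart_exists[OF fx] .
    note cV = Y.chart_facts[OF V(1)]
    define M where "M = {x \<in> U. f x \<in> V}"
    define N where "N = {x \<in> U. (g \<circ> f) x \<in> W}"
    note MN_def = M_def N_def
    define A where "A = (\<psi> \<circ> f \<circ> inv_into U \<phi>)"
    define B where "B = (\<eta> \<circ> g \<circ> inv_into V \<psi>)"
    have A: "A holomorphic_on \<phi> ` M" using f U V by (auto simp: holomorphic_map_def A_def M_def)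
    have B: "B holomorphic_on \<psi> ` {y \<in> V. g y \<in> W}" using g V W by (auto simp: holomorphic_map_def B_def)
    have "openin (surf_top X) {x \<in> points X. f x \<in> V}"
      using cf cV(1) by (rule openin_continuous_map_preimage)
    then have "openin (surf_top X) (U \<inter> {x \<in> points X. f x \<in> V})" using cU(1) by blast
    moreover have "U \<inter> {x \<in> points X. f x \<in> V} = M" using cU(4) by (auto simp: M_def)
    ultimately have oA: "open (\<phi> ` M)" using cU(5)[of M] by (auto simp: M_def)
    have comp: "(B \<circ> A) holomorphic_on \<phi> ` (M \<inter> N)"
    proof (rule holomorphic_on_compose_gen[OF _ B])
      show "A holomorphic_on \<phi> ` (M \<inter> N)"
        by (rule holomorphic_on_subset[OF A]) auto
      show "A ` \<phi> ` (M \<inter> N) \<subseteq> \<psi> ` {y \<in> V. g y \<in> W}"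
        using inv_into_f_f[OF cU(3)] by (auto simp: A_def MN_def)
    qed
    have "(\<eta> \<circ> (g \<circ> f) \<circ> inv_into U \<phi>) holomorphic_on \<phi> ` (M \<inter> N)"
    proof (rule holomorphic_transform[OF comp])
      fix v assume "v \<in> \<phi> ` (M \<inter> N)"
      then obtain y where y: "y \<in> U" "f y \<in> V" "v = \<phi> y" by (auto simp: MN_def)
      have "inv_into V \<psi> (\<psi> (f y)) = f y" using inv_into_f_f[OF cV(3) y(2)] .
      then show "(B \<circ> A) v = (\<eta> \<circ> (g \<circ> f) \<circ> inv_into U \<phi>) v"
        using inv_into_f_f[OF cU(3) y(1)] y by (simp add: A_def B_def)
    qed
    moreover have w: "w \<in> \<phi> ` (M \<inter> N)" using x V by (auto simp: MN_def)
    ultimately have fd: "(\<eta> \<circ> (g \<circ> f) \<circ> inv_into U \<phi>) field_differentiable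
        (at w within \<phi> ` (M \<inter> N))"
      unfolding holomorphic_on_def by (rule bspec)
    have eq: "\<phi> ` (M \<inter> N)
       = \<phi> ` M \<inter> \<phi> ` N"
      by (rule inj_on_image_Int[OF cU(3)]) (auto simp: MN_def)
    have "w \<in> \<phi> ` M" using x V by (auto simp: M_def)
    \<comment> \<open>The image of \<open>M\<close> is open, so cutting down to it leaves the filter
      at \<open>w\<close> unchanged.\<close>
    then have "at w within (\<phi> ` M \<inter> \<phi> ` N)
        = at w within \<phi> ` N"
      by (rule at_within_nhd[OF _ oA]) blast
    then show "(\<eta> \<circ> (g \<circ> f) \<circ> inv_into U \<phi>) field_differentiable (at w within \<phi> ` {x \<in> U. (g \<circ> f) x \<in> W})"
      using fd eq by (simp add: N_def)
  qed
  then show ?thesis using continuous_map_compose[OF cf cg] unfolding holomorphic_map_def by blast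
qed

lemma sphere_points: "points riemann_sphere = UNIV"
  using notin_range_Some by (auto simp: riemann_sphere_def)

lemma sphere_charts:
  "(range Some, the) \<in> atlas riemann_sphere"
  "(UNIV - {Some 0}, \<lambda>q. case q of None \<Rightarrow> 0 | Some z \<Rightarrow> 1 / z) \<in> atlas riemann_sphere"
  by (auto simp: riemann_sphere_def)

lemma sphere_open: "openin (surf_top riemann_sphere) (range Some)"
  "openin (surf_top riemann_sphere) (UNIV - {Some 0})"
proof -
  show "openin (surf_top riemann_sphere) (range Some)"
    by (simp add: riemann_sphere_def)
  have "UNIV - {Some 0} = insert None (Some ` (topspace euclidean - {0::complex}))"
  proof (intro set_eqI iffI)
    fix q :: "complex option"
    assume "q \<in> UNIV - {Some 0}"
    then show "q \<in> insert None (Some ` (topspace euclidean - {0}))" by (cases q) auto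
  qed auto
  then show "openin (surf_top riemann_sphere) (UNIV - {Some 0})"
    unfolding riemann_sphere_def
    by (simp add: openin_Alexandroff_compactification) (intro disjI2 exI[of _ "{0}"], simp)
qed

definition cval :: "('a \<Rightarrow> complex option) \<Rightarrow> 'a \<Rightarrow> complex" where
  "cval k x = (case k x of None \<Rightarrow> 0 | Some z \<Rightarrow> z)"

text \<open>At points of \<open>k\<close>-value \<open>a\<close> this is \<open>1/0 = 0\<close>, although \<open>1/(k - a)\<close> has a pole there.\<close>

definition rcp :: "complex \<Rightarrow> ('a \<Rightarrow> complex option) \<Rightarrow> 'a \<Rightarrow> complex" where
  "rcp a k x = (case k x of None \<Rightarrow> 0 | Some z \<Rightarrow> 1 / (z - a))"

text \<open>The value 0 must be excluded: it is taken over infinity and, through division by zero,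
  also over \<open>a\<close>.\<close>

lemma rcp_eq_iff: "c \<noteq> 0 \<Longrightarrow> rcp a k x = c \<longleftrightarrow> k x = Some (a + 1 / c)"
proof (cases "k x")
  case (Some z)
  assume c: "c \<noteq> 0"
  have "1 / (z - a) = c \<longleftrightarrow> z = a + 1 / c"
  proof
    assume "1 / (z - a) = c"
    then have "z - a = 1 / c" by auto
    then show "z = a + 1 / c" by (metis add.commute diff_add_cancel)
  qed simp
  then show ?thesis using Some by (simp add: rcp_def)
qed (simp add: rcp_def)

context compact_surface
begin

lemma reg_of_chart:
  assumes k: "holomorphic_map S Y k" and V: "(V, \<psi>) \<in> atlas Y" "openin (surf_top Y) V"
    and x: "x \<in> points S" "k x \<in> V"
  shows "reg (\<lambda>y. \<psi> (k y)) x" "\<forall>\<^sub>F z in nhds 0. k (par x z) \<in> V"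
proof -
  note c = chart_at[OF x(1)]
  define W where "W = {y \<in> points S. k y \<in> V}"
  have W: "openin (surf_top S) W" unfolding W_def
    using k V(2) by (auto simp: holomorphic_map_def intro: openin_continuous_map_preimage)
  have xW: "x \<in> W" using x by (simp add: W_def)
  have "\<forall>\<^sub>F z in at 0. par x z \<in> W" using ev_par_in[OF x(1) W xW] .
  then show "\<forall>\<^sub>F z in nhds 0. k (par x z) \<in> V"
    unfolding eventually_nhds_conv_at using x par_0[OF x(1)] by (auto simp: W_def elim: eventually_mono)
  obtain r where r: "r > 0" "ball (crd x x) r \<subseteq> crd x ` (dom x \<inter> W)" using chart_ball[OF c W xW] .
  have "(\<psi> \<circ> k \<circ> inv_into (dom x) (crd x)) holomorphic_on crd x ` {y \<in> dom x. k y \<in> V}"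
    using k c(1) V(1) by (auto simp: holomorphic_map_def)
  moreover have "ball (crd x x) r \<subseteq> crd x ` {y \<in> dom x. k y \<in> V}" using r(2) by (auto simp: W_def)
  ultimately have "(\<psi> \<circ> k \<circ> inv_into (dom x) (crd x)) holomorphic_on ball (crd x x) r"
    by (rule holomorphic_on_subset)
  then have "((\<psi> \<circ> k \<circ> inv_into (dom x) (crd x)) \<circ> (\<lambda>z. crd x x + z)) holomorphic_on ball 0 r"
    by (intro holomorphic_on_compose_gen[where t = "ball (crd x x) r"])
      (auto intro!: holomorphic_intros simp: dist_norm)
  then have "(\<lambda>z. \<psi> (k (par x z))) holomorphic_on ball 0 r" by (simp add: o_def par_def)
  then show "reg (\<lambda>y. \<psi> (k y)) x" unfolding reg_def using r(1) by (auto simp: analytic_on_def)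
qed

lemma reg_cong:
  assumes "\<forall>\<^sub>F z in nhds 0. u (par x z) = v (par x z)" shows "reg u x \<longleftrightarrow> reg v x"
  unfolding reg_def by (rule analytic_at_cong[OF assms refl])

lemma reg_cval:
  assumes k: "holomorphic_map S riemann_sphere k" and x: "x \<in> points S" "k x \<noteq> None"
  shows "reg (cval k) x"
proof -
  have kx: "k x \<in> range Some" using x by auto
  note r = reg_of_chart[OF k sphere_charts(1) sphere_open(1) x(1) kx]
  have "\<forall>\<^sub>F z in nhds 0. cval k (par x z) = the (k (par x z))"
    using r(2) by eventually_elim (auto simp: cval_def)
  from reg_cong[OF this] show ?thesis using r(1) by blast
qed

lemma reg_rcp:
  assumes k: "holomorphic_map S riemann_sphere k" and x: "x \<in> points S" "k x \<noteq> Some a"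
  shows "reg (rcp a k) x"
proof (cases "k x")
  case (Some w)
  have "reg (cval k) x" using reg_cval[OF k x(1)] Some by simp
  then have "(\<lambda>z. inverse (cval k (par x z) - a)) analytic_on {0}"
    unfolding reg_def using Some x(2)
    by (intro analytic_on_inverse analytic_on_diff) (auto simp: cval_def par_0[OF x(1)])
  then have rv: "reg (\<lambda>y. inverse (cval k y - a)) x" by (simp add: reg_def)
  have "k x \<in> range Some" using Some by simp
  from reg_of_chart(2)[OF k sphere_charts(1) sphere_open(1) x(1) this]
  have "\<forall>\<^sub>F z in nhds 0. rcp a k (par x z) = inverse (cval k (par x z) - a)"
    by eventually_elim (auto simp: rcp_def cval_def divide_inverse)
  from reg_cong[OF this] show ?thesis using rv by blast
next
  case None
  define v where "v = (\<lambda>y. case k y of None \<Rightarrow> 0 | Some z \<Rightarrow> 1 / z)"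
  have kx: "k x \<in> UNIV - {Some 0}" using None by simp
  note r = reg_of_chart[OF k sphere_charts(2) sphere_open(2) x(1) kx, folded v_def]
  have "reg v x" using r(1) by (simp add: v_def)
  \<comment> \<open>With \<open>v = 1/k\<close> near infinity,
    \<open>1/(k - a) = v/(1 - a * v)\<close>, and the denominator is 1 where
    \<open>v = 0\<close>.\<close>
  then have "(\<lambda>z. v (par x z) * inverse (1 - a * v (par x z))) analytic_on {0}"
    unfolding reg_def using None
    by (intro analytic_on_mult analytic_on_inverse analytic_on_diff analytic_on_const)
      (auto simp: v_def par_0[OF x(1)])
  then have rv: "reg (\<lambda>y. v y * inverse (1 - a * v y)) x" by (simp add: reg_def)
  have "\<forall>\<^sub>F z in nhds 0. rcp a k (par x z) = v (par x z) * inverse (1 - a * v (par x z))"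
    using r(2)
  proof eventually_elim
    case (elim z)
    show ?case
    proof (cases "k (par x z)")
      case None then show ?thesis by (simp add: rcp_def v_def)
    next
      case (Some w)
      then have "w \<noteq> 0" using elim by auto
      then show ?thesis using Some by (simp add: rcp_def v_def field_simps)
    qed
  qed
  from reg_cong[OF this] show ?thesis using rv by blast
qed

text \<open>The second claim is conditional because \<open>k\<close> could be constantly
  \<open>a\<close> near \<open>x\<close>; then \<open>rcp a k\<close> is the zero germ and has no
  order.\<close>

lemma rcp_at_pole:
  assumes k: "holomorphic_map S riemann_sphere k" and x: "x \<in> points S" "k x = Some a"
  shows "\<exists>n. og (rcp a k) x n" "oe (rcp a k) x n \<Longrightarrow> n < 0"
proof -
  have r: "reg (cval k) x" using reg_cval[OF k x(1)] x(2) by simp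
  have og1: "og (\<lambda>y. cval k y - a) x 1" using reg_og_pos[OF x(1) r] x(2) by (simp add: cval_def)
  have "k x \<in> range Some" using x by simp
  from reg_of_chart(2)[OF k sphere_charts(1) sphere_open(1) x(1) this]
  have "\<forall>\<^sub>F z in nhds 0. rcp a k (par x z) = inverse (cval k (par x z) - a)"
    by eventually_elim (auto simp: rcp_def cval_def divide_inverse)
  then have ev: "\<forall>\<^sub>F z in at 0. rcp a k (par x z) = inverse (cval k (par x z) - a)"
    by (simp add: eventually_nhds_conv_at)
  from ord_ge_cases[OF og1] show "\<exists>n. og (rcp a k) x n"
  proof
    assume "\<forall>\<^sub>F z in at 0. cval k (par x z) - a = 0"
    with ev have "\<forall>\<^sub>F z in at 0. rcp a k (par x z) = 0" by eventually_elim simp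
    then have "og (rcp a k) x 0 \<longleftrightarrow> ord_ge (\<lambda>z. 0) 0" by (rule ord_ge_cong)
    then show ?thesis using ord_ge_const by blast
  next
    assume "\<exists>m\<ge>1. oe (\<lambda>y. cval k y - a) x m"
    then obtain m where "oe (\<lambda>y. cval k y - a) x m" by blast
    then have "ord_ge (\<lambda>z. inverse (cval k (par x z) - a)) (- m)" by (intro ord_eq_imp_ge ord_eq_inverse)
    then show ?thesis using ord_ge_cong[OF ev] by blast
  qed
  show "n < 0" if "oe (rcp a k) x n"
  proof -
    have "ord_eq (\<lambda>z. inverse (cval k (par x z) - a)) n" using that ord_eq_cong[OF ev] by blast
    then have "ord_eq (\<lambda>z. inverse (inverse (cval k (par x z) - a))) (- n)" by (rule ord_eq_inverse)
    then have "ord_eq (\<lambda>z. cval k (par x z) - a) (- n)" by simp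
    then have "1 \<le> - n" using ord_ge_eq_le og1 by blast
    then show ?thesis by simp
  qed
qed

lemma mero_rcp: assumes k: "holomorphic_map S riemann_sphere k" shows "mero (rcp a k)"
  unfolding mero_def
proof
  fix x assume x: "x \<in> points S"
  show "\<exists>n. og (rcp a k) x n"
    using rcp_at_pole(1)[OF k x] reg_og[OF reg_rcp[OF k x]] by blast
qed

text \<open>Near any value, the fibres over the other values have exactly \<open>d\<close> points.
  This identifies the weighted count at that value, and with it the number of poles.\<close>

lemma degree_from_count:
  assumes u: "mero u" and d: "d > 0" and fin: "finite {c. card {x \<in> points S. u x = c} \<noteq> d}"
  shows "nz (\<lambda>x. u x - q)" "zeros_at u q = d" "num_poles u = d"
proof -
  show nz: "nz (\<lambda>x. u x - q)" for q
  proof (rule ccontr)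
    assume "\<not> nz (\<lambda>x. u x - q)"
    then have E: "finite {x \<in> points S. u x \<noteq> q}"
      using mero_zero_or_nz[OF mero_diff[OF u mero_const]] by force
    \<comment> \<open>An almost constant \<open>u\<close> takes only finitely many values, whereas
      almost every fibre has \<open>d > 0\<close> points.\<close>
    have "UNIV \<subseteq> {c. card {x \<in> points S. u x = c} \<noteq> d} \<union> {q} \<union> u ` {x \<in> points S. u x \<noteq> q}"
    proof
      fix c :: complex
      show "c \<in> {c. card {x \<in> points S. u x = c} \<noteq> d} \<union> {q} \<union> u ` {x \<in> points S. u x \<noteq> q}"
      proof (cases "card {x \<in> points S. u x = c} = d \<and> c \<noteq> q")
        case True
        then have "{x \<in> points S. u x = c} \<noteq> {}" using d by (metis card.empty less_numeral_extra(3))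
        then show ?thesis using True by blast
      qed auto
    qed
    moreover have "finite ({c. card {x \<in> points S. u x = c} \<noteq> d} \<union> {q} \<union> u ` {x \<in> points S. u x \<noteq> q})"
      using fin E by auto
    ultimately show False using infinite_UNIV_char_0[where 'a = complex] finite_subset by blast
  qed
  have ev: "\<forall>\<^sub>F c in at q. card {x \<in> points S. u x = c} = d" for q
  proof -
    have "closed ({c. card {x \<in> points S. u x = c} \<noteq> d} - {q})" using fin by (intro finite_imp_closed) auto
    then have "\<forall>\<^sub>F c in at q. c \<in> - ({c. card {x \<in> points S. u x = c} \<noteq> d} - {q}) - {q}"
      by (intro eventually_at_in_open) (auto simp only: open_closed double_complement)
    then show ?thesis by eventually_elim auto
  qed
  have "\<forall>\<^sub>F c in at q. zeros_at u q = d" using ev[of q] count_at[OF u nz, of q] by eventually_elim simp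
  then show "zeros_at u q = d" by simp
  then show "num_poles u = d" using zeros_eq_poles[OF u nz] by simp
qed

lemma rcp_degree:
  assumes k: "holomorphic_map S riemann_sphere k" and d: "d > 0" and deg: "has_degree S riemann_sphere k d"
  shows "nz (\<lambda>x. rcp a k x - q)" "zeros_at (rcp a k) q = d" "num_poles (rcp a k) = d"
proof -
  have E: "finite {y. card {x \<in> points S. k x = y} \<noteq> d}"
    using deg by (simp add: has_degree_def sphere_points)
  \<comment> \<open>Away from 0 the fibres of \<open>rcp a k\<close> are fibres of \<open>k\<close>;
    the value 0 is simply added to the exceptions.\<close>
  have sub: "{c. card {x \<in> points S. rcp a k x = c} \<noteq> d} \<subseteq>
      {0} \<union> (\<lambda>y. 1 / (the y - a)) ` {y. card {x \<in> points S. k x = y} \<noteq> d}"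
  proof
    fix c assume c: "c \<in> {c. card {x \<in> points S. rcp a k x = c} \<noteq> d}"
    show "c \<in> {0} \<union> (\<lambda>y. 1 / (the y - a)) ` {y. card {x \<in> points S. k x = y} \<noteq> d}"
    proof (cases "c = 0")
      case False
      then have "Some (a + 1 / c) \<in> {y. card {x \<in> points S. k x = y} \<noteq> d}"
        using c by (simp add: rcp_eq_iff)
      moreover have "c = 1 / (the (Some (a + 1 / c)) - a)" by simp
      ultimately show ?thesis by blast
    qed simp
  qed
  then have fin: "finite {c. card {x \<in> points S. rcp a k x = c} \<noteq> d}"
    by (rule finite_subset) (use E in simp)
  show "nz (\<lambda>x. rcp a k x - q)" "zeros_at (rcp a k) q = d" "num_poles (rcp a k) = d"
    using degree_from_count[OF mero_rcp[OF k] d fin] by auto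
qed

lemma og_comp:
  assumes T: "holomorphic_map S S T" "inj_on T (points S)" and x: "x \<in> points S" and og: "og u (T x) n"
  shows "og (\<lambda>y. u (T y)) x n"
proof -
  have Tx: "T x \<in> points S" using holomorphic_map_in[OF T(1) x] .
  define \<tau> where "\<tau> = (\<lambda>z. crd (T x) (T (par x z)) - crd (T x) (T x))"
  note c = chart_at[OF x] chart_at[OF Tx]
  note t = chart_transition[OF c(1) c(3) c(2) c(4) T, folded par_def, folded \<tau>_def]
  have ge: "ord_ge (\<lambda>z. u (par (T x) (\<tau> z))) n"
    by (rule ord_ge_compose[OF og t(1) _ t(3)]) (use t(2) in \<open>simp add: \<tau>_def\<close>)
  have "\<forall>\<^sub>F z in nhds 0. T (par x z) = par (T x) (\<tau> z)"
    using t(4) by eventually_elim (simp add: par_def \<tau>_def)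
  then have "\<forall>\<^sub>F z in at 0. u (T (par x z)) = u (par (T x) (\<tau> z))"
    by (auto simp: eventually_nhds_conv_at elim: eventually_mono)
  from ord_ge_cong[OF this] show ?thesis using ge by blast
qed

lemma reg_comp:
  assumes T: "holomorphic_map S S T" "inj_on T (points S)" and x: "x \<in> points S" and u: "reg u (T x)"
  shows "reg (\<lambda>y. u (T y)) x"
proof -
  have Tx: "T x \<in> points S" using holomorphic_map_in[OF T(1) x] .
  define \<tau> where "\<tau> = (\<lambda>z. crd (T x) (T (par x z)) - crd (T x) (T x))"
  note c = chart_at[OF x] chart_at[OF Tx]
  note t = chart_transition[OF c(1) c(3) c(2) c(4) T, folded par_def, folded \<tau>_def]
  have t0: "\<tau> 0 = 0" using t(2) by (simp add: \<tau>_def)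
  have "(\<lambda>z. u (par (T x) (\<tau> z))) analytic_on {0}"
    using analytic_on_compose[OF t(1), of "\<lambda>z. u (par (T x) z)"] u t0 by (simp add: reg_def o_def)
  moreover have "\<forall>\<^sub>F z in nhds 0. u (T (par x z)) = u (par (T x) (\<tau> z))"
    using t(4) by eventually_elim (simp add: par_def \<tau>_def)
  ultimately show ?thesis unfolding reg_def by (subst analytic_at_cong) auto
qed

end

section \<open>An automorphism with four fixed points\<close>

lemma funpow_fixed_mult: "(f ^^ k) x = x \<Longrightarrow> (f ^^ (a * k)) x = x"
  by (induction a) (simp_all add: funpow_add)

context compact_surface
begin

text \<open>The orders sum to zero, while their lower bounds sum to \<open>card Z - card P\<close>.
  If the two cardinalities agree, every bound is attained.\<close>

lemma ord_sum_bound: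
  assumes w: "mero w" "nz w" and fin: "finite P" "finite Z" "P \<subseteq> points S" "Z \<subseteq> points S" "P \<inter> Z = {}"
    and P: "\<And>x. x \<in> P \<Longrightarrow> og w x (- 1)" and Z: "\<And>x. x \<in> Z \<Longrightarrow> og w x 1"
    and other: "\<And>x. x \<in> points S \<Longrightarrow> x \<notin> P \<Longrightarrow> og w x 0"
  shows "card Z \<le> card P"
    "card Z = card P \<Longrightarrow> x \<in> points S \<Longrightarrow> oe w x (if x \<in> P then - 1 else if x \<in> Z then 1 else 0)"
proof -
  define e :: "'a \<Rightarrow> int" where "e = (\<lambda>x. if x \<in> P then - 1 else if x \<in> Z then 1 else 0)"
  define A where "A = P \<union> Z \<union> {x \<in> points S. ord w x \<noteq> 0}"
  have A: "finite A" "A \<subseteq> points S" using fin finite_ord[OF w] by (auto simp: A_def)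
  have le: "e x \<le> ord w x" if "x \<in> points S" for x
    using og_le_ord[OF w that] P Z other[OF that] by (auto simp: e_def)
  have s0: "(\<Sum>x\<in>A. ord w x) = 0" by (rule sum_ord_zero[OF w A]) (auto simp: A_def)
  have "P \<subseteq> A" by (auto simp: A_def)
  then have "(\<Sum>x\<in>A. e x) = (\<Sum>x\<in>A - P. e x) + (\<Sum>x\<in>P. e x)" using A(1) by (rule sum.subset_diff)
  also have "(\<Sum>x\<in>A - P. e x) = (\<Sum>x\<in>Z. e x)"
    by (rule sum.mono_neutral_right) (use A fin in \<open>auto simp: A_def e_def\<close>)
  also have "(\<Sum>x\<in>Z. e x) = (\<Sum>x\<in>Z. 1)" by (rule sum.cong) (use fin(5) in \<open>auto simp: e_def\<close>)
  also have "(\<Sum>x\<in>P. e x) = (\<Sum>x\<in>P. - 1)" by (rule sum.cong) (auto simp: e_def)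
  finally have se: "(\<Sum>x\<in>A. e x) = int (card Z) - int (card P)" by simp
  have "(\<Sum>x\<in>A. e x) \<le> (\<Sum>x\<in>A. ord w x)" by (rule sum_mono) (use le A in auto)
  then show "card Z \<le> card P" using s0 se by simp
  show "oe w x (if x \<in> P then - 1 else if x \<in> Z then 1 else 0)" if c: "card Z = card P" and x: "x \<in> points S"
  proof -
    have "(\<Sum>x\<in>A. ord w x - e x) = 0" using s0 se c by (simp add: sum_subtractf)
    then have "\<forall>x\<in>A. ord w x - e x = 0"
      using sum_nonneg_eq_0_iff[OF A(1), of "\<lambda>x. ord w x - e x"] le A(2) by auto
    moreover have "x \<notin> A \<Longrightarrow> ord w x = 0 \<and> e x = 0" using x by (auto simp: A_def e_def)
    ultimately have "ord w x = e x" by force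
    then show ?thesis using oe_ord[OF w x] by (simp add: e_def)
  qed
qed

end

locale surface_aut = compact_surface +
  fixes T :: "'a \<Rightarrow> 'a" and p :: nat
  assumes T_order: "automorphism_of_order S T p" and p: "prime p" "odd p"
    and four: "card {x \<in> points S. T x = x} = 4"
begin

section \<open>The cyclic group generated by the automorphism\<close>

definition FX :: "'a set" where "FX = {x \<in> points S. T x = x}"

lemma FX: "finite FX" "card FX = 4" "FX \<subseteq> points S"
  using four card.infinite[of FX] by (auto simp: FX_def)

lemma T_holo: "holomorphic_map S S T" and T_inj: "inj_on T (points S)"
proof -
  obtain g where g: "biholomorphic_maps S S T g"
    using T_order by (auto simp: automorphism_of_order_def automorphism_def)
  then show "holomorphic_map S S T" by (simp add: biholomorphic_maps_def)
  show "inj_on T (points S)" by (rule inj_on_inverseI[of _ g]) (use g in \<open>auto simp: biholomorphic_maps_def\<close>)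
qed

lemma T_in: "x \<in> points S \<Longrightarrow> T x \<in> points S"
  by (rule holomorphic_map_in[OF T_holo])

lemma Tpow_in: "x \<in> points S \<Longrightarrow> (T ^^ k) x \<in> points S"
  by (induction k) (auto intro: T_in)

lemma Tp: "x \<in> points S \<Longrightarrow> (T ^^ p) x = x"
  using T_order by (auto simp: automorphism_of_order_def)

lemma p_gt: "p > 2" using p prime_ge_2_nat[of p] by (cases "p = 2") auto

lemma Tpow_mod: "x \<in> points S \<Longrightarrow> (T ^^ (k mod p)) x = (T ^^ k) x"
  by (rule funpow_mod_eq[OF Tp])

text \<open>As \<open>p\<close> is prime, \<open>k\<close> is invertible modulo \<open>p\<close>, so
  on the points \<open>T\<close> is a power of \<open>T ^^ k\<close>.\<close>

lemma fixed_if_Tpow: assumes "x \<in> points S" "(T ^^ k) x = x" "\<not> p dvd k" shows "T x = x"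
proof -
  have "coprime k p" using p(1) assms(3) by (metis coprime_commute prime_imp_coprime)
  then obtain a where "[k * a = Suc 0] (mod p)" using cong_solve_coprime_nat by blast
  then have "(a * k) mod p = 1" using p_gt by (simp add: cong_def mult.commute)
  then have "(T ^^ 1) x = (T ^^ (a * k)) x" using Tpow_mod[OF assms(1), of "a * k"] by simp
  then show ?thesis using funpow_fixed_mult[OF assms(2)] by simp
qed

text \<open>Inverse to \<open>T\<close> on the points because \<open>T\<close> has order
  \<open>p\<close>.\<close>

definition T' :: "'a \<Rightarrow> 'a" where "T' = T ^^ (p - 1)"

lemma T': assumes "x \<in> points S" shows "T' x \<in> points S" "T (T' x) = x" "T' (T x) = x"
proof -
  show "T' x \<in> points S" unfolding T'_def by (rule Tpow_in[OF assms])
  have "Suc (p - 1) = p" using p_gt by simp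
  then show "T (T' x) = x" using Tp[OF assms] unfolding T'_def by (metis funpow_simps_right(2) funpow_swap1 o_apply)
  then show "T' (T x) = x" unfolding T'_def by (simp add: funpow_swap1)
qed

lemma T_eq: "x \<in> points S \<Longrightarrow> y \<in> points S \<Longrightarrow> T x = T y \<longleftrightarrow> x = y"
  using T_inj by (auto dest: inj_onD)

lemma T'_iff: "x \<in> points S \<Longrightarrow> y \<in> points S \<Longrightarrow> x = T' y \<longleftrightarrow> T x = y"
  using T' by auto

lemma mero_T: assumes "mero u" shows "mero (\<lambda>x. u (T x))"
  unfolding mero_def
proof
  fix x assume x: "x \<in> points S"
  obtain n where "og u (T x) n" using assms T_in[OF x] unfolding mero_def by blast
  then show "\<exists>n. og (\<lambda>x. u (T x)) x n" using og_comp[OF T_holo T_inj x] by blast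
qed

lemma finite_T: assumes "finite {x \<in> points S. P (T x)}" shows "finite {x \<in> points S. P x}"
proof (rule finite_subset)
  show "{x \<in> points S. P x} \<subseteq> T ` {x \<in> points S. P (T x)}"
  proof
    fix x assume "x \<in> {x \<in> points S. P x}"
    then show "x \<in> T ` {x \<in> points S. P (T x)}" using T' by (intro image_eqI[of _ _ "T' x"]) auto
  qed
qed (use assms in simp)

lemma finite_T': assumes "finite {x \<in> points S. P x}" shows "finite {x \<in> points S. P (T x)}"
proof (rule finite_subset)
  show "{x \<in> points S. P (T x)} \<subseteq> T' ` {x \<in> points S. P x}"
  proof
    fix x assume "x \<in> {x \<in> points S. P (T x)}"
    then show "x \<in> T' ` {x \<in> points S. P x}" using T' T_in by (intro image_eqI[of _ _ "T x"]) auto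
  qed
qed (use assms in simp)

text \<open>At a fixed point \<open>g\<close> and \<open>g \<circ> T\<close> have the same limit,
  which cancels in the difference.\<close>

lemma og_T_diff:
  assumes g: "og g x 0" and x: "x \<in> FX" and h: "h = (\<lambda>y. g (T y))"
  shows "og (\<lambda>y. g y - h y) x 1"
proof -
  have xS: "x \<in> points S" and Tx: "T x = x" using x by (auto simp: FX_def)
  obtain l where "((\<lambda>z. g (par x z)) \<longlongrightarrow> l) (at 0)" using ord_ge_tendsto[OF g] .
  then have 1: "og (\<lambda>y. g y - l) x 1" by (rule ord_ge_diff_limit[OF g])
  then have "og (\<lambda>y. g y - l) (T x) 1" by (simp add: Tx)
  from og_comp[OF T_holo T_inj xS this] have 2: "og (\<lambda>y. g (T y) - l) x 1" .
  show ?thesis using ord_ge_diff[OF 1 2] by (simp add: h)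
qed

section \<open>Functions with at most two simple poles\<close>

text \<open>Otherwise \<open>g - g \<circ> T\<close> would have two simple poles but four zeros.\<close>

lemma single_pole_const:
  assumes g: "mero g" and b: "b \<in> points S" "T b \<noteq> b" "og g b (- 1)"
    and other: "\<And>x. x \<in> points S \<Longrightarrow> x \<noteq> b \<Longrightarrow> og g x 0"
  obtains c where "finite {x \<in> points S. g x \<noteq> c}"
proof (cases "og g b 0")
  case True
  then have "og g x 0" if "x \<in> points S" for x using other[OF that] by blast
  then show ?thesis using no_poles_const[OF g] that by blast
next
  case False
  have oeb: "oe g b (- 1)"
  proof (rule disjE[OF ord_ge_cases[OF b(3)]])
    assume "\<forall>\<^sub>F z in at 0. g (par b z) = 0"
    from ord_ge_cong[OF this] show ?thesis using False ord_ge_const[of 0] by blast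
  next
    assume "\<exists>m\<ge>- 1. oe g b m"
    then obtain m where m: "m \<ge> - 1" "oe g b m" by blast
    then have "\<not> m \<ge> 0" using False ord_ge_mono[OF ord_eq_imp_ge] by blast
    then have "m = - 1" using m by simp
    then show ?thesis using m by simp
  qed
  define gT where "gT = (\<lambda>x. g (T x))"
  define w where "w = (\<lambda>x. g x - gT x)"
  have m: "mero w" unfolding w_def gT_def by (intro mero_diff g mero_T)
  have gT: "og gT x 0" if "x \<in> points S" "T x \<noteq> b" for x
    unfolding gT_def by (rule og_comp[OF T_holo T_inj that(1) other[OF T_in[OF that(1)] that(2)]])
  \<comment> \<open>The only possible pole of \<open>g \<circ> T\<close> is at
    \<open>T' b \<noteq> b\<close>, so the pole of \<open>g\<close> at \<open>b\<close> is not
    cancelled.\<close>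
  have "oe (\<lambda>x. g x + (- 1) * gT x) b (- 1)"
    by (rule ord_eq_add[OF oeb ord_ge_cmult[OF gT[OF b(1,2)]]]) simp
  then have "oe w b (- 1)" by (simp add: w_def)
  then have nzw: "nz w" using oe_imp_nz[OF m b(1)] by blast
  define b' where "b' = T' b"
  have b': "b' \<in> points S" "T b' = b" using T' b by (auto simp: b'_def)
  have gT': "og gT b' (- 1)"
    unfolding gT_def by (rule og_comp[OF T_holo T_inj b'(1)]) (simp add: b' b)
  have bF: "b \<notin> FX" "b' \<notin> FX" using b b' by (auto simp: FX_def)
  have "card FX \<le> card {b, b'}"
  proof (rule ord_sum_bound[OF m nzw])
    show "{b, b'} \<inter> FX = {}" using bF by auto
    show "og w x 1" if "x \<in> FX" for x unfolding w_def
      by (rule og_T_diff[OF _ that gT_def]) (use other bF FX that in blast)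
    have og1: "og g x (- 1)" if "x \<in> points S" for x
      using other[OF that] b(3) by (cases "x = b") (auto intro: ord_ge_mono)
    have og2: "og gT x (- 1)" if "x \<in> points S" for x
      using gT[OF that] gT' T_eq[OF that b'(1)] b'(2) by (cases "x = b'") (auto intro: ord_ge_mono)
    show "og w x (- 1)" if "x \<in> {b, b'}" for x unfolding w_def
      using that b b' by (intro ord_ge_diff og1 og2) auto
    show "og w x 0" if "x \<in> points S" "x \<notin> {b, b'}" for x unfolding w_def
      using that other T_eq[OF that(1) b'(1)] b'(2) by (intro ord_ge_diff gT) auto
  qed (use b b' FX in auto)
  also have "card {b, b'} \<le> 2" by (rule card_insert_le_m1) auto
  finally show ?thesis using FX by simp
qed

text \<open>Cancelling the pole at \<open>a\<close> with a multiple of \<open>F\<close> leaves at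
  most a simple pole at \<open>b\<close>, to which \<open>single_pole_const\<close> applies; this is
  why \<open>T\<close> must move \<open>b\<close>.\<close>

lemma two_poles_dim:
  assumes F: "mero F" "a \<in> points S" "b \<in> points S" "a \<noteq> b" "T b \<noteq> b" "oe F a (- 1)" "oe F b (- 1)"
      "\<And>x. x \<in> points S \<Longrightarrow> x \<notin> {a, b} \<Longrightarrow> og F x 0"
    and u: "mero u" "og u a (- 1)" "og u b (- 1)" "\<And>x. x \<in> points S \<Longrightarrow> x \<notin> {a, b} \<Longrightarrow> og u x 0"
  obtains \<alpha> \<beta> where "finite {x \<in> points S. u x \<noteq> \<alpha> * F x + \<beta>}"
proof -
  obtain \<alpha> where \<alpha>: "og (\<lambda>x. u x - \<alpha> * F x) a 0" using ord_ge_kill[OF u(2) F(6)] by auto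
  have "mero (\<lambda>x. u x - \<alpha> * F x)" by (intro mero_diff mero_mult mero_const u F)
  moreover have "og (\<lambda>x. u x - \<alpha> * F x) b (- 1)"
    by (intro ord_ge_diff ord_ge_cmult u(3) ord_eq_imp_ge[OF F(7)])
  moreover have "og (\<lambda>x. u x - \<alpha> * F x) x 0" if "x \<in> points S" "x \<noteq> b" for x
  proof (cases "x = a")
    case False
    then show ?thesis using that by (intro ord_ge_diff ord_ge_cmult u(4) F(8)) auto
  qed (use \<alpha> in simp)
  ultimately obtain \<beta> where \<beta>: "finite {x \<in> points S. u x - \<alpha> * F x \<noteq> \<beta>}"
    using single_pole_const[OF _ F(3,5)] by blast
  have eq: "{x \<in> points S. u x \<noteq> \<alpha> * F x + \<beta>} = {x \<in> points S. u x - \<alpha> * F x \<noteq> \<beta>}"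
    by (auto simp: algebra_simps)
  show ?thesis by (rule that[of \<alpha> \<beta>]) (simp only: eq \<beta>)
qed

text \<open>The relation is stated without denominators, outside a finite set. The condition
  \<open>\<alpha> \<noteq> 0\<close> says that infinity is not a fixed value of the transformation,
  so its fixed values can be found by solving a quadratic equation.\<close>

lemma moebius_relation:
  assumes F: "mero F" "a \<in> points S" "b \<in> points S" "a \<noteq> b" "oe F a (- 1)" "oe F b (- 1)"
      "\<And>x. x \<in> points S \<Longrightarrow> x \<notin> {a, b} \<Longrightarrow> og F x 0"
    and disj: "\<And>x. x \<in> {a, b} \<Longrightarrow> T x \<notin> {a, b} \<and> T (T x) \<notin> {a, b}"
  obtains \<alpha> \<beta> \<gamma> \<delta> where "\<alpha> \<noteq> 0" "finite {x \<in> points S. F (T x) * (\<alpha> * F x + \<beta>) \<noteq> \<gamma> * F x + \<delta>}"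
proof -
  define F1 where "F1 = (\<lambda>x. F (T x))"
  define F2 where "F2 = (\<lambda>x. F1 (T x))"
  define D1 where "D1 = {T' a, T' b}"
  define D2 where "D2 = {T' (T' a), T' (T' b)}"
  have D1: "x \<in> D1 \<longleftrightarrow> T x \<in> {a, b}" if "x \<in> points S" for x
    unfolding D1_def using T'_iff[OF that F(2)] T'_iff[OF that F(3)] by blast
  have D2: "x \<in> D2 \<longleftrightarrow> T (T x) \<in> {a, b}" if "x \<in> points S" for x
    unfolding D2_def using T'_iff[OF that T'(1)[OF F(2)]] T'_iff[OF that T'(1)[OF F(3)]]
      T'_iff[OF T_in[OF that] F(2)] T'_iff[OF T_in[OF that] F(3)] by blast
  have DS: "D1 \<subseteq> points S" "D2 \<subseteq> points S" using F(2,3) T' by (auto simp: D1_def D2_def)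
  have card: "card {a, b} = 2" "card D1 = 2" "card D2 = 2"
  proof -
    have ne: "T' x \<noteq> T' y" if "x \<in> points S" "y \<in> points S" "x \<noteq> y" for x y
      using T'(2)[OF that(1)] T'(2)[OF that(2)] that(3) by auto
    show "card {a, b} = 2" using F(4) by simp
    show "card D1 = 2" using ne[OF F(2-4)] by (simp add: D1_def)
    show "card D2 = 2" using ne[OF T'(1)[OF F(2)] T'(1)[OF F(3)] ne[OF F(2-4)]] by (simp add: D2_def)
  qed
  have d01: "{a, b} \<inter> D1 = {}" using D1 disj F(2,3) by auto
  have d02: "{a, b} \<inter> D2 = {}" using D2 disj F(2,3) by auto
  have d12: "D1 \<inter> D2 = {}" using D1 D2 DS disj by blast
  have dF: "{a, b} \<inter> FX = {}" "D1 \<inter> FX = {}" "D2 \<inter> FX = {}"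
  proof -
    show "{a, b} \<inter> FX = {}" using disj by (auto simp: FX_def)
    then show "D1 \<inter> FX = {}" "D2 \<inter> FX = {}" using D1 D2 by (auto simp: FX_def)
  qed
  have og0: "og F x (- 1)" if "x \<in> points S" for x
    using F(5) F(6) F(7)[OF that] by (cases "x \<in> {a, b}") (auto intro: ord_ge_mono ord_eq_imp_ge)
  have m1: "mero F1" and m2: "mero F2" unfolding F2_def F1_def by (intro mero_T F)+
  have og1: "og F1 x (- 1)" if "x \<in> points S" for x
    unfolding F1_def by (rule og_comp[OF T_holo T_inj that og0[OF T_in[OF that]]])
  have og1': "og F1 x 0" if "x \<in> points S" "x \<notin> D1" for x
    unfolding F1_def by (rule og_comp[OF T_holo T_inj that(1) F(7)]) (use that D1 T_in in auto)
  have og2: "og F2 x (- 1)" if "x \<in> points S" for x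
    unfolding F2_def by (rule og_comp[OF T_holo T_inj that og1[OF T_in[OF that]]])
  have og2': "og F2 x 0" if "x \<in> points S" "x \<notin> D2" for x
    unfolding F2_def by (rule og_comp[OF T_holo T_inj that(1) og1']) (use that D1 D2 T_in in auto)
  \<comment> \<open>Serves \<open>G = F1\<close> with \<open>D = D1\<close> and
    \<open>G = F2\<close> with \<open>D = D2\<close>. Four possible poles face four fixed points, so
    the equality case of \<open>ord_sum_bound\<close> determines all orders.\<close>
  have key: "oe (\<lambda>x. F x - G x) x (if x \<in> {a, b} \<union> D then - 1 else if x \<in> FX then 1 else 0) \<and> mero (\<lambda>x. F x - G x)
       \<and> nz (\<lambda>x. F x - G x)"
    if G: "mero G" "\<And>x. x \<in> points S \<Longrightarrow> og G x (- 1)" "\<And>x. x \<in> points S \<Longrightarrow> x \<notin> D \<Longrightarrow> og G x 0"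
      "\<And>x. x \<in> FX \<Longrightarrow> og (\<lambda>x. F x - G x) x 1"
      and D: "D \<subseteq> points S" "card D = 2" "{a, b} \<inter> D = {}" "D \<inter> FX = {}" and x: "x \<in> points S" for G D x
  proof -
    have m: "mero (\<lambda>x. F x - G x)" by (intro mero_diff F G)
    have "a \<notin> D" using D by auto
    have "oe (\<lambda>x. F x + (- 1) * G x) a (- 1)"
      by (rule ord_eq_add[OF F(5) ord_ge_cmult[OF G(3)[OF F(2) \<open>a \<notin> D\<close>]]]) simp
    then have "oe (\<lambda>x. F x - G x) a (- 1)" by simp
    then have nz: "nz (\<lambda>x. F x - G x)" using oe_imp_nz[OF m F(2)] by blast
    have fD: "finite D" using D(2) card.infinite by fastforce
    have cd: "card FX = card ({a, b} \<union> D)" using card_Un_disjoint[of "{a, b}" D] D card fD FX by simp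
    have "oe (\<lambda>x. F x - G x) x (if x \<in> {a, b} \<union> D then - 1 else if x \<in> FX then 1 else 0)"
    proof (rule ord_sum_bound(2)[OF m nz _ _ _ _ _ _ _ _ cd x])
      show "({a, b} \<union> D) \<inter> FX = {}" using dF D by auto
      show "og (\<lambda>x. F x - G x) x (- 1)" if "x \<in> {a, b} \<union> D" for x
        using that F(2,3) D by (intro ord_ge_diff og0 G(2)) auto
      show "og (\<lambda>x. F x - G x) x 1" if "x \<in> FX" for x using G(4)[OF that] .
      show "og (\<lambda>x. F x - G x) x 0" if "x \<in> points S" "x \<notin> {a, b} \<union> D" for x
        using that by (intro ord_ge_diff F(7) G(3)) auto
    qed (use fD FX F D in auto)
    then show ?thesis using m nz by blast
  qed
  have Fx0: "og F x 0" if "x \<in> FX" for x using F(7) that dF FX by blast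
  have F1x0: "og F1 x 0" if "x \<in> FX" for x using og1' that dF FX by blast
  have dd1: "og (\<lambda>x. F x - F1 x) x 1" if "x \<in> FX" for x
    by (rule og_T_diff[OF Fx0[OF that] that F1_def])
  have dd2: "og (\<lambda>x. F x - F2 x) x 1" if "x \<in> FX" for x
    using ord_ge_add[OF dd1[OF that] og_T_diff[OF F1x0[OF that] that F2_def]] by simp
  define w1 where "w1 = (\<lambda>x. F x - F1 x)"
  define w2 where "w2 = (\<lambda>x. F x - F2 x)"
  have k1: "oe w1 x (if x \<in> {a, b} \<union> D1 then - 1 else if x \<in> FX then 1 else 0) \<and> mero w1 \<and> nz w1"
    if "x \<in> points S" for x
    unfolding w1_def by (rule key[OF m1 og1 og1' dd1 DS(1) card(2) d01 dF(2) that])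
  have k2: "oe w2 x (if x \<in> {a, b} \<union> D2 then - 1 else if x \<in> FX then 1 else 0) \<and> mero w2 \<and> nz w2"
    if "x \<in> points S" for x
    unfolding w2_def by (rule key[OF m2 og2 og2' dd2 DS(2) card(3) d02 dF(3) that])
  have w: "mero w1" "mero w2" "nz w2" using k1[OF F(2)] k2[OF F(2)] by auto
  define v where "v = (\<lambda>x. w1 x / w2 x)"
  have mv: "mero v" unfolding v_def by (rule mero_divide[OF w])
  \<comment> \<open>The poles at \<open>a\<close> and \<open>b\<close> and the zeros at the fixed
    points cancel in the quotient.\<close>
  have oev: "oe v x (if x \<in> D1 then - 1 else if x \<in> D2 then 1 else 0)" if x: "x \<in> points S" for x
    using ord_eq_divide[OF k1[OF x, THEN conjunct1] k2[OF x, THEN conjunct1]] d01 d02 d12 dF unfolding v_def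
    by (cases "x \<in> D1"; cases "x \<in> D2"; cases "x \<in> {a, b}"; cases "x \<in> FX") auto
  \<comment> \<open>On \<open>D1\<close> the function \<open>F\<close> has no pole, so
    \<open>F1 = F - w1\<close> inherits the pole of \<open>w1\<close>.\<close>
  have oe1: "oe F1 x (- 1)" if "x \<in> D1" for x
  proof -
    have x: "x \<in> points S" "x \<notin> {a, b}" using that DS d01 by auto
    have w1: "oe w1 x (- 1)" using k1[OF x(1)] that by simp
    have "oe (\<lambda>x. (- 1) * w1 x) x (- 1)" using ord_eq_mult[OF ord_eq_const[of "-1"] w1] by simp
    from ord_eq_add[OF this F(7)[OF x]] have "oe (\<lambda>x. (- 1) * w1 x + F x) x (- 1)" by simp
    then show ?thesis by (simp add: w1_def)
  qed
  define a' b' where "a' = T' a" and "b' = T' b"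
  have ab': "a' \<in> points S" "b' \<in> points S" "a' \<noteq> b'" "T b' \<noteq> b'"
    and Dab: "D1 = {a', b'}"
    using card(2) DS dF by (auto simp: a'_def b'_def D1_def FX_def)
  have oeab: "oe F1 a' (- 1)" "oe F1 b' (- 1)" using oe1 Dab by auto
  have rest: "og F1 x 0" if "x \<in> points S" "x \<notin> {a', b'}" for x using og1' that Dab by auto
  have dim: "\<exists>\<alpha> \<beta>. finite {x \<in> points S. u x \<noteq> \<alpha> * F1 x + \<beta>}"
    if u: "mero u" "og u a' (- 1)" "og u b' (- 1)" "\<And>x. x \<in> points S \<Longrightarrow> x \<notin> {a', b'} \<Longrightarrow> og u x 0" for u
  proof -
    obtain \<alpha> \<beta> where "finite {x \<in> points S. u x \<noteq> \<alpha> * F1 x + \<beta>}"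
      by (rule two_poles_dim[OF m1 ab' oeab rest u])
    then show ?thesis by blast
  qed
  have ogv: "og v x (- 1)" if "x \<in> points S" for x
    using oev[OF that] by (intro ord_ge_mono[OF ord_eq_imp_ge[OF oev[OF that]]]) auto
  have ogv': "og v x 0" if "x \<in> points S" "x \<notin> {a', b'}" for x
    using oev[OF that(1)] that Dab by (intro ord_ge_mono[OF ord_eq_imp_ge[OF oev[OF that(1)]]]) auto
  obtain \<alpha> \<beta> where ab: "finite {x \<in> points S. v x \<noteq> \<alpha> * F1 x + \<beta>}"
    using dim[OF mv ogv[OF ab'(1)] ogv[OF ab'(2)] ogv'] by blast
  \<comment> \<open>Otherwise \<open>v\<close> would be constant outside a finite set, but it has
    poles on \<open>D1\<close>.\<close>
  have "\<alpha> \<noteq> 0"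
  proof
    assume "\<alpha> = 0"
    then have "finite {x \<in> points S. v x \<noteq> \<beta>}" using ab by simp
    from og_cong[OF this ab'(1)] have "og v a' 0" using ord_ge_const by blast
    moreover have "oe v a' (- 1)" using oev[OF ab'(1)] Dab by simp
    ultimately show False using ord_ge_eq_le by fastforce
  qed
  \<comment> \<open>The zeros of \<open>v\<close> on \<open>D2\<close> cancel the poles of
    \<open>F2\<close>, so the only poles left are those of \<open>v\<close> on
    \<open>D1\<close>.\<close>
  define u where "u = (\<lambda>x. F2 x * v x)"
  have mu: "mero u" unfolding u_def by (intro mero_mult m2 mv)
  have ogu: "og u x (- 1)" if "x \<in> D1" for x
    using ord_ge_mult[OF og2' ogv, of x x] that DS d12 unfolding u_def by auto
  have ogu': "og u x 0" if "x \<in> points S" "x \<notin> {a', b'}" for x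
  proof (cases "x \<in> D2")
    case True
    then have "og v x 1" using oev[OF that(1)] that Dab d12 by (intro ord_eq_imp_ge) auto
    from ord_ge_mult[OF og2[OF that(1)] this] show ?thesis by (simp add: u_def)
  next
    case False
    from ord_ge_mult[OF og2'[OF that(1) False] ogv'[OF that]] show ?thesis by (simp add: u_def)
  qed
  obtain \<gamma> \<delta> where cd: "finite {x \<in> points S. u x \<noteq> \<gamma> * F1 x + \<delta>}"
    using dim[OF mu ogu ogu ogu'] Dab by blast
  have "finite {x \<in> points S. F (T (T x)) * (\<alpha> * F (T x) + \<beta>) \<noteq> \<gamma> * F (T x) + \<delta>}"
    by (rule finite_subset[OF _ finite_UnI[OF ab cd]]) (auto simp: u_def F2_def F1_def)
  \<comment> \<open>So far the relation holds with \<open>T x\<close> in place of \<open>x\<close>;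
    since \<open>T\<close> permutes the points, the shift can be undone.\<close>
  then have "finite {x \<in> points S. F (T x) * (\<alpha> * F x + \<beta>) \<noteq> \<gamma> * F x + \<delta>}"
    by (rule finite_T[where P = "\<lambda>x. F (T x) * (\<alpha> * F x + \<beta>) \<noteq> \<gamma> * F x + \<delta>"])
  then show ?thesis using that \<open>\<alpha> \<noteq> 0\<close> by blast
qed

section \<open>The function of degree two\<close>

lemma ex_outside: "finite E \<Longrightarrow> \<exists>x\<in>points S. x \<notin> E"
  using infinite_points finite_subset[of "points S" E] by blast

text \<open>If \<open>f\<close> were invariant under \<open>T ^^ j\<close>, a generic fibre would
  contain a point and its images under \<open>T ^^ j\<close> and \<open>T ^^ (2 * j)\<close>. These
  are three distinct points by the conditions on \<open>j\<close>, but the fibre has only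
  two.\<close>

lemma finite_coincidence:
  assumes f: "holomorphic_map S riemann_sphere f" "has_degree S riemann_sphere f 2"
    and j: "\<not> p dvd j" "\<not> p dvd 2 * j"
  shows "finite {x \<in> points S. f ((T ^^ j) x) = f x}"
proof -
  define u where "u = rcp 0 f"
  define A where "A = T ^^ j"
  have u: "mero u" unfolding u_def by (rule mero_rcp[OF f(1)])
  have nzq: "nz (\<lambda>x. u x - q)" for q unfolding u_def by (rule rcp_degree(1)[OF f(1) _ f(2)]) simp
  have mA: "mero (\<lambda>x. u ((T ^^ i) x))" for i
  proof (induction i)
    case (Suc i)
    from mero_T[OF Suc] show ?case by (simp add: funpow_swap1)
  qed (use u in simp)
  have w: "mero (\<lambda>x. u x - u (A x))" unfolding A_def by (intro mero_diff u mA)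
  have fA: "finite {x \<in> points S. P ((T ^^ i) x)}" if "finite {x \<in> points S. P x}" for P i
  proof (induction i)
    case (Suc i)
    from finite_T'[OF Suc] show ?case by (simp add: funpow_swap1)
  qed (use that in simp)
  have "nz (\<lambda>x. u x - u (A x))"
  proof (rule ccontr)
    assume "\<not> nz (\<lambda>x. u x - u (A x))"
    then have E: "finite {x \<in> points S. u x \<noteq> u (A x)}" using mero_zero_or_nz[OF w] by simp
    have E2: "finite {x \<in> points S. u (A x) \<noteq> u (A (A x))}" using fA[OF E, of j] by (simp add: A_def)
    \<comment> \<open>Values of \<open>u\<close> to be avoided: those over fibres of the wrong size,
      and 0, where \<open>u\<close> does not determine \<open>f\<close>.\<close>
    define C where "C = insert 0 ((\<lambda>y. 1 / the y) ` {y. card {x \<in> points S. f x = y} \<noteq> 2})"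
    have "finite C" using f(2) by (simp add: C_def has_degree_def sphere_points)
    then have E3: "finite (\<Union>q\<in>C. {x \<in> points S. u x - q = 0})" using nz_finite_zeros[OF nzq] by blast
    obtain x where x: "x \<in> points S" "u (A x) = u x" "u (A (A x)) = u (A x)" "u x \<notin> C" "x \<notin> FX"
    proof -
      have "finite ({x \<in> points S. u x \<noteq> u (A x)} \<union> {x \<in> points S. u (A x) \<noteq> u (A (A x))} \<union>
        (\<Union>q\<in>C. {x \<in> points S. u x - q = 0}) \<union> FX)" using E E2 E3 FX(1) by simp
      from ex_outside[OF this]
      obtain x where "x \<in> points S" "x \<notin> {x \<in> points S. u x \<noteq> u (A x)} \<union> {x \<in> points S. u (A x) \<noteq> u (A (A x))} \<union>
        (\<Union>q\<in>C. {x \<in> points S. u x - q = 0}) \<union> FX"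
        by blast
      then show ?thesis by (intro that[of x]) auto
    qed
    have ux: "u x \<noteq> 0" using x(4) by (auto simp: C_def)
    have fx: "f y = Some (1 / u x)" if "u y = u x" for y
      using rcp_eq_iff[OF ux, of 0 f y] that by (simp add: u_def)
    have "card {y \<in> points S. f y = Some (1 / u x)} = 2"
    proof (rule ccontr)
      assume "card {y \<in> points S. f y = Some (1 / u x)} \<noteq> 2"
      then have "1 / the (Some (1 / u x)) \<in> C" unfolding C_def by blast
      then show False using x(4) by simp
    qed
    moreover have AS: "A x \<in> points S" "A (A x) \<in> points S" using x(1) Tpow_in by (auto simp: A_def)
    then have sub: "{x, A x, A (A x)} \<subseteq> {y \<in> points S. f y = Some (1 / u x)}" using x fx by simp
    moreover have nT: "T x \<noteq> x" using x by (simp add: FX_def)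
    have d1: "A x \<noteq> x" using fixed_if_Tpow[OF x(1), of j] j nT by (auto simp: A_def)
    have "(T ^^ (2 * j)) x = A (A x)" by (simp add: A_def mult_2 funpow_add)
    then have d2: "A (A x) \<noteq> x" using fixed_if_Tpow[OF x(1), of "2 * j"] j nT by auto
    have "inj_on A (points S)"
    proof (rule inj_onI)
      fix y z assume yz: "y \<in> points S" "z \<in> points S" "A y = A z"
      show "y = z" using yz(3) unfolding A_def
      proof (induction j)
        case (Suc i)
        then show ?case using T_eq[OF Tpow_in[OF yz(1)] Tpow_in[OF yz(2)], of i i] by simp
      qed simp
    qed
    then have "A (A x) \<noteq> A x" using d1 x(1) AS by (auto dest: inj_onD)
    then have "card {x, A x, A (A x)} = 3" using d1 d2 by auto
    ultimately show False
      using card_mono[OF _ sub] card.infinite[of "{y \<in> points S. f y = Some (1 / u x)}"] by fastforce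
  qed
  from nz_finite_zeros[OF this] show ?thesis
    by (rule finite_subset[rotated]) (auto simp: u_def rcp_def A_def)
qed

text \<open>\<open>F\<close> is \<open>1/(f - c)\<close> for a generic \<open>c\<close>: the fibre
  over \<open>c\<close> has two points, and neither \<open>T\<close> nor \<open>T \<circ> T\<close>
  maps a point of this fibre into it.\<close>

lemma double_cover_function:
  assumes f: "holomorphic_map S riemann_sphere f" "has_degree S riemann_sphere f 2"
  obtains F a b where "mero F" "a \<in> points S" "b \<in> points S" "a \<noteq> b" "oe F a (- 1)" "oe F b (- 1)"
    "\<forall>x\<in>points S. x \<notin> {a, b} \<longrightarrow> og F x 0"
    "\<forall>x\<in>{a, b}. T x \<notin> {a, b} \<and> T (T x) \<notin> {a, b}"
    "\<forall>q. nz (\<lambda>x. F x - q)" "\<forall>q. zeros_at F q = 2"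
proof -
  have nd: "\<not> p dvd 1" "\<not> p dvd 2" "\<not> p dvd 2 * 1" "\<not> p dvd 2 * 2"
  proof -
    show "\<not> p dvd 1" "\<not> p dvd 2" "\<not> p dvd 2 * 1" using p_gt by (auto dest: dvd_imp_le)
    \<comment> \<open>The case of \<open>T \<circ> T\<close> needs that \<open>p\<close> does not
      divide 4; here oddness enters.\<close>
    then show "\<not> p dvd 2 * 2" using p(1) by (metis mult_1_right prime_dvd_mult_iff)
  qed
  define B where "B = {y. card {x \<in> points S. f x = y} \<noteq> 2} \<union> f ` {x \<in> points S. f (T x) = f x}
     \<union> f ` {x \<in> points S. f (T (T x)) = f x}"
  have fin1: "finite {x \<in> points S. f (T x) = f x}" using finite_coincidence[OF f nd(1,3)] by simp
  have fin2: "finite {x \<in> points S. f (T (T x)) = f x}"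
    using finite_coincidence[OF f nd(2,4)] by (simp add: numeral_2_eq_2)
  have "finite {y. card {x \<in> points S. f x = y} \<noteq> 2}" using f(2) by (simp add: has_degree_def sphere_points)
  then have "finite B" unfolding B_def using fin1 fin2 by blast
  then have "finite (Some -` B)" by (rule finite_vimageI) simp
  then obtain c where "c \<notin> Some -` B" using ex_new_if_finite[OF infinite_UNIV_char_0[where 'a = complex]] by blast
  then have c: "Some c \<notin> B" by simp
  then have "card {x \<in> points S. f x = Some c} = 2" by (auto simp: B_def)
  then obtain a b where ab: "{x \<in> points S. f x = Some c} = {a, b}" "a \<noteq> b" by (auto simp: card_2_iff)
  have abS: "a \<in> points S" "b \<in> points S" "f a = Some c" "f b = Some c" using ab by blast+
  define F where "F = rcp c f"
  have F: "mero F" unfolding F_def by (rule mero_rcp[OF f(1)])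
  have deg: "nz (\<lambda>x. F x - q)" "zeros_at F q = 2" "num_poles F = 2" for q
    unfolding F_def by (rule rcp_degree[OF f(1) _ f(2)], simp)+
  have nzF: "nz F" using deg(1)[of 0] by simp
  have og: "og F x 0" if "x \<in> points S" "x \<notin> {a, b}" for x
    unfolding F_def by (rule reg_og[OF reg_rcp[OF f(1) that(1)]]) (use that ab in blast)
  have neg: "ord F a < 0" "ord F b < 0"
    using rcp_at_pole(2)[OF f(1) abS(1,3)] rcp_at_pole(2)[OF f(1) abS(2,4)]
      oe_ord[OF F nzF abS(1)] oe_ord[OF F nzF abS(2)] by (auto simp: F_def)
  have "{x \<in> points S. nat (- ord F x) \<noteq> 0} = {a, b}"
    using neg abS og_le_ord[OF F nzF _ og] by force
  \<comment> \<open>Two poles of total multiplicity two are both simple.\<close>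
  then have "nat (- ord F a) + nat (- ord F b) = 2" using deg(3) ab(2) by (simp add: num_poles_def)
  then have "ord F a = - 1" "ord F b = - 1" using neg by auto
  then have oe: "oe F a (- 1)" "oe F b (- 1)" using oe_ord[OF F nzF abS(1)] oe_ord[OF F nzF abS(2)] by auto
  have disj: "T x \<notin> {a, b} \<and> T (T x) \<notin> {a, b}" if "x \<in> {a, b}" for x
  proof -
    have x: "x \<in> points S" "f x = Some c" using that abS by auto
    have "f x \<notin> f ` {x \<in> points S. f (T x) = f x}" "f x \<notin> f ` {x \<in> points S. f (T (T x)) = f x}"
      using c unfolding x(2) B_def by blast+
    then have "f (T x) \<noteq> f x" "f (T (T x)) \<noteq> f x" using x(1) by blast+
    then show ?thesis using x(2) abS by auto
  qed
  show ?thesis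
    by (rule that[OF F abS(1,2) ab(2) oe]) ((intro ballI allI impI og disj deg(1,2); assumption)+)
qed

section \<open>Linearising the action on the function of degree two\<close>

lemma generic_orbit:
  assumes "finite {x \<in> points S. \<not> P x}" obtains x where "x \<in> points S" "\<And>k. P ((T ^^ k) x)"
proof -
  have fA: "finite {x \<in> points S. \<not> P ((T ^^ i) x)}" for i
  proof (induction i)
    case (Suc i)
    from finite_T'[OF Suc] show ?case by (simp add: funpow_swap1)
  qed (use assms in simp)
  \<comment> \<open>Only exponents below \<open>p\<close> matter, so finitely many finite sets are
    excluded.\<close>
  then have "finite (\<Union>i<p. {x \<in> points S. \<not> P ((T ^^ i) x)})" by blast
  from ex_outside[OF this]
  obtain x where x: "x \<in> points S" "x \<notin> (\<Union>i<p. {x \<in> points S. \<not> P ((T ^^ i) x)})" by blast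
  have "P ((T ^^ k) x)" for k
  proof -
    have "P ((T ^^ (k mod p)) x)" using x p_gt by auto
    then show ?thesis by (simp add: Tpow_mod[OF x(1)])
  qed
  then show ?thesis using that x(1) by blast
qed

text \<open>After \<open>p\<close> iterations the orbit is back at its start, so
  \<open>p * \<mu> = 0\<close>. This rules out a parabolic transformation.\<close>

lemma order_const_add:
  fixes \<mu> :: complex
  assumes "finite {x \<in> points S. u (T x) \<noteq> u x + \<mu>}" shows "\<mu> = 0"
proof -
  have "finite {x \<in> points S. \<not> u (T x) = u x + \<mu>}" using assms by simp
  then obtain x where x: "x \<in> points S" "\<And>k. u (T ((T ^^ k) x)) = u ((T ^^ k) x) + \<mu>"
    by (rule generic_orbit) blast
  have "u ((T ^^ k) x) = u x + of_nat k * \<mu>" for k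
    by (induction k) (use x(2) in \<open>simp_all add: algebra_simps\<close>)
  from this[of p] have "of_nat p * \<mu> = 0" using Tp[OF x(1)] by simp
  then show ?thesis using p_gt by simp
qed

lemma order_const_mult:
  fixes \<omega> :: complex
  assumes "finite {x \<in> points S. u (T x) \<noteq> \<omega> * u x}" "nz u" shows "\<omega> ^ p = 1"
proof -
  have "finite {x \<in> points S. \<not> (u (T x) = \<omega> * u x \<and> u x \<noteq> 0)}"
    by (rule finite_subset[OF _ finite_UnI[OF assms(1) nz_finite_zeros[OF assms(2)]]]) auto
  then obtain x where x: "x \<in> points S" "\<And>k. u (T ((T ^^ k) x)) = \<omega> * u ((T ^^ k) x) \<and> u ((T ^^ k) x) \<noteq> 0"
    by (rule generic_orbit) blast
  have "u ((T ^^ k) x) = \<omega> ^ k * u x" for k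
    by (induction k) (use x(2) in \<open>simp_all add: algebra_simps\<close>)
  from this[of p] have "(\<omega> ^ p - 1) * u x = 0" using Tp[OF x(1)] by (simp add: algebra_simps)
  then show ?thesis using x(2)[of 0] by simp
qed

text \<open>\<open>z1\<close> and \<open>z2\<close> are the fixed values of the Moebius
  transformation. Sending them to 0 and infinity turns it into multiplication by its multiplier
  \<open>\<omega>\<close>.\<close>

lemma linearization:
  assumes F: "\<And>q. nz (\<lambda>x. F x - q)"
    and rel: "\<alpha> \<noteq> 0" "finite {x \<in> points S. F (T x) * (\<alpha> * F x + \<beta>) \<noteq> \<gamma> * F x + \<delta>}"
  obtains z1 z2 \<omega> where "z1 \<noteq> z2" "\<omega> ^ p = 1" "\<omega> \<noteq> 1"
    "finite {x \<in> points S. (F (T x) - z1) / (F (T x) - z2) \<noteq> \<omega> * ((F x - z1) / (F x - z2))}"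
proof -
  \<comment> \<open>A square root of the discriminant of the equation
    \<open>\<alpha> * z\<^sup>2 + (\<beta> - \<gamma>) * z = \<delta>\<close> for the fixed
    values.\<close>
  define s where "s = csqrt ((\<beta> - \<gamma>)\<^sup>2 + 4 * \<alpha> * \<delta>)"
  define z1 where "z1 = (\<gamma> - \<beta> + s) / (2 * \<alpha>)"
  define z2 where "z2 = (\<gamma> - \<beta> - s) / (2 * \<alpha>)"
  have s2: "s\<^sup>2 = (\<beta> - \<gamma>)\<^sup>2 + 4 * \<alpha> * \<delta>" by (simp add: s_def)
  have root: "\<alpha> * z\<^sup>2 + (\<beta> - \<gamma>) * z = \<delta>" if "2 * \<alpha> * z = \<gamma> - \<beta> + t" "t\<^sup>2 = s\<^sup>2" for z t
  proof -
    have "4 * \<alpha> * (\<alpha> * z\<^sup>2 + (\<beta> - \<gamma>) * z) = (2 * \<alpha> * z)\<^sup>2 - 2 * (2 * \<alpha> * z) * (\<gamma> - \<beta>)"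
      by (simp add: power2_eq_square algebra_simps)
    also have "\<dots> = t\<^sup>2 - (\<gamma> - \<beta>)\<^sup>2" unfolding that(1) by (simp add: power2_eq_square algebra_simps)
    also have "\<dots> = 4 * \<alpha> * \<delta>" unfolding that(2) s2 by (simp add: power2_eq_square algebra_simps)
    finally show ?thesis using rel(1) by simp
  qed
  have z1: "2 * \<alpha> * z1 = \<gamma> - \<beta> + s" and z2: "2 * \<alpha> * z2 = \<gamma> - \<beta> + (- s)"
    using rel(1) by (simp_all add: z1_def z2_def)
  have r: "\<alpha> * z1\<^sup>2 + (\<beta> - \<gamma>) * z1 = \<delta>" "\<alpha> * z2\<^sup>2 + (\<beta> - \<gamma>) * z2 = \<delta>"
    using root[OF z1] root[OF z2] by simp_all
  \<comment> \<open>Besides the exceptions to the relation, this contains all points where a factor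
    to be cancelled vanishes.\<close>
  define E where "E = {x \<in> points S. F (T x) * (\<alpha> * F x + \<beta>) \<noteq> \<gamma> * F x + \<delta>} \<union>
     {x \<in> points S. F x - (- \<beta> / \<alpha>) = 0} \<union> {x \<in> points S. F x - z1 = 0} \<union> {x \<in> points S. F x - z2 = 0}
     \<union> {x \<in> points S. F (T x) - z1 = 0} \<union> {x \<in> points S. F (T x) - z2 = 0}"
  have finE: "finite E" unfolding E_def
    by (intro finite_UnI rel(2) nz_finite_zeros[OF F] finite_T'[OF nz_finite_zeros[OF F]])
  \<comment> \<open>For a fixed value \<open>z\<close> the numerator of the transformed
    \<open>F - z\<close> is divisible by \<open>F x - z\<close>.\<close>
  have fact: "(F (T x) - z) * (\<alpha> * F x + \<beta>) = (\<gamma> - \<alpha> * z) * (F x - z)"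
    if "x \<in> points S" "x \<notin> E" "\<alpha> * z\<^sup>2 + (\<beta> - \<gamma>) * z = \<delta>" for x z
  proof -
    have "F (T x) * (\<alpha> * F x + \<beta>) = \<gamma> * F x + \<delta>" using that by (auto simp: E_def)
    then have "(F (T x) - z) * (\<alpha> * F x + \<beta>) = \<gamma> * F x + \<delta> - z * (\<alpha> * F x + \<beta>)"
      by (simp add: left_diff_distrib)
    also have "\<dots> = (\<gamma> - \<alpha> * z) * (F x - z)"
      unfolding that(3)[symmetric] by (simp add: algebra_simps power2_eq_square)
    finally show ?thesis .
  qed
  have Q: "\<alpha> * F x + \<beta> \<noteq> 0" if "x \<in> points S" "x \<notin> E" for x
  proof
    assume "\<alpha> * F x + \<beta> = 0"
    then have "F x - (- \<beta> / \<alpha>) = 0" using rel(1) by (simp add: field_simps)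
    then show False using that by (auto simp: E_def)
  qed
  have ne: "F x - z1 \<noteq> 0" "F x - z2 \<noteq> 0" "F (T x) - z1 \<noteq> 0" "F (T x) - z2 \<noteq> 0"
    if "x \<in> points S" "x \<notin> E" for x using that by (auto simp: E_def)
  obtain x0 where x0: "x0 \<in> points S" "x0 \<notin> E" using ex_outside[OF finE] by blast
  have k: "\<gamma> - \<alpha> * z1 \<noteq> 0" "\<gamma> - \<alpha> * z2 \<noteq> 0"
    using fact[OF x0 r(1)] fact[OF x0 r(2)] Q[OF x0] ne[OF x0] by auto
  show ?thesis
  proof (cases "z1 = z2")
    case True
    \<comment> \<open>The parabolic case: with a double fixed value, \<open>1/(F - z1)\<close> is
      shifted by a nonzero constant, which finite order forbids.\<close>
    define u where "u = (\<lambda>x. 1 / (F x - z1))"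
    have "s = 0" using z1 z2 True by simp
    have "\<alpha> * z1 + \<beta> - (\<gamma> - \<alpha> * z1) = 2 * \<alpha> * z1 - (\<gamma> - \<beta>)" by (simp add: algebra_simps)
    also have "\<dots> = 0" unfolding z1 \<open>s = 0\<close> by simp
    finally have ab: "\<alpha> * z1 + \<beta> = \<gamma> - \<alpha> * z1" by (simp only: right_minus_eq)
    have "u (T x) = u x + \<alpha> / (\<gamma> - \<alpha> * z1)" if "x \<in> points S" "x \<notin> E" for x
    proof -
      have "u (T x) = (\<alpha> * F x + \<beta>) / ((\<gamma> - \<alpha> * z1) * (F x - z1))"
        unfolding fact[OF that r(1), symmetric] using Q[OF that] by (simp add: u_def)
      also have "\<alpha> * F x + \<beta> = \<alpha> * (F x - z1) + (\<gamma> - \<alpha> * z1)" using ab by (simp add: algebra_simps)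
      also have "(\<alpha> * (F x - z1) + (\<gamma> - \<alpha> * z1)) / ((\<gamma> - \<alpha> * z1) * (F x - z1)) = u x + \<alpha> / (\<gamma> - \<alpha> * z1)"
        using k ne[OF that] by (simp add: u_def add_divide_distrib)
      finally show ?thesis .
    qed
    then have "finite {x \<in> points S. u (T x) \<noteq> u x + \<alpha> / (\<gamma> - \<alpha> * z1)}"
      by (intro finite_subset[OF _ finE]) auto
    then have "\<alpha> / (\<gamma> - \<alpha> * z1) = 0" by (rule order_const_add)
    then show ?thesis using rel(1) k by simp
  next
    case False
    define G where "G = (\<lambda>x. (F x - z1) / (F x - z2))"
    define \<omega> where "\<omega> = (\<gamma> - \<alpha> * z1) / (\<gamma> - \<alpha> * z2)"
    have GT: "G (T x) = \<omega> * G x" if "x \<in> points S" "x \<notin> E" for x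
    proof -
      have "G (T x) = ((F (T x) - z1) * (\<alpha> * F x + \<beta>)) / ((F (T x) - z2) * (\<alpha> * F x + \<beta>))"
        using Q[OF that] by (simp add: G_def)
      also have "\<dots> = \<omega> * G x" unfolding fact[OF that r(1)] fact[OF that r(2)] by (simp add: G_def \<omega>_def)
      finally show ?thesis .
    qed
    then have fin: "finite {x \<in> points S. G (T x) \<noteq> \<omega> * G x}" by (intro finite_subset[OF _ finE]) auto
    have nzG: "nz G"
      unfolding nz_def
    proof
      fix x assume x: "x \<in> points S"
      have "\<forall>\<^sub>F z in at 0. F (par x z) - z1 \<noteq> 0" "\<forall>\<^sub>F z in at 0. F (par x z) - z2 \<noteq> 0"
        using F x by (auto simp: nz_def)
      then show "\<forall>\<^sub>F z in at 0. G (par x z) \<noteq> 0" by eventually_elim (simp add: G_def)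
    qed
    have "\<omega> ^ p = 1" by (rule order_const_mult[OF fin nzG])
    moreover have "\<omega> \<noteq> 1" using k rel(1) False by (simp add: \<omega>_def)
    ultimately show ?thesis using that[OF False _ _ fin[unfolded G_def]] by blast
  qed
qed

lemma oe_shift: "oe u x n \<Longrightarrow> n < 0 \<Longrightarrow> oe (\<lambda>y. u y - c) x n"
  using ord_eq_add[of "\<lambda>z. u (par x z)" n "\<lambda>z. - c" 0] ord_ge_const by simp

lemma reg_oe_zero_iff:
  assumes "x \<in> points S" "reg u x" "oe u x n" shows "u x = 0 \<longleftrightarrow> n > 0"
proof
  assume "n > 0"
  then show "u x = 0"
    using ord_ge_pos_tendsto[OF ord_eq_imp_ge[OF assms(3)]] reg_limit[OF assms(1,2)] LIM_unique by blast
next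
  assume "u x = 0"
  then have "og u x 1" using reg_og_pos[OF assms(1,2)] by simp
  then show "n > 0" using ord_ge_eq_le[OF assms(3)] by fastforce
qed

text \<open>If \<open>G\<close> had order 0 at a fixed point, \<open>G - G \<circ> T\<close> would
  vanish there, yet it equals \<open>(1 - \<omega>) * G\<close>. So all four fixed points lie over
  \<open>z1\<close> or \<open>z2\<close>. As \<open>F\<close> takes each value with total
  multiplicity two, each of these fibres consists of two simple points.\<close>

lemma linearizing_function:
  assumes f: "holomorphic_map S riemann_sphere f" "has_degree S riemann_sphere f 2"
  obtains G \<omega> Z1 Z2 where "\<omega> ^ p = 1" "\<omega> \<noteq> 1" "card Z1 = 2" "card Z2 = 2" "Z1 \<inter> Z2 = {}" "FX = Z1 \<union> Z2"
    "mero G" "\<forall>x\<in>points S. oe G x (if x \<in> Z1 then 1 else if x \<in> Z2 then - 1 else 0)"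
    "\<forall>x\<in>points S - Z2. reg G x \<and> G (T x) = \<omega> * G x \<and> (G x = 0 \<longleftrightarrow> x \<in> Z1)"
proof -
  obtain F a b where F: "mero F" "a \<in> points S" "b \<in> points S" "a \<noteq> b" "oe F a (- 1)" "oe F b (- 1)"
    and F0: "\<forall>x\<in>points S. x \<notin> {a, b} \<longrightarrow> og F x 0"
    and disj0: "\<forall>x\<in>{a, b}. T x \<notin> {a, b} \<and> T (T x) \<notin> {a, b}"
    and nzF0: "\<forall>q. nz (\<lambda>x. F x - q)" and deg0: "\<forall>q. zeros_at F q = 2"
    by (rule double_cover_function[OF f])
  have og: "og F x 0" if "x \<in> points S" "x \<notin> {a, b}" for x using F0 that by blast
  have disj: "T x \<notin> {a, b} \<and> T (T x) \<notin> {a, b}" if "x \<in> {a, b}" for x using disj0 that by blast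
  have nzF: "nz (\<lambda>x. F x - q)" and deg: "zeros_at F q = 2" for q
    using nzF0[rule_format, of q] deg0[rule_format, of q] .
  obtain \<alpha> \<beta> \<gamma> \<delta> where rel: "\<alpha> \<noteq> 0" "finite {x \<in> points S. F (T x) * (\<alpha> * F x + \<beta>) \<noteq> \<gamma> * F x + \<delta>}"
    by (rule moebius_relation[OF F og disj])
  obtain z1 z2 \<omega> where z: "z1 \<noteq> z2" and \<omega>: "\<omega> ^ p = 1" "\<omega> \<noteq> 1"
    and fin: "finite {x \<in> points S. (F (T x) - z1) / (F (T x) - z2) \<noteq> \<omega> * ((F x - z1) / (F x - z2))}"
    by (rule linearization[OF nzF rel])
  define e where "e = (\<lambda>q x. ord (\<lambda>y. F y - q) x)"
  have mF: "mero (\<lambda>x. F x - q)" for q by (intro mero_diff F mero_const)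
  have oeF: "oe (\<lambda>y. F y - q) x (e q x)" if "x \<in> points S" for q x
    unfolding e_def by (rule oe_ord[OF mF nzF that])
  define K where "K = (\<lambda>q. {x \<in> points S. nat (e q x) \<noteq> 0})"
  have K: "x \<in> K q \<longleftrightarrow> e q x > 0" if "x \<in> points S" for q x using that by (auto simp: K_def)
  have finK: "finite (K q)" for q
    by (rule finite_subset[OF _ finite_ord[OF mF[of q] nzF[of q]]]) (auto simp: K_def e_def)
  have sumK: "(\<Sum>x\<in>K q. nat (e q x)) = 2" for q
    using deg[of q] by (simp add: zeros_at_def K_def e_def)
  have cardK: "card (K q) \<le> 2" for q
  proof -
    have "(\<Sum>x\<in>K q. 1) \<le> (\<Sum>x\<in>K q. nat (e q x))" by (rule sum_mono) (auto simp: K_def)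
    then show ?thesis using sumK by simp
  qed
  have ab_e: "e q a = - 1" "e q b = - 1" for q
    using ord_eqI[OF oe_shift[OF F(5)]] ord_eqI[OF oe_shift[OF F(6)]] by (auto simp: e_def)
  have other: "e q x \<ge> 0" if "x \<in> points S" "x \<notin> {a, b}" for q x
    using ord_ge_eq_le[OF oeF[OF that(1)] ord_ge_diff[OF og[OF that] ord_ge_const]] .
  have Kdisj: "K z1 \<inter> K z2 = {}"
  proof -
    have False if "x \<in> K z1" "x \<in> K z2" for x
    proof -
      have x: "x \<in> points S" using that by (simp add: K_def)
      have "og (\<lambda>y. F y - z1) x 1" "og (\<lambda>y. F y - z2) x 1"
        using that K[OF x] oeF[OF x] by (auto intro: ord_ge_mono[OF ord_eq_imp_ge[OF oeF[OF x]]])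
      from ord_ge_diff[OF this] have "ord_ge (\<lambda>z. z2 - z1) 1" by simp
      then show False using ord_ge_eq_le[OF ord_eq_const[of "z2 - z1"]] z by fastforce
    qed
    then show ?thesis by blast
  qed
  define G0 where "G0 = (\<lambda>x. (F x - z1) / (F x - z2))"
  have finG: "finite {x \<in> points S. G0 (T x) \<noteq> \<omega> * G0 x}" using fin by (simp only: G0_def)
  have mG0: "mero G0" unfolding G0_def by (rule mero_divide[OF mF mF nzF])
  have oeG0: "oe G0 x (e z1 x - e z2 x)" if "x \<in> points S" for x
    unfolding G0_def by (rule ord_eq_divide[OF oeF[OF that] oeF[OF that]])
  have abF: "a \<notin> FX" "b \<notin> FX" using disj by (auto simp: FX_def)
  have FXK: "FX \<subseteq> K z1 \<union> K z2"
  proof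
    fix x assume x: "x \<in> FX"
    then have xS: "x \<in> points S" by (simp add: FX_def)
    show "x \<in> K z1 \<union> K z2"
    proof (rule ccontr)
      assume "x \<notin> K z1 \<union> K z2"
      moreover have "x \<notin> {a, b}" using x abF by auto
      ultimately have "e z1 x = 0" "e z2 x = 0" using K[OF xS] other[OF xS] by (auto simp: order_antisym)
      then have oe0: "oe G0 x 0" using oeG0[OF xS] by simp
      have "og (\<lambda>y. G0 y - (\<lambda>y. G0 (T y)) y) x 1" by (rule og_T_diff[OF ord_eq_imp_ge[OF oe0] x refl])
      moreover have "finite {y \<in> points S. G0 y - G0 (T y) \<noteq> (1 - \<omega>) * G0 y}"
        by (rule finite_subset[OF _ finG]) (auto simp: algebra_simps)
      from og_cong[OF this xS] have "og (\<lambda>y. G0 y - G0 (T y)) x 1 \<longleftrightarrow> og (\<lambda>y. (1 - \<omega>) * G0 y) x 1" .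
      moreover have "oe (\<lambda>y. (1 - \<omega>) * G0 y) x 0" using ord_eq_mult[OF ord_eq_const[of "1 - \<omega>"] oe0] \<omega>(2) by simp
      ultimately show False using ord_ge_eq_le by fastforce
    qed
  qed
  have cards: "card (K z1) = 2" "card (K z2) = 2" and FXeq: "FX = K z1 \<union> K z2"
  proof -
    have le: "card (K z1 \<union> K z2) \<le> card FX" using card_Un_disjoint[OF finK finK Kdisj] cardK[of z1] cardK[of z2] FX(2) by simp
    show FXeq: "FX = K z1 \<union> K z2" by (rule card_seteq[OF _ FXK le]) (use finK in simp)
    show "card (K z1) = 2" "card (K z2) = 2"
      using FX(2) cardK[of z1] cardK[of z2] card_Un_disjoint[OF finK finK Kdisj] unfolding FXeq by auto
  qed
  \<comment> \<open>The weights are at least 1 and sum to 2 over two points.\<close>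
  have one: "e q x = 1" if "card (K q) = 2" "x \<in> K q" for q x
  proof -
    have "(\<Sum>y\<in>K q. nat (e q y) - 1) = 0"
      using sumK[of q] that(1) by (subst sum_subtractf_nat) (auto simp: K_def)
    then have "nat (e q x) - 1 = 0" using finK that(2) by simp
    then show ?thesis using that(2) by (auto simp: K_def)
  qed
  have oeG: "oe G0 x (if x \<in> K z1 then 1 else if x \<in> K z2 then - 1 else 0)" if x: "x \<in> points S" for x
  proof (cases "x \<in> {a, b}")
    case True
    \<comment> \<open>The poles of \<open>F\<close> at \<open>a\<close> and \<open>b\<close> cancel
      in the quotient.\<close>
    then have "e z1 x - e z2 x = 0" "x \<notin> K z1" "x \<notin> K z2" using ab_e K[OF x] by auto
    then show ?thesis using oeG0[OF x] by simp
  next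
    case False
    have "e q x = (if x \<in> K q then 1 else 0)" if "q = z1 \<or> q = z2" for q
      using one[of q x] cards that K[OF x, of q] other[OF x False, of q] by auto
    then have "e z1 x - e z2 x = (if x \<in> K z1 then 1 else if x \<in> K z2 then - 1 else 0)"
      using Kdisj by auto
    then show ?thesis using oeG0[OF x] by simp
  qed
  \<comment> \<open>Removable singularities are filled so that equivariance holds at every point
    that is not a pole.\<close>
  define G where "G = nrm G0"
  have GG0: "finite {x \<in> points S. G x \<noteq> G0 x}" unfolding G_def by (rule nrm_finite[OF mG0])
  have G0G: "finite {x \<in> points S. G0 x \<noteq> G x}" by (rule finite_subset[OF _ GG0]) auto
  have mG: "mero G" unfolding mero_def
  proof
    fix x assume x: "x \<in> points S"
    then obtain n where "og G0 x n" using mG0 unfolding mero_def by blast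
    then show "\<exists>n. og G x n" using og_cong[OF GG0 x] by blast
  qed
  have oe: "oe G x (if x \<in> K z1 then 1 else if x \<in> K z2 then - 1 else 0)" if x: "x \<in> points S" for x
    using oe_cong[OF GG0 x] oeG[OF x] by blast
  have rg: "reg G x" if x: "x \<in> points S" "x \<notin> K z2" for x
  proof -
    have "og G0 x 0" by (rule ord_ge_mono[OF ord_eq_imp_ge[OF oeG[OF x(1)]]]) (use x in auto)
    then show ?thesis unfolding G_def by (rule reg_nrm[OF mG0 x(1)])
  qed
  have Tinv: "T x \<notin> K z2" if "x \<in> points S" "x \<notin> K z2" for x
  proof
    assume "T x \<in> K z2"
    then have "T (T x) = T x" using FXeq by (auto simp: FX_def)
    then have "T x = x" using T_eq T_in that by blast
    then show False using \<open>T x \<in> K z2\<close> that by simp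
  qed
  have eqv: "G (T x) = \<omega> * G x" if x: "x \<in> points S" "x \<notin> K z2" for x
  proof (rule reg_cong_value[OF x(1)])
    show "reg (\<lambda>y. G (T y)) x" by (rule reg_comp[OF T_holo T_inj x(1) rg[OF T_in[OF x(1)] Tinv[OF x]]])
    show "reg (\<lambda>y. \<omega> * G y) x" using rg[OF x] unfolding reg_def by (intro analytic_intros)
    have "finite {y \<in> points S. \<not> G (T y) = \<omega> * G y}"
      by (rule finite_subset[OF _ finite_UnI[OF finite_UnI[OF finG GG0] finite_T'[OF GG0]]]) auto
    then show "\<forall>\<^sub>F z in at 0. G (T (par x z)) = \<omega> * G (par x z)"
      by (rule ev_par_outside[OF x(1), where P = "\<lambda>y. G (T y) = \<omega> * G y"])
  qed
  have zero: "G x = 0 \<longleftrightarrow> x \<in> K z1" if x: "x \<in> points S" "x \<notin> K z2" for x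
    using reg_oe_zero_iff[OF x(1) rg[OF x] oe[OF x(1)]] x(2) by auto
  show ?thesis
    by (rule that[OF \<omega> cards Kdisj FXeq mG]) (use oe rg eqv zero in auto)
qed

section \<open>The quotient map\<close>

text \<open>\<open>orbit_of\<close> uses forward iterates only; each step back is made by
  \<open>T'\<close>, which is itself an iterate.\<close>

lemma T_reachable_back: "x \<in> points S \<Longrightarrow> \<exists>j. x = (T ^^ j) ((T ^^ k) x)"
proof (induction k)
  case 0 show ?case by (rule exI[of _ 0]) simp
next
  case (Suc k)
  then obtain j where j: "x = (T ^^ j) ((T ^^ k) x)" by blast
  have "(T ^^ k) x = T' ((T ^^ Suc k) x)" using T'(3)[OF Tpow_in[OF Suc.prems]] by simp
  then have "(T ^^ j) ((T ^^ k) x) = (T ^^ (j + (p - 1))) ((T ^^ Suc k) x)"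
    unfolding funpow_add o_apply T'_def[symmetric] by (rule arg_cong)
  from trans[OF j this] show ?case by (rule exI)
qed

lemma orbit_eq_iff:
  assumes "x \<in> points S" "y \<in> points S"
  shows "orbit_of T x = orbit_of T y \<longleftrightarrow> (\<exists>k. y = (T ^^ k) x)"
proof
  assume eq: "orbit_of T x = orbit_of T y"
  have "y = (T ^^ 0) y" by simp
  then have "y \<in> orbit_of T y" unfolding orbit_of_def by blast
  then show "\<exists>k. y = (T ^^ k) x" unfolding eq[symmetric] by (auto simp: orbit_of_def)
next
  assume "\<exists>k. y = (T ^^ k) x"
  then obtain k where k: "y = (T ^^ k) x" by blast
  obtain j where j: "x = (T ^^ j) y" using T_reachable_back[OF assms(1)] k by blast
  have sub: "orbit_of T ((T ^^ i) w) \<subseteq> orbit_of T w" for i w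
  proof
    fix v assume "v \<in> orbit_of T ((T ^^ i) w)"
    then obtain n where "v = (T ^^ n) ((T ^^ i) w)" by (auto simp: orbit_of_def)
    then have "v = (T ^^ (n + i)) w" by (simp add: funpow_add)
    then show "v \<in> orbit_of T w" unfolding orbit_of_def by blast
  qed
  have "orbit_of T y \<subseteq> orbit_of T x" unfolding k by (rule sub)
  moreover have "orbit_of T x \<subseteq> orbit_of T y" by (subst j) (rule sub)
  ultimately show "orbit_of T x = orbit_of T y" by (rule equalityI[rotated])
qed

lemma fixed_Tpow: "x \<in> FX \<Longrightarrow> (T ^^ k) x = x"
  by (induction k) (auto simp: FX_def)

text \<open>A coincidence of iterates puts a fixed point into the orbit; the orbit is then that
  single point, so \<open>x\<close> itself would be fixed.\<close>

lemma inj_Tpow: assumes "x \<in> points S" "x \<notin> FX" shows "inj_on (\<lambda>i. (T ^^ i) x) {..<p}"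
proof -
  have ne: "(T ^^ i) x \<noteq> (T ^^ j) x" if "i < j" "j < p" for i j
  proof
    assume eq: "(T ^^ i) x = (T ^^ j) x"
    have "(T ^^ j) x = (T ^^ (j - i)) ((T ^^ i) x)" using that by (simp add: funpow_add[symmetric, THEN fun_cong, unfolded o_apply])
    then have "(T ^^ (j - i)) ((T ^^ i) x) = (T ^^ i) x" using eq by simp
    moreover have "\<not> p dvd j - i" using that by (auto dest: dvd_imp_le)
    ultimately have "T ((T ^^ i) x) = (T ^^ i) x" by (rule fixed_if_Tpow[OF Tpow_in[OF assms(1)]])
    then have "(T ^^ i) x \<in> FX" using Tpow_in[OF assms(1)] by (simp add: FX_def)
    moreover obtain n where "x = (T ^^ n) ((T ^^ i) x)" using T_reachable_back[OF assms(1)] by blast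
    ultimately have "x = (T ^^ i) x" using fixed_Tpow by metis
    then show False using \<open>(T ^^ i) x \<in> FX\<close> assms(2) by simp
  qed
  show ?thesis by (rule linorder_inj_onI) (use ne in auto)
qed

text \<open>The fibres of \<open>k\<close> are the orbits, and the orbit of a point that is not
  fixed has exactly \<open>p\<close> elements; only the images of the fixed points can be
  exceptional values.\<close>

lemma quotient_map_sphere:
  assumes Q: "quotient_surface S T Q" "isomorphic_surfaces Q riemann_sphere"
  obtains k where "holomorphic_map S riemann_sphere k"
    "\<forall>x\<in>points S. \<forall>y\<in>points S. k x = k y \<longleftrightarrow> (\<exists>j. y = (T ^^ j) x)"
    "\<forall>q. \<exists>x\<in>points S. k x = q" "has_degree S riemann_sphere k p"
proof -
  obtain \<phi> \<psi> where phi: "biholomorphic_maps Q riemann_sphere \<phi> \<psi>"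
    using Q(2) by (auto simp: isomorphic_surfaces_def)
  have hQ: "holomorphic_map S Q (orbit_of T)" and rsQ: "riemann_surface Q" and pQ: "points Q = orbit_of T ` points S"
    using Q(1) by (auto simp: quotient_surface_def)
  define k where "k = \<phi> \<circ> orbit_of T"
  have hk: "holomorphic_map S riemann_sphere k" unfolding k_def
    by (rule holomorphic_map_compose[OF rs rsQ hQ]) (use phi in \<open>simp add: biholomorphic_maps_def\<close>)
  have inv_k: "\<psi> (k x) = orbit_of T x" if "x \<in> points S" for x
    using phi that pQ by (auto simp: biholomorphic_maps_def k_def)
  have eq: "k x = k y \<longleftrightarrow> (\<exists>j. y = (T ^^ j) x)" if "x \<in> points S" "y \<in> points S" for x y
  proof -
    have "k x = k y \<longleftrightarrow> orbit_of T x = orbit_of T y"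
    proof
      assume "k x = k y"
      then have "\<psi> (k x) = \<psi> (k y)" by (rule arg_cong)
      then show "orbit_of T x = orbit_of T y" by (simp only: inv_k[OF that(1)] inv_k[OF that(2)])
    qed (simp add: k_def)
    then show ?thesis using orbit_eq_iff[OF that] by simp
  qed
  have sur: "\<exists>x\<in>points S. k x = q" for q
  proof -
    have "\<phi> (\<psi> q) = q" "holomorphic_map riemann_sphere Q \<psi>"
      using phi by (auto simp: biholomorphic_maps_def sphere_points)
    moreover from this(2) have "\<psi> q \<in> points Q" by (rule holomorphic_map_in) (simp add: sphere_points)
    ultimately show ?thesis using pQ by (auto simp: k_def)
  qed
  have "card {x \<in> points S. k x = q} = p" if "q \<notin> k ` FX" for q
  proof -
    obtain x where x: "x \<in> points S" "k x = q" using sur by blast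
    then have xF: "x \<notin> FX" using that by blast
    have "{y \<in> points S. k y = q} = (\<lambda>i. (T ^^ i) x) ` {..<p}"
    proof (intro equalityI subsetI)
      fix y assume "y \<in> {y \<in> points S. k y = q}"
      then have y: "y \<in> points S" "k x = k y" using x(2) by simp_all
      then obtain j where "y = (T ^^ j) x" using eq[OF x(1) y(1)] by blast
      then have "y = (T ^^ (j mod p)) x" using Tpow_mod[OF x(1)] by simp
      then show "y \<in> (\<lambda>i. (T ^^ i) x) ` {..<p}" using p_gt by auto
    next
      fix y assume "y \<in> (\<lambda>i. (T ^^ i) x) ` {..<p}"
      then obtain i where i: "y = (T ^^ i) x" by blast
      then have y: "y \<in> points S" using Tpow_in[OF x(1)] by simp
      then have "k x = k y" using eq[OF x(1) y] i by blast
      then show "y \<in> {y \<in> points S. k y = q}" using x(2) y by simp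
    qed
    then show ?thesis using card_image[OF inj_Tpow[OF x(1) xF]] by simp
  qed
  then have "{q. card {x \<in> points S. k x = q} \<noteq> p} \<subseteq> k ` FX" by blast
  then have deg: "has_degree S riemann_sphere k p"
    unfolding has_degree_def sphere_points using FX(1) finite_subset by fastforce
  show ?thesis by (rule that[OF hk _ _ deg]) ((intro ballI allI eq sur; assumption)+)
qed

text \<open>A fixed point is alone in its fibre of \<open>k\<close>, whose degree is
  \<open>p\<close>, so it carries the whole multiplicity. Hence \<open>1/(k - a)\<close> minus its
  value at \<open>P\<close> has divisor \<open>p P - p P4\<close>.\<close>

lemma quotient_function:
  assumes k: "holomorphic_map S riemann_sphere k"
    and eq: "\<And>x y. x \<in> points S \<Longrightarrow> y \<in> points S \<Longrightarrow> k x = k y \<longleftrightarrow> (\<exists>j. y = (T ^^ j) x)"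
    and deg: "has_degree S riemann_sphere k p" and P4: "P4 \<in> FX" "k P4 = Some a"
    and P: "P \<in> FX" "P \<noteq> P4" and x: "x \<in> points S"
  shows "oe (\<lambda>y. rcp a k y - rcp a k P) x (if x = P then int p else if x = P4 then - int p else 0)"
proof -
  define u where "u = rcp a k"
  have p0: "p > 0" using p_gt by simp
  have mu: "mero u" unfolding u_def by (rule mero_rcp[OF k])
  note dg = rcp_degree[OF k p0 deg, of a, folded u_def]
  have PS: "P \<in> points S" "P4 \<in> points S" using P P4 by (auto simp: FX_def)
  have k4: "k y = Some a \<longleftrightarrow> y = P4" if "y \<in> points S" for y
    using eq[OF PS(2) that] P4 fixed_Tpow[OF P4(1)] by auto
  have kP: "k y = k P \<longleftrightarrow> y = P" if "y \<in> points S" for y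
    using eq[OF PS(1) that] fixed_Tpow[OF P(1)] by auto
  have rg: "reg u y" if "y \<in> points S" "y \<noteq> P4" for y
    unfolding u_def by (rule reg_rcp[OF k that(1)]) (use k4[OF that(1)] that in auto)
  have inj: "u y = u P \<longleftrightarrow> y = P" if "y \<in> points S" "y \<noteq> P4" for y
  proof -
    have "k y \<noteq> Some a" "k P \<noteq> Some a" using k4 that PS P(2) by auto
    then have "u y = u P \<longleftrightarrow> k y = k P"
      by (cases "k y"; cases "k P") (auto simp: u_def rcp_def)
    then show ?thesis using kP[OF that(1)] by simp
  qed
  define v where "v = (\<lambda>y. u y - u P)"
  have mv: "mero v" and nv: "nz v" unfolding v_def using mero_diff[OF mu mero_const] dg(1) by auto
  have nu: "nz u" using dg(1)[of 0] by simp
  have neg: "ord u P4 < 0" using rcp_at_pole(2)[OF k PS(2) P4(2), folded u_def] oe_ord[OF mu nu PS(2)] by blast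
  have pole: "ord u P4 = - int p"
  proof -
    have "{y \<in> points S. nat (- ord u y) \<noteq> 0} = {P4}"
      using neg PS og_le_ord[OF mu nu _ reg_og[OF rg]] by force
    then have "nat (- ord u P4) = p" using dg(3) by (simp add: num_poles_def)
    then show ?thesis using neg by simp
  qed
  have v4: "oe v P4 (- int p)"
    using oe_shift[OF oe_ord[OF mu nu PS(2), unfolded pole]] p0 by (simp add: v_def)
  have v0: "oe v y 0" if "y \<in> points S" "y \<noteq> P4" "y \<noteq> P" for y
  proof (rule reg_oe[OF that(1)])
    show "reg v y" using rg[OF that(1,2)] unfolding v_def reg_def by (intro analytic_intros)
    show "v y \<noteq> 0" using inj that by (simp add: v_def)
  qed
  have vP: "oe v P (int p)"
  proof -
    have pos: "ord v P > 0" using og_le_ord[OF mv nv PS(1), of 1] reg_og_pos[OF PS(1) rg[OF PS(1) P(2)]]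
      by (simp add: v_def)
    have "{y \<in> points S. nat (ord v y) \<noteq> 0} = {P}"
    proof (intro equalityI subsetI)
      fix y assume y: "y \<in> {y \<in> points S. nat (ord v y) \<noteq> 0}"
      show "y \<in> {P}"
      proof (rule ccontr)
        assume "y \<notin> {P}"
        then have "ord v y = 0 \<or> ord v y = - int p"
          using ord_eqI[OF v0, of y] ord_eqI[OF v4] y by (cases "y = P4") auto
        then show False using y p0 by auto
      qed
    qed (use pos PS in auto)
    then have "nat (ord v P) = p" using dg(2)[of "u P"] by (simp add: zeros_at_def v_def)
    then have "ord v P = int p" using pos by simp
    then show ?thesis using oe_ord[OF mv nv PS(1)] by simp
  qed
  show ?thesis using v4 v0[OF x] vP P(2) by (auto simp: v_def u_def)
qed

section \<open>The equation between the linearising function and the quotient function\<close>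

lemma superelliptic_model:
  assumes f: "holomorphic_map S riemann_sphere f" "has_degree S riemann_sphere f 2"
    and Q: "quotient_surface S T Q" "isomorphic_surfaces Q riemann_sphere"
  obtains G H \<omega> c l1 l2 P3 P4 where "\<omega> ^ p = 1" "\<omega> \<noteq> 1" "c \<noteq> 0" "l1 \<noteq> 0" "l2 \<noteq> 0" "l1 \<noteq> l2"
    "P3 \<in> points S" "P4 \<in> points S" "oe G P3 (- 1)" "oe G P4 (- 1)"
    "\<forall>x\<in>points S - {P3, P4}. reg G x \<and> reg H x \<and> H x \<noteq> 0 \<and> T x \<notin> {P3, P4} \<and> G (T x) = \<omega> * G x \<and> H (T x) = H x
        \<and> G x ^ p * H x = c * (H x - l1) * (H x - l2) \<and> (G x = 0 \<longrightarrow> T x = x)"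
    "\<forall>x\<in>points S - {P3, P4}. \<forall>y\<in>points S - {P3, P4}. H x = H y \<longrightarrow> (\<exists>j. y = (T ^^ j) x)"
    "\<forall>\<eta>. \<eta> \<noteq> 0 \<longrightarrow> (\<exists>x\<in>points S - {P3, P4}. H x = \<eta>)"
proof -
  obtain G \<omega> Z1 Z2 where \<omega>: "\<omega> ^ p = 1" "\<omega> \<noteq> 1" and Z: "card Z1 = 2" "card Z2 = 2" "Z1 \<inter> Z2 = {}" "FX = Z1 \<union> Z2"
    and mG: "mero G" and oeG: "\<forall>x\<in>points S. oe G x (if x \<in> Z1 then 1 else if x \<in> Z2 then - 1 else 0)"
    and G: "\<forall>x\<in>points S - Z2. reg G x \<and> G (T x) = \<omega> * G x \<and> (G x = 0 \<longleftrightarrow> x \<in> Z1)"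
    by (rule linearizing_function[OF f])
  obtain k where k: "holomorphic_map S riemann_sphere k"
    and keq0: "\<forall>x\<in>points S. \<forall>y\<in>points S. k x = k y \<longleftrightarrow> (\<exists>j. y = (T ^^ j) x)"
    and ksurj: "\<forall>q. \<exists>x\<in>points S. k x = q" and kdeg: "has_degree S riemann_sphere k p"
    by (rule quotient_map_sphere[OF Q])
  have keq: "k x = k y \<longleftrightarrow> (\<exists>j. y = (T ^^ j) x)" if "x \<in> points S" "y \<in> points S" for x y
    using keq0 that by blast
  have FXS: "x \<in> points S" if "x \<in> FX" for x using that by (simp add: FX_def)
  have kFX: "k x = k y \<longleftrightarrow> x = y" if "x \<in> FX" "y \<in> FX" for x y
    using keq[OF FXS[OF that(1)] FXS[OF that(2)]] fixed_Tpow[OF that(1)] by auto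
  obtain P1 P2 where Z1: "Z1 = {P1, P2}" "P1 \<noteq> P2" using Z(1) by (auto simp: card_2_iff)
  \<comment> \<open>\<open>k\<close> is infinite at no more than one of the two points, so a point
    with a finite value can be named \<open>P4\<close>.\<close>
  obtain P3 P4 a where Z2: "Z2 = {P3, P4}" "P3 \<noteq> P4" and a: "k P4 = Some a"
  proof -
    obtain A B where AB: "Z2 = {A, B}" "A \<noteq> B" using Z(2) by (auto simp: card_2_iff)
    then have "k A \<noteq> k B" using kFX[of A B] Z(4) by auto
    then consider a where "k A = Some a" | a where "k B = Some a" by (cases "k A"; cases "k B") auto
    then show ?thesis
    proof cases
      case 1
      then show ?thesis using that[of B A] AB by auto
    next
      case 2
      then show ?thesis using that[of A B] AB by auto
    qed
  qed
  have PF: "P1 \<in> FX" "P2 \<in> FX" "P3 \<in> FX" "P4 \<in> FX" using Z(4) Z1 Z2 by auto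
  have ne: "P1 \<noteq> P3" "P1 \<noteq> P4" "P2 \<noteq> P3" "P2 \<noteq> P4" using Z(3) Z1 Z2 by auto
  have PS: "P1 \<in> points S" "P2 \<in> points S" "P3 \<in> points S" "P4 \<in> points S" using PF FXS by auto
  define u where "u = rcp a k"
  \<comment> \<open>Shifted so that the zero lies at \<open>P3\<close>; the pole is at
    \<open>P4\<close>.\<close>
  define H where "H = (\<lambda>x. u x - u P3)"
  define l1 where "l1 = H P1"
  define l2 where "l2 = H P2"
  have qf: "oe (\<lambda>y. u y - u P) x (if x = P then int p else if x = P4 then - int p else 0)"
    if "P \<in> FX" "P \<noteq> P4" "x \<in> points S" for P x
    unfolding u_def by (rule quotient_function[OF k keq kdeg PF(4) a that])
  have o0: "oe H x (if x = P3 then int p else if x = P4 then - int p else 0)" if "x \<in> points S" for x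
    unfolding H_def by (rule qf[OF PF(3) Z2(2) that])
  have o1: "oe (\<lambda>y. H y - l1) x (if x = P1 then int p else if x = P4 then - int p else 0)" if "x \<in> points S" for x
    using qf[OF PF(1) ne(2) that] by (simp add: H_def l1_def)
  have o2: "oe (\<lambda>y. H y - l2) x (if x = P2 then int p else if x = P4 then - int p else 0)" if "x \<in> points S" for x
    using qf[OF PF(2) ne(4) that] by (simp add: H_def l2_def)
  have k4: "k y \<noteq> Some a" if "y \<in> points S" "y \<noteq> P4" for y
  proof
    assume "k y = Some a"
    then have "k P4 = k y" using a by simp
    then show False using keq[OF PS(4) that(1)] fixed_Tpow[OF PF(4)] that(2) by auto
  qed
  have rH: "reg (\<lambda>y. H y - q) x" if "x \<in> points S" "x \<noteq> P4" for x q
    using reg_rcp[OF k that(1) k4[OF that]] unfolding H_def reg_def u_def by (intro analytic_intros)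
  have rH0: "reg H x" if "x \<in> points S" "x \<noteq> P4" for x using rH[OF that, of 0] by simp
  have H0: "H x \<noteq> 0" if "x \<in> points S" "x \<notin> {P3, P4}" for x
    using reg_oe_zero_iff[OF that(1) rH0 o0[OF that(1)]] that by auto
  have l: "l1 \<noteq> 0" "l2 \<noteq> 0" using H0[OF PS(1)] H0[OF PS(2)] ne by (auto simp: l1_def l2_def)
  have l12: "l1 \<noteq> l2"
  proof -
    \<comment> \<open>The order of \<open>H - l1\<close> at \<open>P2\<close> is 0, so it does not
      vanish there.\<close>
    have "H P2 - l1 = 0 \<longleftrightarrow> (0::int) > 0"
      using reg_oe_zero_iff[OF PS(2) rH[OF PS(2) ne(4)] o1[OF PS(2)]] Z1(2) ne(4) by simp
    then show ?thesis by (auto simp: l2_def)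
  qed
  have mu: "mero u" unfolding u_def by (rule mero_rcp[OF k])
  have mH: "mero (\<lambda>y. H y - q)" for q unfolding H_def by (intro mero_diff mu mero_const)
  define \<Phi> where "\<Phi> = (\<lambda>x. (G x ^ p * H x) / ((H x - l1) * (H x - l2)))"
  \<comment> \<open>At \<open>P1\<close> and \<open>P2\<close> the zeros of \<open>G ^ p\<close>
    meet those of \<open>H - l1\<close> and \<open>H - l2\<close>; at \<open>P3\<close> the pole of
    \<open>G ^ p\<close> meets the zero of \<open>H\<close>; at \<open>P4\<close> numerator and
    denominator both have a pole of order \<open>2 * p\<close>.\<close>
  have oePhi: "oe \<Phi> x 0" if x: "x \<in> points S" for x
  proof -
    define g :: int where "g = (if x \<in> Z1 then 1 else if x \<in> Z2 then - 1 else 0)"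
    have "oe G x g" unfolding g_def using oeG x by blast
    from ord_eq_divide[OF ord_eq_mult[OF ord_eq_power[OF this] o0[OF x]] ord_eq_mult[OF o1[OF x] o2[OF x]]]
    have oe: "oe \<Phi> x (int p * g + (if x = P3 then int p else if x = P4 then - int p else 0)
       - ((if x = P1 then int p else if x = P4 then - int p else 0) +
          (if x = P2 then int p else if x = P4 then - int p else 0)))" unfolding \<Phi>_def .
    have "int p * g + (if x = P3 then int p else if x = P4 then - int p else 0)
       - ((if x = P1 then int p else if x = P4 then - int p else 0) +
          (if x = P2 then int p else if x = P4 then - int p else 0)) = 0"
      using Z1 Z2 ne by (auto simp: g_def)
    then show ?thesis using oe by simp
  qed
  obtain c where c: "finite {x \<in> points S. \<Phi> x \<noteq> c}"
    by (rule no_poles_const[of \<Phi>]) (auto intro: meroI ord_eq_imp_ge oePhi)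
  have c0: "c \<noteq> 0"
  proof
    assume "c = 0"
    have "oe (\<lambda>x. c) P1 0" using oe_cong[OF c PS(1)] oePhi[OF PS(1)] by blast
    from ord_eq_nz[OF this] show False using \<open>c = 0\<close> by simp
  qed
  have finR: "finite {x \<in> points S. \<not> G x ^ p * H x = c * (H x - l1) * (H x - l2)}"
  proof (rule finite_subset)
    have "nz (\<lambda>y. H y - l1)" "nz (\<lambda>y. H y - l2)"
      using oe_imp_nz[OF mH PS(1) o1[OF PS(1)]] oe_imp_nz[OF mH PS(1) o2[OF PS(1)]] by auto
    then show "finite ({x \<in> points S. \<Phi> x \<noteq> c} \<union> {x \<in> points S. H x - l1 = 0} \<union> {x \<in> points S. H x - l2 = 0})"
      using c nz_finite_zeros by blast
  qed (auto simp: \<Phi>_def mult.assoc)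
  have rel: "G x ^ p * H x = c * (H x - l1) * (H x - l2)" if x: "x \<in> points S" "x \<notin> {P3, P4}" for x
  proof (rule reg_cong_value[OF x(1)])
    have rG: "reg G x" using G x Z2 by auto
    have rH': "reg H x" using rH0 x by auto
    show "reg (\<lambda>x. G x ^ p * H x) x" using rG rH' unfolding reg_def by (intro analytic_intros)
    show "reg (\<lambda>x. c * (H x - l1) * (H x - l2)) x" using rH' unfolding reg_def by (intro analytic_intros)
    show "\<forall>\<^sub>F z in at 0. G (par x z) ^ p * H (par x z) = c * (H (par x z) - l1) * (H (par x z) - l2)"
      by (rule ev_par_outside[OF x(1) finR])
  qed
  have TZ: "T x \<notin> {P3, P4}" if x: "x \<in> points S" "x \<notin> {P3, P4}" for x
  proof
    assume "T x \<in> {P3, P4}"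
    then have "T x \<in> FX" using PF by auto
    then have "T (T x) = T x" by (simp add: FX_def)
    then have "T x = x" using T_eq[OF T_in[OF x(1)] x(1)] by simp
    then show False using \<open>T x \<in> {P3, P4}\<close> x(2) by simp
  qed
  have HT: "H (T x) = H x" if x: "x \<in> points S" for x
  proof -
    have "\<exists>j. T x = (T ^^ j) x" by (rule exI[of _ 1]) simp
    then have "k x = k (T x)" using keq[OF x T_in[OF x]] by blast
    then show ?thesis by (simp add: H_def u_def rcp_def)
  qed
  have all: "\<forall>x\<in>points S - {P3, P4}. reg G x \<and> reg H x \<and> H x \<noteq> 0 \<and> T x \<notin> {P3, P4} \<and> G (T x) = \<omega> * G x \<and> H (T x) = H x
        \<and> G x ^ p * H x = c * (H x - l1) * (H x - l2) \<and> (G x = 0 \<longrightarrow> T x = x)"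
  proof
    fix x assume "x \<in> points S - {P3, P4}"
    then have x: "x \<in> points S" "x \<notin> {P3, P4}" "x \<noteq> P4" "x \<in> points S - Z2" using Z2 by auto
    have "x \<in> Z1 \<Longrightarrow> T x = x" using Z(4) by (auto simp: FX_def)
    then show "reg G x \<and> reg H x \<and> H x \<noteq> 0 \<and> T x \<notin> {P3, P4} \<and> G (T x) = \<omega> * G x \<and> H (T x) = H x
        \<and> G x ^ p * H x = c * (H x - l1) * (H x - l2) \<and> (G x = 0 \<longrightarrow> T x = x)"
      using G[rule_format, OF x(4)] rH0[OF x(1,3)] H0[OF x(1,2)] TZ[OF x(1,2)] HT[OF x(1)] rel[OF x(1,2)] by blast
  qed
  have inj: "\<forall>x\<in>points S - {P3, P4}. \<forall>y\<in>points S - {P3, P4}. H x = H y \<longrightarrow> (\<exists>j. y = (T ^^ j) x)"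
  proof (intro ballI impI)
    fix x y assume xy: "x \<in> points S - {P3, P4}" "y \<in> points S - {P3, P4}" "H x = H y"
    then have x: "x \<in> points S" "x \<noteq> P4" and y: "y \<in> points S" "y \<noteq> P4" by auto
    have "u x = u y" using xy(3) by (simp add: H_def)
    then have "k x = k y" using k4[OF x] k4[OF y]
      by (cases "k x"; cases "k y") (auto simp: u_def rcp_def)
    then show "\<exists>j. y = (T ^^ j) x" using keq[OF x(1) y(1)] by blast
  qed
  have sur: "\<forall>\<eta>. \<eta> \<noteq> 0 \<longrightarrow> (\<exists>x\<in>points S - {P3, P4}. H x = \<eta>)"
  proof (intro allI impI)
    fix \<eta> :: complex assume \<eta>: "\<eta> \<noteq> 0"
    define w where "w = \<eta> + u P3"
    \<comment> \<open>This is the default value of \<open>1/0\<close>; as a meromorphic function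
      \<open>u\<close> has a pole at \<open>P4\<close>. The value 0 must therefore be sought over
      infinity.\<close>
    have u4: "u P4 = 0" using a by (simp add: u_def rcp_def)
    obtain x where x: "x \<in> points S" "u x = w" "x \<noteq> P4"
    proof (cases "w = 0")
      case True
      obtain x where x: "x \<in> points S" "k x = None" using ksurj by blast
      then have "u x = w" using True by (simp add: u_def rcp_def)
      moreover have "x \<noteq> P4" using x a by auto
      ultimately show ?thesis using that x by blast
    next
      case False
      obtain x where x: "x \<in> points S" "k x = Some (a + 1 / w)" using ksurj by blast
      then have "u x = w" using rcp_eq_iff[OF False, of a k x] by (simp add: u_def)
      moreover have "x \<noteq> P4" using calculation u4 False by auto
      ultimately show ?thesis using that x by blast
    qed
    have "H x = \<eta>" using x(2) by (simp add: H_def w_def)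
    moreover have "x \<noteq> P3" using calculation \<eta> by (auto simp: H_def)
    ultimately show "\<exists>x\<in>points S - {P3, P4}. H x = \<eta>" using x by blast
  qed
  have "oe G P3 (- 1)" "oe G P4 (- 1)" using oeG[rule_format, OF PS(3)] oeG[rule_format, OF PS(4)] Z(3) Z2 by auto
  then show ?thesis by (rule that[OF \<omega> c0 l l12 PS(3,4) _ _ all inj sur])
qed

end

section \<open>Identification with the affine curve\<close>

lemma regular_curve_charts:
  assumes "(V, \<psi>) \<in> atlas (regular_curve F)"
  shows "openin (top_of_set (regular_points F)) V" "inj_on \<psi> V" "\<psi> = fst \<or> \<psi> = snd"
  using assms by (auto simp: regular_curve_def inj_on_def)

context compact_surface
begin

lemma reg_continuous:
  assumes A: "openin (surf_top S) A" and u: "\<And>x. x \<in> A \<Longrightarrow> reg u x"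
  shows "continuous_map (subtopology (surf_top S) A) euclidean u"
proof -
  have AS: "A \<subseteq> points S" using A openin_subset by blast
  have "openin (surf_top S) {x \<in> A. u x \<in> D}" if D: "open D" for D
  proof (subst openin_subopen, intro ballI)
    fix x assume x: "x \<in> {x \<in> A. u x \<in> D}"
    then have xS: "x \<in> points S" using AS by blast
    have "((\<lambda>z. u (par x z)) \<longlongrightarrow> u x) (at 0)" using reg_limit[OF xS u] x by blast
    then have "\<forall>\<^sub>F z in at 0. u (par x z) \<in> D" using D x by (intro topological_tendstoD) auto
    then have "\<forall>\<^sub>F z in at 0. par x z \<in> {x \<in> A. u x \<in> D}"
      using ev_par_in[OF xS A] x by (auto elim: eventually_elim2)
    then obtain W where W: "openin (surf_top S) W" "x \<in> W" "\<forall>y\<in>W - {x}. y \<in> {x \<in> A. u x \<in> D}"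
      using ev_par_iff[OF xS, of "\<lambda>y. y \<in> {x \<in> A. u x \<in> D}"] by blast
    then show "\<exists>W. openin (surf_top S) W \<and> x \<in> W \<and> W \<subseteq> {x \<in> A. u x \<in> D}" using x by blast
  qed
  then have "openin (subtopology (surf_top S) A) {x \<in> A. u x \<in> D}" if "open D" for D
    using that by (simp add: openin_subtopology) (metis (no_types, lifting) Int_absorb2 inf_commute mem_Collect_eq subsetI)
  then show ?thesis using AS by (auto simp: continuous_map_def Int_absorb1)
qed

text \<open>The inverse is continuous because \<open>X\<close> blows up at the removed points, which
  makes the map to the curve proper and hence closed. It is holomorphic because in charts an
  injective holomorphic function has a holomorphic inverse.\<close>

lemma isomorphic_to_curve:
  fixes X Y :: "'a \<Rightarrow> complex"
  assumes Z: "finite Z" "Z \<subseteq> points S"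
    and reg: "\<And>x. x \<in> points S - Z \<Longrightarrow> reg X x \<and> reg Y x"
    and bij: "bij_betw (\<lambda>s. (X s, Y s)) (points S - Z) (regular_points F)"
    and pole: "\<And>x. x \<in> Z \<Longrightarrow> filterlim (\<lambda>z. X (par x z)) at_infinity (at 0)"
  shows "isomorphic_surfaces (restrict_surface S (points S - Z)) (regular_curve F)"
proof -
  define A where "A = points S - Z"
  define C where "C = regular_points F"
  define f where "f = (\<lambda>s. (X s, Y s))"
  define g where "g = inv_into A f"
  define R where "R = restrict_surface S A"
  have A: "openin (surf_top S) A" "A \<subseteq> points S" unfolding A_def using closed_finite[OF Z(1)] by auto
  have bij': "bij_betw f A C" using bij by (simp add: f_def A_def C_def)
  have inj: "inj_on f A" and im: "f ` A = C" using bij' by (auto simp: bij_betw_def)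
  have gf: "g (f x) = x" if "x \<in> A" for x unfolding g_def using inv_into_f_f[OF inj that] .
  have fg: "f (g q) = q" "g q \<in> A" if "q \<in> C" for q
    using that im by (auto simp: g_def f_inv_into_f inv_into_into)
  have topR: "surf_top R = subtopology (surf_top S) A" by (simp add: R_def restrict_surface_def)
  have topC: "surf_top (regular_curve F) = top_of_set C" by (simp add: regular_curve_def C_def)
  have ptsR: "points R = A" using A(2) by (auto simp: topR)
  have ptsC: "points (regular_curve F) = C" by (simp add: topC)
  have regA: "reg X x" "reg Y x" if "x \<in> A" for x using reg that by (auto simp: A_def)
  have contX: "continuous_map (subtopology (surf_top S) A) euclidean X"
    by (rule reg_continuous[OF A(1) regA(1)])
  have contY: "continuous_map (subtopology (surf_top S) A) euclidean Y"
    by (rule reg_continuous[OF A(1) regA(2)])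
  have "continuous_map (subtopology (surf_top S) A) euclidean f"
    using continuous_map_pairedI[OF contX contY] by (simp add: f_def)
  then have contf: "continuous_map (surf_top R) (top_of_set C) f"
    unfolding topR using im A(2) by (intro continuous_map_into_subtopology) auto
  have contg: "continuous_map (top_of_set C) (surf_top R) g"
    unfolding continuous_map_closedin
  proof (intro conjI allI impI)
    show "g \<in> topspace (top_of_set C) \<rightarrow> points R" using fg ptsR by simp
    fix K assume K: "closedin (surf_top R) K"
    then have KA: "K \<subseteq> A" using closedin_subset ptsR by blast
    have eq: "{q \<in> topspace (top_of_set C). g q \<in> K} = f ` K"
    proof (intro equalityI subsetI)
      fix q assume "q \<in> {q \<in> topspace (top_of_set C). g q \<in> K}"
      then have "q \<in> C" "g q \<in> K" by auto
      then show "q \<in> f ` K" using fg(1)[of q] by (metis image_eqI)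
    next
      fix q assume "q \<in> f ` K"
      then obtain x where "x \<in> K" "q = f x" by blast
      then show "q \<in> {q \<in> topspace (top_of_set C). g q \<in> K}" using gf[of x] KA im by auto
    qed
    have "C \<inter> closure (f ` K) \<subseteq> f ` K"
    proof
      fix q assume q: "q \<in> C \<inter> closure (f ` K)"
      define r where "r = norm (fst q) + 1"
      \<comment> \<open>Near \<open>q\<close> only this part of \<open>K\<close> matters. It is
        closed in all of \<open>S\<close>, since \<open>X\<close> exceeds \<open>r\<close> near the
        removed points, and hence compact.\<close>
      define L where "L = {s \<in> K. norm (X s) \<le> r}"
      have "closedin (surf_top S) L" unfolding closedin_def
      proof
        show "L \<subseteq> points S" using KA A(2) by (auto simp: L_def)
        show "openin (surf_top S) (points S - L)"
        proof (subst openin_subopen, intro ballI)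
          fix x assume x: "x \<in> points S - L"
          show "\<exists>W. openin (surf_top S) W \<and> x \<in> W \<and> W \<subseteq> points S - L"
          proof (cases "x \<in> Z")
            case True
            have "\<forall>\<^sub>F z in at 0. norm (X (par x z)) > r"
              using filterlim_at_infinity_imp_norm_at_top[OF pole[OF True]]
              by (simp only: filterlim_at_top_dense)
            then have "\<forall>\<^sub>F z in at 0. par x z \<in> points S - L"
              using ev_par_points[of x] x by (auto simp: L_def elim: eventually_elim2)
            then obtain W where "openin (surf_top S) W" "x \<in> W" "\<forall>y\<in>W - {x}. y \<in> points S - L"
              using ev_par_iff[of x "\<lambda>y. y \<in> points S - L"] x by blast
            then show ?thesis using x by blast
          next
            case False
            then have xA: "x \<in> A" using x by (simp add: A_def)
            have "openin (surf_top R) (A - K)" using K unfolding closedin_def ptsR by blast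
            then have "openin (subtopology (surf_top S) A) (A - K)" by (simp only: topR)
            then have o1: "openin (surf_top S) (A - K)" using A(1) by (rule openin_trans_full)
            have "openin (subtopology (surf_top S) A) {s \<in> topspace (subtopology (surf_top S) A). X s \<in> {w. norm w > r}}"
              by (rule openin_continuous_map_preimage[OF contX])
                (unfold open_openin[symmetric], intro open_Collect_less continuous_intros)
            then have o2: "openin (surf_top S) {s \<in> A. norm (X s) > r}"
              using A openin_trans_full[of "surf_top S" A] by (simp add: Int_absorb1)
            have "openin (surf_top S) ((A - K) \<union> {s \<in> A. norm (X s) > r})" using o1 o2 by blast
            moreover have "x \<in> (A - K) \<union> {s \<in> A. norm (X s) > r}" using x xA by (auto simp: L_def)
            moreover have "(A - K) \<union> {s \<in> A. norm (X s) > r} \<subseteq> points S - L" using A(2) by (auto simp: L_def)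
            ultimately show ?thesis by blast
          qed
        qed
      qed
      then have "compactin (surf_top S) L" using cpt closedin_compact_space by blast
      moreover have "L \<subseteq> A" using KA by (auto simp: L_def)
      ultimately have "compactin (surf_top R) L" unfolding topR by (simp add: compactin_subtopology)
      then have "compactin (top_of_set C) (f ` L)" using contf by (rule image_compactin)
      then have cl: "closed (f ` L)" by (simp add: compactin_subtopology compact_imp_closed)
      have "open {w :: complex \<times> complex. norm (fst w) < r}" by (intro open_Collect_less continuous_intros)
      from open_Int_closure_subset[OF this, of "f ` K"]
      have "q \<in> closure ({w. norm (fst w) < r} \<inter> f ` K)" using q by (auto simp: r_def)
      also have "\<dots> \<subseteq> closure (f ` L)" by (rule closure_mono) (auto simp: L_def f_def)
      also have "\<dots> = f ` L" using cl by simp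
      also have "\<dots> \<subseteq> f ` K" by (auto simp: L_def)
      finally show "q \<in> f ` K" .
    qed
    then have "f ` K = C \<inter> closure (f ` K)" using KA im closure_subset[of "f ` K"] by blast
    then have "closedin (top_of_set C) (f ` K)" by (metis closed_closure closedin_closed)
    then show "closedin (top_of_set C) {q \<in> topspace (top_of_set C). g q \<in> K}" unfolding eq .
  qed
  \<comment> \<open>Both directions together: the coordinate expression of \<open>f\<close> is
    holomorphic and injective on an open set, and that of \<open>g\<close> is its inverse.\<close>
  have charts: "(\<psi> \<circ> f \<circ> inv_into U \<phi>) holomorphic_on \<phi> ` {x \<in> U. f x \<in> V} \<and>
     (\<phi> \<circ> g \<circ> inv_into V \<psi>) holomorphic_on \<psi> ` {q \<in> V. g q \<in> U}"
    if U: "(U, \<phi>) \<in> atlas R" and V: "(V, \<psi>) \<in> atlas (regular_curve F)" for U \<phi> V \<psi>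
  proof -
    obtain U0 where U0: "(U0, \<phi>) \<in> atlas S" "U = U0 \<inter> A"
      using U by (auto simp: R_def restrict_surface_def)
    note c0 = chart_facts[OF U0(1)]
    have UA: "U \<subseteq> A" "U \<subseteq> U0" using U0 by auto
    have injU: "inj_on \<phi> U" using c0(3) UA inj_on_subset by blast
    note cV = regular_curve_charts[OF V, folded C_def]
    have VC: "V \<subseteq> C" using openin_imp_subset[OF cV(1)] .
    define W where "W = {x \<in> U. f x \<in> V}"
    have "openin (surf_top R) {x \<in> topspace (surf_top R). f x \<in> V}"
      by (rule openin_continuous_map_preimage[OF contf cV(1)])
    then have "openin (surf_top R) {x \<in> A. f x \<in> V}" by (simp only: ptsR)
    then have "openin (subtopology (surf_top S) A) {x \<in> A. f x \<in> V}" by (simp only: topR)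
    then have "openin (surf_top S) {x \<in> A. f x \<in> V}" using A(1) by (rule openin_trans_full)
    then have "openin (surf_top S) (U0 \<inter> {x \<in> A. f x \<in> V})" using c0(1) by blast
    moreover have "U0 \<inter> {x \<in> A. f x \<in> V} = W" using U0(2) by (auto simp: W_def)
    ultimately have oW: "open (\<phi> ` W)" using c0(5)[of W] by (auto simp: W_def U0(2))
    define k where "k = \<psi> \<circ> f \<circ> inv_into U \<phi>"
    have kW: "k (\<phi> x) = \<psi> (f x)" if "x \<in> W" for x
      using inv_into_f_f[OF injU, of x] that by (simp add: k_def W_def)
    have hol: "k holomorphic_on \<phi> ` W"
    proof -
      have "k analytic_on {w}" if w: "w \<in> \<phi> ` W" for w
      proof -
        obtain x where x: "x \<in> W" "w = \<phi> x" using w by blast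
        then have xU: "x \<in> U0" "x \<in> A" using U0 by (auto simp: W_def)
        define v where "v = (\<lambda>s. \<psi> (f s))"
        have "reg v x" using regA[OF xU(2)] cV(3) by (auto simp: v_def f_def)
        then have an: "(\<lambda>z. v (inv_into U0 \<phi> (\<phi> x + z))) analytic_on {0}"
          using reg_chart[OF U0(1) xU(1)] by blast
        have "((\<lambda>z. v (inv_into U0 \<phi> (\<phi> x + z))) \<circ> (\<lambda>w'. w' - \<phi> x)) analytic_on {w}"
          by (rule analytic_on_compose) (use an x in \<open>auto intro!: analytic_intros\<close>)
        then have an': "(\<lambda>w'. v (inv_into U0 \<phi> w')) analytic_on {w}" by (simp add: o_def)
        have "\<forall>\<^sub>F w' in nhds w. w' \<in> \<phi> ` W" using oW w by (rule eventually_nhds_in_open)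
        then have "\<forall>\<^sub>F w' in nhds w. k w' = v (inv_into U0 \<phi> w')"
        proof eventually_elim
          case (elim w')
          then obtain y where y: "y \<in> W" "w' = \<phi> y" by blast
          then have "inv_into U0 \<phi> w' = y" using inv_into_f_f[OF c0(3), of y] U0 by (auto simp: W_def)
          then show ?case using kW y by (simp add: v_def)
        qed
        then show ?thesis using an' analytic_at_cong[of k "\<lambda>w'. v (inv_into U0 \<phi> w')" w w] by blast
      qed
      then show ?thesis by (meson analytic_imp_holomorphic analytic_on_analytic_at)
    qed
    have injk: "inj_on k (\<phi> ` W)"
    proof (rule inj_onI)
      fix w w' assume w: "w \<in> \<phi> ` W" "w' \<in> \<phi> ` W" "k w = k w'"
      then obtain x x' where x: "x \<in> W" "w = \<phi> x" and x': "x' \<in> W" "w' = \<phi> x'" by blast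
      have "\<psi> (f x) = \<psi> (f x')" using w(3) kW x x' by simp
      then have "f x = f x'" using inj_onD[OF cV(2)] x(1) x'(1) by (auto simp: W_def)
      then have "x = x'" using inj_onD[OF inj] x(1) x'(1) UA by (auto simp: W_def)
      then show "w = w'" using x x' by simp
    qed
    obtain h where h: "h holomorphic_on k ` \<phi> ` W" "\<forall>z\<in>\<phi> ` W. h (k z) = z"
      by (rule holomorphic_has_inverse[OF hol oW injk]) blast
    have img: "k ` \<phi> ` W = \<psi> ` {q \<in> V. g q \<in> U}"
    proof (intro equalityI subsetI)
      fix w assume "w \<in> k ` \<phi> ` W"
      then obtain x where x: "x \<in> W" "w = \<psi> (f x)" using kW by auto
      then have "g (f x) = x" using gf UA by (auto simp: W_def)
      then show "w \<in> \<psi> ` {q \<in> V. g q \<in> U}" using x by (auto simp: W_def)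
    next
      fix w assume "w \<in> \<psi> ` {q \<in> V. g q \<in> U}"
      then obtain q where q: "q \<in> V" "g q \<in> U" "w = \<psi> q" by blast
      then have fq: "f (g q) = q" using fg(1)[of q] VC by blast
      then have "g q \<in> W" using q by (simp add: W_def)
      moreover have "w = k (\<phi> (g q))" using kW[OF calculation] fq q by simp
      ultimately show "w \<in> k ` \<phi> ` W" by blast
    qed
    have "(\<phi> \<circ> g \<circ> inv_into V \<psi>) holomorphic_on k ` \<phi> ` W"
    proof (rule holomorphic_transform[OF h(1)])
      fix w assume "w \<in> k ` \<phi> ` W"
      then obtain x where x: "x \<in> W" "w = k (\<phi> x)" by blast
      then have "w = \<psi> (f x)" using kW by simp
      then have "inv_into V \<psi> w = f x" using inv_into_f_f[OF cV(2)] x by (auto simp: W_def)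
      moreover have "g (f x) = x" using gf x UA by (auto simp: W_def)
      moreover have "h w = \<phi> x" using h(2) x by simp
      ultimately show "h w = (\<phi> \<circ> g \<circ> inv_into V \<psi>) w" by simp
    qed
    then have "(\<phi> \<circ> g \<circ> inv_into V \<psi>) holomorphic_on \<psi> ` {q \<in> V. g q \<in> U}" by (simp only: img)
    then show ?thesis using hol unfolding k_def W_def by (rule conjI[rotated])
  qed
  have "holomorphic_map R (regular_curve F) f" "holomorphic_map (regular_curve F) R g"
    unfolding holomorphic_map_def topC using contf contg charts by blast+
  then have "biholomorphic_maps R (regular_curve F) f g"
    unfolding biholomorphic_maps_def ptsR ptsC by (intro conjI ballI gf fg)
  then show ?thesis unfolding isomorphic_surfaces_def R_def A_def by blast
qed

end

section \<open>Roots of unity and smoothness of the affine curve\<close>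

lemma prime_root_of_unity:
  fixes \<omega> :: complex
  assumes "prime p" "\<omega> ^ p = 1" "\<omega> \<noteq> 1" "\<omega> ^ j = 1" shows "p dvd j"
proof (rule ccontr)
  assume "\<not> p dvd j"
  then have "coprime j p" using assms(1) by (metis coprime_commute prime_imp_coprime)
  then obtain a where "[j * a = Suc 0] (mod p)" using cong_solve_coprime_nat by blast
  then have m: "(j * a) mod p = 1" using prime_gt_1_nat[OF assms(1)] by (simp add: cong_def)
  have "\<omega> ^ (j * a) = \<omega> ^ (p * ((j * a) div p) + (j * a) mod p)" by simp
  also have "\<dots> = \<omega>" unfolding power_add power_mult assms(2) m by simp
  finally show False using assms(3,4) by (simp add: power_mult)
qed

text \<open>The first \<open>p\<close> powers of \<open>\<omega>\<close> are distinct because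
  \<open>p\<close> is prime, so they exhaust the p-th roots of unity.\<close>

lemma prime_root_powers:
  fixes \<omega> w :: complex
  assumes "prime p" "\<omega> ^ p = 1" "\<omega> \<noteq> 1" "w ^ p = 1" shows "\<exists>j. w = \<omega> ^ j"
proof -
  have p0: "p > 0" using assms(1) by (rule prime_gt_0_nat)
  have w0: "\<omega> \<noteq> 0" using assms(2) p0 by (auto simp: power_0_left)
  have ne: "\<omega> ^ i \<noteq> \<omega> ^ j" if "i < j" "j < p" for i j
  proof
    assume eq: "\<omega> ^ i = \<omega> ^ j"
    have "\<omega> ^ j = \<omega> ^ i * \<omega> ^ (j - i)" using that by (simp add: power_add[symmetric])
    then have "\<omega> ^ (j - i) = 1" using eq w0 by simp
    then have "p dvd j - i" by (rule prime_root_of_unity[OF assms(1-3)])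
    then show False using that by (auto dest: dvd_imp_le)
  qed
  have inj: "inj_on (\<lambda>j. \<omega> ^ j) {..<p}" by (rule linorder_inj_onI) (use ne in auto)
  have "(\<omega> ^ j) ^ p = 1" for j
    by (simp only: power_mult[symmetric] mult.commute[of j p]) (simp add: power_mult assms(2))
  then have sub: "(\<lambda>j. \<omega> ^ j) ` {..<p} \<subseteq> {z. z ^ p = 1}" by blast
  have "card {z::complex. z ^ p = 1} = p" by (rule card_nth_roots) (use p0 in auto)
  then have "(\<lambda>j. \<omega> ^ j) ` {..<p} = {z. z ^ p = 1}"
    using card_image[OF inj] finite_nth_roots[OF p0] by (intro card_subset_eq sub) auto
  then show ?thesis using assms(4) by blast
qed

lemma complex_root_exists: assumes "n > 0" shows "\<exists>z::complex. z ^ n = w"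
proof (cases "w = 0")
  case False
  have "exp (Ln w / of_nat n) ^ n = exp (of_nat n * (Ln w / of_nat n))" by (subst exp_of_nat_mult) simp
  also have "of_nat n * (Ln w / of_nat n) = Ln w" using assms by simp
  finally show ?thesis using False by auto
qed (use assms in auto)

text \<open>Where \<open>y \<noteq> 0\<close> the derivative in \<open>y\<close> is nonzero. Where
  \<open>y = 0\<close> exactly one factor vanishes, because \<open>a ^ p\<close> and
  \<open>- 1 / a ^ p\<close> differ, and \<open>x\<close> is a simple root of it since
  \<open>x \<noteq> 0\<close>.\<close>

lemma curve_regular_points:
  fixes a :: complex
  assumes p: "p > 0" and a: "a \<noteq> 0" "a ^ p + 1 / a ^ p \<noteq> 0"
  defines "F \<equiv> \<lambda>x y. y ^ 2 - (x ^ p - a ^ p) * (x ^ p + 1 / a ^ p)"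
  shows "regular_points F = {(x, y). F x y = 0}"
proof -
  have "deriv (\<lambda>u. F u y) x \<noteq> 0 \<or> deriv (\<lambda>v. F x v) y \<noteq> 0" if F0: "F x y = 0" for x y
  proof (cases "y = 0")
    case False
    have "((\<lambda>v. F x v) has_field_derivative 2 * y) (at y)"
      unfolding F_def by (auto intro!: derivative_eq_intros)
    then have "deriv (\<lambda>v. F x v) y = 2 * y" by (rule DERIV_imp_deriv)
    then show ?thesis using False by simp
  next
    case True
    have "((\<lambda>u. F u y) has_field_derivative
        - (of_nat p * x ^ (p - 1) * (x ^ p + 1 / a ^ p) + (x ^ p - a ^ p) * (of_nat p * x ^ (p - 1)))) (at x)"
      unfolding F_def by (auto intro!: derivative_eq_intros)
    then have d: "deriv (\<lambda>u. F u y) x =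
        - (of_nat p * x ^ (p - 1) * (x ^ p + 1 / a ^ p) + (x ^ p - a ^ p) * (of_nat p * x ^ (p - 1)))"
      by (rule DERIV_imp_deriv)
    have "(x ^ p - a ^ p) * (x ^ p + 1 / a ^ p) = 0" using F0 True by (simp add: F_def)
    then consider "x ^ p = a ^ p" | "x ^ p = - (1 / a ^ p)" by (auto simp: eq_neg_iff_add_eq_0)
    then show ?thesis
    proof cases
      case 1
      then have "x \<noteq> 0" using a(1) p by (auto simp: power_0_left)
      then show ?thesis using a(2) p unfolding d 1 by simp
    next
      case 2
      then have "x \<noteq> 0" using a(1) p by (auto simp: power_0_left)
      moreover have "- (1 / a ^ p) - a ^ p = - (a ^ p + 1 / a ^ p)" by simp
      then have "- (1 / a ^ p) - a ^ p \<noteq> 0" using a(2) by (simp only: neg_equal_0_iff_equal not_False_eq_True)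
      ultimately show ?thesis using p unfolding d 2 by simp
    qed
  qed
  then show ?thesis by (auto simp: regular_points_def)
qed

theorem proposition11p1:
  fixes p :: nat and S :: "'a surface"
  assumes "prime p" and "odd p"
    and "S \<in> gimel p"
    and "hyperelliptic S"
  shows "\<exists>a::complex. a \<noteq> 0 \<and>
    represented_by_curve S (\<lambda>x y. y ^ 2 - (x ^ p - a ^ p) * (x ^ p + 1 / a ^ p))"
proof -
  obtain T Q where T: "automorphism_of_order S T p" "card {x \<in> points S. T x = x} = 4"
    and Q: "quotient_surface S T Q" "isomorphic_surfaces Q riemann_sphere"
    and crs: "compact_riemann_surface S"
    using assms(3) by (auto simp: gimel_def)
  obtain f where f: "holomorphic_map S riemann_sphere f" "has_degree S riemann_sphere f 2"
    using assms(4) by (auto simp: hyperelliptic_def)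
  interpret surface_aut S T p
    by unfold_locales (use crs T assms(1,2) in \<open>auto simp: compact_riemann_surface_def\<close>)
  have p0: "p > 0" using p_gt by simp
  obtain G H \<omega> c l1 l2 P3 P4 where \<omega>: "\<omega> ^ p = 1" "\<omega> \<noteq> 1" and c: "c \<noteq> 0" and l: "l1 \<noteq> 0" "l2 \<noteq> 0" "l1 \<noteq> l2"
    and PS: "P3 \<in> points S" "P4 \<in> points S" and poleG: "oe G P3 (- 1)" "oe G P4 (- 1)"
    and all: "\<forall>x\<in>points S - {P3, P4}. reg G x \<and> reg H x \<and> H x \<noteq> 0 \<and> T x \<notin> {P3, P4} \<and> G (T x) = \<omega> * G x \<and> H (T x) = H x
        \<and> G x ^ p * H x = c * (H x - l1) * (H x - l2) \<and> (G x = 0 \<longrightarrow> T x = x)"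
    and inj: "\<forall>x\<in>points S - {P3, P4}. \<forall>y\<in>points S - {P3, P4}. H x = H y \<longrightarrow> (\<exists>j. y = (T ^^ j) x)"
    and sur: "\<forall>\<eta>. \<eta> \<noteq> 0 \<longrightarrow> (\<exists>x\<in>points S - {P3, P4}. H x = \<eta>)"
    by (rule superelliptic_model[OF f Q])
  define Z where "Z = {P3, P4}"
  define m where "m = l1 * l2"
  define e where "e = l1 + l2"
  define \<mu> where "\<mu> = csqrt m"
  have \<mu>2: "\<mu>\<^sup>2 = m" by (simp add: \<mu>_def)
  have m0: "m \<noteq> 0" using l by (simp add: m_def)
  then have \<mu>0: "\<mu> \<noteq> 0" using \<mu>2 by auto
  \<comment> \<open>\<open>A\<close> and \<open>B\<close> are the values of
    \<open>c * (h + m/h - e)\<close> at its critical points \<open>h = \<mu>\<close> and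
    \<open>h = - \<mu>\<close>, that is, where the quadratic equation for \<open>h\<close> has a
    double root.\<close>
  define A where "A = c * (2 * \<mu> - e)"
  define B where "B = c * (- 2 * \<mu> - e)"
  have "A * B = c\<^sup>2 * (e\<^sup>2 - 4 * \<mu>\<^sup>2)" by (simp add: A_def B_def power2_eq_square algebra_simps)
  also have "e\<^sup>2 - 4 * \<mu>\<^sup>2 = (l1 - l2)\<^sup>2" unfolding \<mu>2 by (simp add: e_def m_def power2_eq_square algebra_simps)
  finally have AB: "A * B \<noteq> 0" using c l by simp
  have AmB: "A \<noteq> B" using c \<mu>0 by (simp add: A_def B_def)
  \<comment> \<open>The scaling factor that makes the product of \<open>\<tau> * A\<close> and
    \<open>\<tau> * B\<close> equal to -1, as the shape of the curve demands.\<close>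
  define \<tau> where "\<tau> = csqrt (- 1 / (A * B))"
  have \<tau>2: "\<tau>\<^sup>2 * (A * B) = - 1" using AB by (simp add: \<tau>_def)
  then have \<tau>0: "\<tau> \<noteq> 0" by auto
  obtain \<kappa> where \<kappa>: "\<kappa> ^ p = \<tau>" using complex_root_exists[OF p0] by blast
  then have \<kappa>0: "\<kappa> \<noteq> 0" using \<tau>0 p0 by auto
  \<comment> \<open>With this choice \<open>- 1 / a ^ p\<close> is \<open>\<tau> * B\<close>, so
    both factors of the curve are determined by \<open>a\<close>.\<close>
  obtain a where a: "a ^ p = \<tau> * A" using complex_root_exists[OF p0] by blast
  have a0: "a \<noteq> 0" using a \<tau>0 AB p0 by (auto simp: power_0_left)
  have ia: "1 / (\<tau> * A) = - (\<tau> * B)"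
  proof -
    have "\<tau> * A * (- (\<tau> * B)) = - (\<tau>\<^sup>2 * (A * B))" by (simp add: power2_eq_square)
    also have "\<dots> = 1" unfolding \<tau>2 by simp
    finally have "\<tau> * A * (- (\<tau> * B)) = 1" .
    moreover have "\<tau> * A \<noteq> 0" using \<tau>0 AB by simp
    ultimately show ?thesis by (metis nonzero_mult_div_cancel_left)
  qed
  define F where "F = (\<lambda>x y. y ^ 2 - (x ^ p - a ^ p) * (x ^ p + 1 / a ^ p))"
  have "a ^ p + 1 / a ^ p = \<tau> * (A - B)" unfolding a ia by (simp add: algebra_simps)
  then have C: "regular_points F = {(x, y). F x y = 0}"
    unfolding F_def using \<tau>0 AmB by (intro curve_regular_points p0 a0) simp
  define X where "X = (\<lambda>s. \<kappa> * G s)"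
  define Y where "Y = (\<lambda>s. \<tau> * c * (H s - m / H s))"
  have t: "G s ^ p = c * (H s + m / H s - e)" if "s \<in> points S - Z" for s
  proof -
    have h: "H s \<noteq> 0" "G s ^ p * H s = c * (H s - l1) * (H s - l2)" using all that by (auto simp: Z_def)
    then have "G s ^ p = c * ((H s - l1) * (H s - l2)) / H s" by (simp add: field_simps)
    also have "(H s - l1) * (H s - l2) = (H s + m / H s - e) * H s"
      using h(1) by (simp add: m_def e_def field_simps)
    finally show ?thesis using h(1) by simp
  qed
  have Tpow: "(T ^^ j) s \<in> points S - Z \<and> G ((T ^^ j) s) = \<omega> ^ j * G s \<and> H ((T ^^ j) s) = H s"
    if s: "s \<in> points S - Z" for s j
  proof (induction j)
    case (Suc j)
    then have s': "(T ^^ j) s \<in> points S - {P3, P4}" by (simp add: Z_def)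
    show ?case using all[rule_format, OF s'] Suc T_in s' by (simp add: Z_def)
  qed (use s in simp)
  have reg: "reg X s \<and> reg Y s" if s: "s \<in> points S - Z" for s
  proof
    have r: "reg G s" "reg H s" "H s \<noteq> 0" using all s by (auto simp: Z_def)
    show "reg X s" using r(1) unfolding X_def reg_def by (intro analytic_intros)
    show "reg Y s" using r(2,3) s unfolding Y_def reg_def by (intro analytic_intros) (auto simp: par_0)
  qed
  have bij: "bij_betw (\<lambda>s. (X s, Y s)) (points S - Z) (regular_points F)"
    unfolding bij_betw_def
  proof
    show "inj_on (\<lambda>s. (X s, Y s)) (points S - Z)"
    proof (rule inj_onI)
      fix s s' assume s: "s \<in> points S - Z" "s' \<in> points S - Z" and eq: "(X s, Y s) = (X s', Y s')"
      have GG: "G s = G s'" using eq \<kappa>0 by (simp add: X_def)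
      have "H s - m / H s = H s' - m / H s'" using eq \<tau>0 c by (simp add: Y_def)
      moreover have "H s + m / H s - e = H s' + m / H s' - e" using t[OF s(1)] t[OF s(2)] GG c by simp
      \<comment> \<open>The two expressions add up to \<open>2 * H - e\<close>, so \<open>H\<close>
        is recovered from the two coordinates.\<close>
      ultimately have "(H s - m / H s) + (H s + m / H s - e) = (H s' - m / H s') + (H s' + m / H s' - e)"
        by (rule arg_cong2)
      then have "H s = H s'" by simp
      then obtain j where j: "s' = (T ^^ j) s" using inj s unfolding Z_def by blast
      \<comment> \<open>A zero of \<open>G\<close> is fixed by \<open>T\<close>, so every exponent
        \<open>j\<close> is harmless there; elsewhere \<open>j\<close> must be a multiple of
        \<open>p\<close>.\<close>
      show "s = s'"
      proof (cases "G s = 0")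
        case True
        then have "T s = s" using all s(1) by (simp add: Z_def)
        then have "s \<in> FX" using s(1) by (simp add: FX_def)
        from fixed_Tpow[OF this] show ?thesis using j by simp
      next
        case False
        have "G s = \<omega> ^ j * G s" using Tpow[OF s(1), of j] j GG by simp
        then have "\<omega> ^ j = 1" using False by simp
        then have "p dvd j" by (rule prime_root_of_unity[OF assms(1) \<omega>])
        then have "(T ^^ j) s = (T ^^ 0) s" using Tpow_mod[of s j] s(1) by simp
        then show ?thesis using j by simp
      qed
    qed
    show "(\<lambda>s. (X s, Y s)) ` (points S - Z) = regular_points F"
    proof (intro equalityI subsetI)
      fix q assume "q \<in> (\<lambda>s. (X s, Y s)) ` (points S - Z)"
      then obtain s where s: "s \<in> points S - Z" "q = (X s, Y s)" by blast
      \<comment> \<open>With \<open>h * i = \<mu>\<^sup>2\<close> the claim becomes the polynomial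
        identity \<open>(h + i)\<^sup>2 - 4 * h * i = (h - i)\<^sup>2\<close>.\<close>
      define h where "h = H s"
      define i where "i = m / h"
      have "h \<noteq> 0" using all s(1) by (simp add: Z_def h_def)
      then have hi: "h * i = \<mu>\<^sup>2" by (simp add: i_def \<mu>2)
      have "X s ^ p = \<tau> * (c * (h + i - e))" using t[OF s(1)] \<kappa> by (simp add: X_def power_mult_distrib h_def i_def)
      then have "(X s ^ p - a ^ p) * (X s ^ p + 1 / a ^ p)
          = (\<tau> * (c * (h + i - e)) - \<tau> * A) * (\<tau> * (c * (h + i - e)) - \<tau> * B)" unfolding a ia by simp
      also have "\<dots> = \<tau>\<^sup>2 * c\<^sup>2 * ((h + i)\<^sup>2 - 4 * \<mu>\<^sup>2)"
        by (simp add: A_def B_def power2_eq_square algebra_simps)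
      also have "\<dots> = (\<tau> * c * (h - i))\<^sup>2" unfolding hi[symmetric]
        by (simp add: power2_eq_square algebra_simps)
      also have "\<tau> * c * (h - i) = Y s" by (simp only: Y_def h_def i_def)
      finally show "q \<in> regular_points F" unfolding C s(2) by (simp add: F_def)
    next
      fix q assume "q \<in> regular_points F"
      then obtain x y where q: "q = (x, y)" and Fxy: "F x y = 0" unfolding C by blast
      \<comment> \<open>\<open>b\<close> and \<open>d\<close> are the values that
        \<open>H + m/H\<close> and \<open>H - m/H\<close> have to take, so the value of
        \<open>H\<close> must be half their sum, \<open>\<eta>\<close>.\<close>
      define b where "b = x ^ p / (\<tau> * c) + e"
      define d where "d = y / (\<tau> * c)"
      have x: "x ^ p = \<tau> * c * (b - e)" and y: "y = \<tau> * c * d" using \<tau>0 c by (simp_all add: b_def d_def)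
      have "(\<tau> * c * d)\<^sup>2 = (x ^ p - \<tau> * A) * (x ^ p - \<tau> * B)" using Fxy unfolding F_def a ia y by simp
      also have "\<dots> = (\<tau> * c)\<^sup>2 * (b\<^sup>2 - 4 * \<mu>\<^sup>2)" unfolding x by (simp add: A_def B_def power2_eq_square algebra_simps)
      finally have bd: "d\<^sup>2 = b\<^sup>2 - 4 * m" using \<tau>0 c \<mu>2 by (simp add: power_mult_distrib)
      define \<eta> where "\<eta> = (b + d) / 2"
      have "\<eta> * ((b - d) / 2) = (b\<^sup>2 - d\<^sup>2) / 4" by (simp add: \<eta>_def power2_eq_square algebra_simps)
      then have prod: "\<eta> * ((b - d) / 2) = m" using bd by simp
      then have \<eta>0: "\<eta> \<noteq> 0" using m0 by auto
      then have i\<eta>: "m / \<eta> = (b - d) / 2" using prod by (simp add: field_simps)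
      obtain s where s: "s \<in> points S - Z" "H s = \<eta>" using sur \<eta>0 by (auto simp: Z_def)
      have "\<eta> + m / \<eta> = b" "\<eta> - m / \<eta> = d" unfolding i\<eta> by (simp_all add: \<eta>_def field_simps)
      then have Gs: "G s ^ p = c * (b - e)" and Ys: "Y s = y" using t[OF s(1)] s(2) y by (simp_all add: Y_def)
      define x' where "x' = x / \<kappa>"
      have x': "x' ^ p = G s ^ p" using x Gs \<kappa> \<tau>0 by (simp add: x'_def power_divide)
      \<comment> \<open>Moving along the orbit multiplies \<open>G\<close> by powers of
        \<open>\<omega>\<close> and keeps \<open>H\<close>, which corrects the first coordinate
        without changing the second.\<close>
      have "\<exists>j. x' = \<omega> ^ j * G s"
      proof (cases "G s = 0")
        case True
        then have "x' = 0" using x' p0 by (simp add: power_0_left)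
        then show ?thesis using True by simp
      next
        case False
        then have "(x' / G s) ^ p = 1" using x' by (simp add: power_divide)
        then obtain j where "x' / G s = \<omega> ^ j" using prime_root_powers[OF assms(1) \<omega>] by blast
        then have "x' = \<omega> ^ j * G s" using False by (simp add: field_simps)
        then show ?thesis ..
      qed
      then obtain j where j: "x' = \<omega> ^ j * G s" ..
      note Tj = Tpow[OF s(1), of j]
      have "X ((T ^^ j) s) = x" using Tj j \<kappa>0 by (simp add: X_def x'_def field_simps)
      moreover have "Y ((T ^^ j) s) = y" using Tj Ys by (simp add: Y_def)
      ultimately show "q \<in> (\<lambda>s. (X s, Y s)) ` (points S - Z)" using Tj q by force
    qed
  qed
  have pole: "filterlim (\<lambda>z. X (par x z)) at_infinity (at 0)" if "x \<in> Z" for x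
  proof (rule ord_eq_neg_filterlim)
    have "oe G x (- 1)" using that poleG by (auto simp: Z_def)
    from ord_eq_mult[OF ord_eq_const[OF \<kappa>0] this] show "oe X x (- 1)" by (simp add: X_def)
  qed simp
  have "isomorphic_surfaces (restrict_surface S (points S - Z)) (regular_curve F)"
    by (rule isomorphic_to_curve[OF _ _ reg bij pole]) (use PS in \<open>auto simp: Z_def\<close>)
  moreover have "finite Z" "Z \<subseteq> points S" using PS by (auto simp: Z_def)
  ultimately have "represented_by_curve S F" unfolding represented_by_curve_def using crs by blast
  then show ?thesis using a0 unfolding F_def by blast
qed

end
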